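(* Let $k$ be an algebraically closed field of characteristic $2$, $S=\mathbf{V}(g)\subset\mathbb{A}^3$ with $g = x^2+y^2z+yz^2+xyz$, and $m\ge 5$. Let $R_m = k[x_0,\dots,x_m,y_0,\dots,y_m,z_0,\dots,z_m]$, $(\mathbb{A}^3)_m=\mathrm{Spec}\,R_m$, and define $g^{(j)}\in R_m$ by $g(\sum_{i=0}^m x_it^i,\sum_{i=0}^m y_it^i,\sum_{i=0}^m z_it^i)=\sum_{j=0}^m g^{(j)}t^j$ in $R_m[t]/\langle t^{m+1}\rangle$. Let $S_m^0=\mathbf{V}(x_0,y_0,z_0,g^{(0)},\dots,g^{(m)})$ be the singular fiber of the $m$-th jet scheme $S_m=\mathrm{Spec}\,R_m/\langle g^{(0)},\dots,g^{(m)}\rangle$ (the fiber over $0$ of the truncation $S_m\to S$). Define $I_m^0 = \langle x_0,x_1,x_2,y_0,y_1,z_0,z_1\rangle + \langle g^{(0)},\dots,g^{(m)}\rangle$, $I_m^1 = J_m^1 (R_m)_{z_1}\cap R_m$, $I_m^2 = J_m^2 (R_m)_{y_1}\cap R_m$, $I_m^3 = J_m^3 (R_m)_{y_1}\cap R_m$, where $J_m^1 = \langle x_0,x_1,y_0,y_1,z_0\rangle + \langle g^{(0)},\dots,g^{(m)}\rangle$, $J_m^2 = \langle x_0,x_1,y_0,z_0,z_1\rangle + \langle g^{(0)},\dots,g^{(m)}\rangle$, $J_m^3 = \langle x_0,x_1,y_0,z_0,y_1+z_1\rangle + \langle g^{(0)},\dots,g^{(m)}\rangle$, and $Z_m^i=\mathbf{V}(I_m^i)$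 for $i=0,1,2,3$. Then the irreducible decomposition of $S_m^0$ is $$S_m^0=Z_m^0\cup Z_m^1\cup Z_m^2\cup Z_m^3.$$
   Context: $(R_m)_h$ is the localization at powers of $h$, $J(R_m)_h\cap R_m$ the preimage in $R_m$ of the extended ideal, and $\mathbf{V}(\cdot)$ the zero set in $(\mathbb{A}^3)_m$. $S$ has a rational double point of type $D_4^1$ at the origin. *)

theory Defs
  imports "HOL-Computational_Algebra.Computational_Algebra"
begin

text \<open>A k-point of the jet space (A^3)_m is recorded as three coefficient sequences
  (x_i)_i, (y_i)_i, (z_i)_i; only indices i \<le> m are coordinates, the rest are 0.\<close>
type_synonym 'k jpt = "(nat \<Rightarrow> 'k) \<times> (nat \<Rightarrow> 'k) \<times> (nat \<Rightarrow> 'k)"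

definition jet_space :: "nat \<Rightarrow> 'k::zero jpt set" where
  "jet_space m = {(a, b, c). \<forall>i>m. a i = 0 \<and> b i = 0 \<and> c i = 0}"

definition xv :: "nat \<Rightarrow> 'k jpt \<Rightarrow> 'k" where "xv i = (\<lambda>(a, b, c). a i)"
definition yv :: "nat \<Rightarrow> 'k jpt \<Rightarrow> 'k" where "yv i = (\<lambda>(a, b, c). b i)"
definition zv :: "nat \<Rightarrow> 'k jpt \<Rightarrow> 'k" where "zv i = (\<lambda>(a, b, c). c i)"

text \<open>The coordinate ring R_m = k[x_0..x_m, y_0..y_m, z_0..z_m], realised as the ring of
  polynomial functions (k is infinite, so this is isomorphic to the polynomial ring).\<close>
inductive_set Rm :: "nat \<Rightarrow> ('k::comm_ring_1 jpt \<Rightarrow> 'k) set" for m :: nat where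
  const: "(\<lambda>_. c) \<in> Rm m"
| varx: "i \<le> m \<Longrightarrow> xv i \<in> Rm m"
| vary: "i \<le> m \<Longrightarrow> yv i \<in> Rm m"
| varz: "i \<le> m \<Longrightarrow> zv i \<in> Rm m"
| add: "f \<in> Rm m \<Longrightarrow> g \<in> Rm m \<Longrightarrow> (\<lambda>p. f p + g p) \<in> Rm m"
| mult: "f \<in> Rm m \<Longrightarrow> g \<in> Rm m \<Longrightarrow> (\<lambda>p. f p * g p) \<in> Rm m"

inductive_set gen_ideal :: "nat \<Rightarrow> ('k::comm_ring_1 jpt \<Rightarrow> 'k) set \<Rightarrow> ('k jpt \<Rightarrow> 'k) set"
  for m :: nat and F :: "('k jpt \<Rightarrow> 'k) set" where
  zero: "(\<lambda>_. 0) \<in> gen_ideal m F"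
| gen: "f \<in> F \<Longrightarrow> f \<in> gen_ideal m F"
| add: "f \<in> gen_ideal m F \<Longrightarrow> g \<in> gen_ideal m F \<Longrightarrow> (\<lambda>p. f p + g p) \<in> gen_ideal m F"
| smult: "h \<in> Rm m \<Longrightarrow> f \<in> gen_ideal m F \<Longrightarrow> (\<lambda>p. h p * f p) \<in> gen_ideal m F"

text \<open>J (R_m)_h \<inter> R_m: the saturation of J with respect to h.\<close>
definition saturate :: "nat \<Rightarrow> ('k::comm_ring_1 jpt \<Rightarrow> 'k) set \<Rightarrow> ('k jpt \<Rightarrow> 'k) \<Rightarrow> ('k jpt \<Rightarrow> 'k) set" where
  "saturate m J h = {f \<in> Rm m. \<exists>N::nat. (\<lambda>p. h p ^ N * f p) \<in> J}"

definition zero_set :: "nat \<Rightarrow> ('k::comm_ring_1 jpt \<Rightarrow> 'k) set \<Rightarrow> 'k jpt set" where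
  "zero_set m F = {p \<in> jet_space m. \<forall>f\<in>F. f p = 0}"

definition zariski_closed :: "nat \<Rightarrow> 'k::comm_ring_1 jpt set \<Rightarrow> bool" where
  "zariski_closed m Z \<longleftrightarrow> (\<exists>F \<subseteq> Rm m. Z = zero_set m F)"

definition irreducible_closed :: "nat \<Rightarrow> 'k::comm_ring_1 jpt set \<Rightarrow> bool" where
  "irreducible_closed m Z \<longleftrightarrow> zariski_closed m Z \<and> Z \<noteq> {} \<and>
     (\<forall>A B. zariski_closed m A \<longrightarrow> zariski_closed m B \<longrightarrow> Z \<subseteq> A \<union> B \<longrightarrow> Z \<subseteq> A \<or> Z \<subseteq> B)"

definition gpoly :: "'a::comm_ring_1 \<Rightarrow> 'a \<Rightarrow> 'a \<Rightarrow> 'a" where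
  "gpoly x y z = x^2 + y^2 * z + y * z^2 + x * y * z"

definition arc :: "nat \<Rightarrow> (nat \<Rightarrow> 'k::comm_ring_1) \<Rightarrow> 'k fps" where
  "arc m a = Abs_fps (\<lambda>i. if i \<le> m then a i else 0)"

text \<open>g^(j): the coefficient of t^j (j \<le> m, so computing in k[[t]] agrees with k[t]/(t^(m+1))).\<close>
definition gj :: "nat \<Rightarrow> nat \<Rightarrow> 'k::comm_ring_1 jpt \<Rightarrow> 'k" where
  "gj m j = (\<lambda>(a, b, c). fps_nth (gpoly (arc m a) (arc m b) (arc m c)) j)"

definition Gm :: "nat \<Rightarrow> ('k::comm_ring_1 jpt \<Rightarrow> 'k) set" where
  "Gm m = {gj m j | j. j \<le> m}"

definition S0 :: "nat \<Rightarrow> 'k::comm_ring_1 jpt set" where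
  "S0 m = zero_set m ({xv 0, yv 0, zv 0} \<union> Gm m)"

definition I0 :: "nat \<Rightarrow> ('k::comm_ring_1 jpt \<Rightarrow> 'k) set" where
  "I0 m = gen_ideal m ({xv 0, xv 1, xv 2, yv 0, yv 1, zv 0, zv 1} \<union> Gm m)"

definition J1 :: "nat \<Rightarrow> ('k::comm_ring_1 jpt \<Rightarrow> 'k) set" where
  "J1 m = gen_ideal m ({xv 0, xv 1, yv 0, yv 1, zv 0} \<union> Gm m)"

definition J2 :: "nat \<Rightarrow> ('k::comm_ring_1 jpt \<Rightarrow> 'k) set" where
  "J2 m = gen_ideal m ({xv 0, xv 1, yv 0, zv 0, zv 1} \<union> Gm m)"

definition J3 :: "nat \<Rightarrow> ('k::comm_ring_1 jpt \<Rightarrow> 'k) set" where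
  "J3 m = gen_ideal m ({xv 0, xv 1, yv 0, zv 0, (\<lambda>p. yv 1 p + zv 1 p)} \<union> Gm m)"

definition I1 :: "nat \<Rightarrow> ('k::comm_ring_1 jpt \<Rightarrow> 'k) set" where
  "I1 m = saturate m (J1 m) (zv 1)"
definition I2 :: "nat \<Rightarrow> ('k::comm_ring_1 jpt \<Rightarrow> 'k) set" where
  "I2 m = saturate m (J2 m) (yv 1)"
definition I3 :: "nat \<Rightarrow> ('k::comm_ring_1 jpt \<Rightarrow> 'k) set" where
  "I3 m = saturate m (J3 m) (yv 1)"

definition Zm :: "nat \<Rightarrow> nat \<Rightarrow> 'k::comm_ring_1 jpt set" where
  "Zm m i = zero_set m (if i = 0 then I0 m else if i = 1 then I1 m else if i = 2 then I2 m else I3 m)"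

definition irreducible_decomposition :: "nat \<Rightarrow> 'k::comm_ring_1 jpt set \<Rightarrow> (nat \<Rightarrow> 'k jpt set) \<Rightarrow> nat \<Rightarrow> bool" where
  "irreducible_decomposition m X Z n \<longleftrightarrow>
     X = (\<Union>i<n. Z i) \<and> (\<forall>i<n. irreducible_closed m (Z i)) \<and>
     (\<forall>i<n. \<forall>j<n. i \<noteq> j \<longrightarrow> \<not> Z i \<subseteq> Z j)"

end

theory Submission
  imports Defs
begin

text \<open>
  A jet in the singular fiber has \<open>x\<^sub>1 = 0\<close> and \<open>y\<^sub>1 z\<^sub>1 (y\<^sub>1 + z\<^sub>1) = 0\<close>, which gives the four pieces. Where one
  of the three linear factors vanishes and another does not, the equations can be solved successively
  for one family of coordinates, so that locus is a graph over an open part of an affine space; its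
  closure is the corresponding component.

  Substituting \<open>(t\<^sup>3 x, t\<^sup>2 y, t\<^sup>2 z)\<close> turns the remaining piece into the jets modulo \<open>t ^ (m - 5)\<close> of
  \<open>x\<^sup>2 + y\<^sup>2 z + y z\<^sup>2 + t x y z\<close>. Its part with \<open>(y\<^sub>0, z\<^sub>0) \<noteq> 0\<close> is again a union of overlapping graphs, and the
  point is that this part is dense. The other jets are stratified by the order \<open>e\<close> of \<open>(y, z)\<close>. If a
  polynomial vanished on the dense part but not at a jet of order 1 or 2, then fixing suitable
  coordinates there would leave a system with more unknowns than equations in whose local ring all
  unknowns are nilpotent, and counting monomials excludes this; higher orders reduce to a smaller truncation order
  by the same substitution. To make everything stable under the symmetries permuting the three
  lines \<open>y z (y + z) = 0\<close>, the cross term is a general \<open>x (A y\<^sup>2 + B y z + C z\<^sup>2)\<close> with \<open>A\<close>, \<open>B\<close>, \<open>C\<close> power series.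
\<close>

section \<open>Locally nilpotent coordinates\<close>

text \<open>The obstacle is density, and the reason behind it is a count of codimensions. A
  component of a locus given by \<open>n\<close> equations has codimension at most \<open>n\<close>.
  Let \<open>e\<close> be at least 1 with \<open>3 * e < n\<close>. Order \<open>e\<close> imposes
  \<open>e\<close> conditions on each of \<open>y\<close> and \<open>z\<close>; the equations then
  force \<open>e + 1\<close> coefficients of \<open>x\<close> to vanish and determine
  \<open>n - 3 * e\<close> further coefficients of \<open>y\<close>. That makes \<open>n + 1\<close>
  conditions, so the stratum is too small to contain a component; for \<open>3 * e \<ge> n\<close>
  the count again exceeds \<open>n\<close>. The bound on the codimension, an instance of Krull's
  height theorem, is proved in elementary form: unknowns that are nilpotent in the local ring of
  \<open>r\<close> equations number at most \<open>r\<close>. The exponents 3, 2, 2 give all terms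
  but the cross term the weight 6 and the cross term the weight 7. So jets of order at least 2 are
  jets of an equation of the same kind with 6 equations fewer and \<open>A\<close>,
  \<open>B\<close>, \<open>C\<close> multiplied by \<open>t\<close>. In particular their constant
  terms become zero, as the density argument requires. The bound \<open>5 \<le> m\<close> makes the
  coefficient of \<open>t^5\<close> available, which separates the component of index 0 from the
  closures of the three line charts.\<close>

inductive_set polys :: "nat \<Rightarrow> ((nat \<Rightarrow> 'k::comm_ring_1) \<Rightarrow> 'k) set" for s :: nat where
  const: "(\<lambda>_. c) \<in> polys s"
| var: "i < s \<Longrightarrow> (\<lambda>w. w i) \<in> polys s"
| add: "f \<in> polys s \<Longrightarrow> g \<in> polys s \<Longrightarrow> (\<lambda>w. f w + g w) \<in> polys s"
| mult: "f \<in> polys s \<Longrightarrow> g \<in> polys s \<Longrightarrow> (\<lambda>w. f w * g w) \<in> polys s"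

lemma polys_sum:
  "finite T \<Longrightarrow> (\<And>i. i \<in> T \<Longrightarrow> f i \<in> polys s) \<Longrightarrow> (\<lambda>w. \<Sum>i\<in>T. f i w) \<in> polys s"
  by (induction T rule: finite_induct) (auto intro: polys.intros)

lemma polys_prod:
  "finite T \<Longrightarrow> (\<And>i. i \<in> T \<Longrightarrow> f i \<in> polys s) \<Longrightarrow> (\<lambda>w. \<Prod>i\<in>T. f i w) \<in> polys s"
  by (induction T rule: finite_induct) (auto intro: polys.intros)

lemma polys_power: "f \<in> polys s \<Longrightarrow> (\<lambda>w. f w ^ n) \<in> polys s"
  by (induction n) (auto intro: polys.intros)

definition monom_fun :: "nat \<Rightarrow> (nat \<Rightarrow> nat) \<Rightarrow> (nat \<Rightarrow> 'k::comm_ring_1) \<Rightarrow> 'k" where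
  "monom_fun s \<beta> w = (\<Prod>i<s. w i ^ \<beta> i)"

lemma monom_fun_polys: "monom_fun s \<beta> \<in> polys s"
  unfolding monom_fun_def[abs_def] by (intro polys_prod polys_power polys.var) auto

lemma monom_fun_mult: "monom_fun s \<beta> w * monom_fun s \<gamma> w = monom_fun s (\<lambda>i. \<beta> i + \<gamma> i) w"
  by (simp add: monom_fun_def power_add prod.distrib)

text \<open>Polynomials are stored as functions and have no coefficients to inspect. A normal form
  as a sum of scaled monomials, without uniqueness, is all that the later reduction of exponents
  uses.\<close>

inductive_set monom_span :: "nat \<Rightarrow> ((nat \<Rightarrow> 'k::comm_ring_1) \<Rightarrow> 'k) set" for s :: nat where
  monom: "(\<lambda>w. c * monom_fun s \<beta> w) \<in> monom_span s"
| add: "f \<in> monom_span s \<Longrightarrow> g \<in> monom_span s \<Longrightarrow> (\<lambda>w. f w + g w) \<in> monom_span s"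

lemma monom_span_mult_monom:
  assumes "g \<in> monom_span s"
  shows "(\<lambda>w. c * monom_fun s \<beta> w * g w) \<in> monom_span s"
  using assms
proof induction
  case (monom d \<gamma>)
  have "(\<lambda>w. c * monom_fun s \<beta> w * (d * monom_fun s \<gamma> w)) =
        (\<lambda>w. (c * d) * monom_fun s (\<lambda>i. \<beta> i + \<gamma> i) w)"
    by (auto simp flip: monom_fun_mult simp: algebra_simps)
  then show ?case by (simp only: monom_span.monom)
next
  case (add f g)
  then show ?case using monom_span.add[OF add.IH] by (simp add: algebra_simps)
qed

lemma monom_span_mult:
  assumes "f \<in> monom_span s" "g \<in> monom_span s"
  shows "(\<lambda>w. f w * g w) \<in> monom_span s"
  using assms(1)
proof induction
  case (monom c \<beta>)
  then show ?case using monom_span_mult_monom[OF assms(2)] by simp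
next
  case (add f1 f2)
  then show ?case using monom_span.add[OF add.IH] by (simp add: algebra_simps)
qed

lemma polys_subset_monom_span: "f \<in> polys s \<Longrightarrow> f \<in> monom_span s"
proof (induction rule: polys.induct)
  case (const c)
  have "(\<lambda>_::nat \<Rightarrow> 'a. c) = (\<lambda>w. c * monom_fun s (\<lambda>_. 0) w)" by (simp add: monom_fun_def)
  then show ?case by (simp only: monom_span.monom)
next
  case (var i)
  have "(\<lambda>w::nat \<Rightarrow> 'a. w i) = (\<lambda>w. 1 * monom_fun s (\<lambda>j. if j = i then 1 else 0) w)"
  proof
    fix w :: "nat \<Rightarrow> 'a"
    have "monom_fun s (\<lambda>j. if j = i then 1 else 0) w = (\<Prod>j<s. if j = i then w j else 1)"
      unfolding monom_fun_def by (rule prod.cong) auto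
    then show "w i = 1 * monom_fun s (\<lambda>j. if j = i then 1 else 0) w" using var by simp
  qed
  then show ?case by (simp only: monom_span.monom)
qed (auto intro: monom_span.add monom_span_mult)

text \<open>Vanishing to order at least \<open>L\<close> at the origin, tested on every line through
  it, so that only polynomials in one variable occur and no homogeneous components are
  needed.\<close>

definition ord_ge :: "nat \<Rightarrow> ((nat \<Rightarrow> 'k::comm_ring_1) \<Rightarrow> 'k) \<Rightarrow> bool" where
  "ord_ge L F \<longleftrightarrow> (\<forall>w. \<exists>Q. \<forall>c. F (\<lambda>i. c * w i) = c ^ L * poly Q c)"

lemma ord_ge_0: "F \<in> polys s \<Longrightarrow> ord_ge 0 F"
  unfolding ord_ge_def
proof (induction rule: polys.induct)
  case (const c)
  show ?case by (auto intro!: exI[of _ "[:c:]"])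
next
  case (var i)
  show ?case
  proof
    fix w :: "nat \<Rightarrow> 'a"
    show "\<exists>Q. \<forall>c. c * w i = c ^ 0 * poly Q c"
      by (auto intro!: exI[of _ "[:0, w i:]"])
  qed
next
  case (add f g)
  show ?case
  proof
    fix w
    obtain P Q where "\<forall>c. f (\<lambda>i. c * w i) = c ^ 0 * poly P c" "\<forall>c. g (\<lambda>i. c * w i) = c ^ 0 * poly Q c"
      using add.IH by meson
    then show "\<exists>Q. \<forall>c. f (\<lambda>i. c * w i) + g (\<lambda>i. c * w i) = c ^ 0 * poly Q c"
      by (auto intro!: exI[of _ "P + Q"])
  qed
next
  case (mult f g)
  show ?case
  proof
    fix w
    obtain P Q where "\<forall>c. f (\<lambda>i. c * w i) = c ^ 0 * poly P c" "\<forall>c. g (\<lambda>i. c * w i) = c ^ 0 * poly Q c"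
      using mult.IH by meson
    then show "\<exists>Q. \<forall>c. f (\<lambda>i. c * w i) * g (\<lambda>i. c * w i) = c ^ 0 * poly Q c"
      by (auto intro!: exI[of _ "P * Q"])
  qed
qed

lemma ord_ge_1:
  assumes "F \<in> polys s" "F (\<lambda>_. 0) = 0"
  shows "ord_ge 1 F"
  unfolding ord_ge_def
proof
  fix w :: "nat \<Rightarrow> 'a"
  obtain Q where Q: "\<And>c. F (\<lambda>i. c * w i) = poly Q c"
    using ord_ge_0[OF assms(1)] unfolding ord_ge_def by auto
  have "poly Q 0 = 0" using Q[of 0] assms(2) by simp
  then obtain Q' where "Q = [:0, 1:] * Q'" by (auto simp: poly_eq_0_iff_dvd)
  then have "\<forall>c. F (\<lambda>i. c * w i) = c ^ 1 * poly Q' c" using Q by simp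
  then show "\<exists>Q. \<forall>c. F (\<lambda>i. c * w i) = c ^ 1 * poly Q c" ..
qed

lemma ord_ge_mult:
  assumes "ord_ge a F" "ord_ge b G"
  shows "ord_ge (a + b) (\<lambda>w. F w * G w)"
  unfolding ord_ge_def
proof
  fix w
  obtain P Q where "\<And>c. F (\<lambda>i. c * w i) = c ^ a * poly P c" "\<And>c. G (\<lambda>i. c * w i) = c ^ b * poly Q c"
    using assms unfolding ord_ge_def by metis
  then have "\<forall>c. F (\<lambda>i. c * w i) * G (\<lambda>i. c * w i) = c ^ (a + b) * poly (P * Q) c"
    by (simp add: power_add algebra_simps)
  then show "\<exists>Q. \<forall>c. F (\<lambda>i. c * w i) * G (\<lambda>i. c * w i) = c ^ (a + b) * poly Q c" ..
qed

lemma ord_ge_add: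
  assumes "ord_ge a F" "ord_ge a G"
  shows "ord_ge a (\<lambda>w. F w + G w)"
  unfolding ord_ge_def
proof
  fix w
  obtain P Q where "\<And>c. F (\<lambda>i. c * w i) = c ^ a * poly P c" "\<And>c. G (\<lambda>i. c * w i) = c ^ a * poly Q c"
    using assms unfolding ord_ge_def by metis
  then have "\<forall>c. F (\<lambda>i. c * w i) + G (\<lambda>i. c * w i) = c ^ a * poly (P + Q) c"
    by (simp add: algebra_simps)
  then show "\<exists>Q. \<forall>c. F (\<lambda>i. c * w i) + G (\<lambda>i. c * w i) = c ^ a * poly Q c" ..
qed

lemma ord_ge_mono:
  assumes "ord_ge a F" "b \<le> a"
  shows "ord_ge b F"
  unfolding ord_ge_def
proof
  fix w
  obtain P where "\<And>c. F (\<lambda>i. c * w i) = c ^ a * poly P c"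
    using assms unfolding ord_ge_def by metis
  then have "\<forall>c. F (\<lambda>i. c * w i) = c ^ b * poly (monom 1 (a - b) * P) c"
    using assms(2) by (simp add: poly_monom algebra_simps flip: power_add)
  then show "\<exists>Q. \<forall>c. F (\<lambda>i. c * w i) = c ^ b * poly Q c" ..
qed

lemma ord_ge_zero: "ord_ge a (\<lambda>_. 0)"
  unfolding ord_ge_def by (auto intro!: exI[of _ 0])

lemma ord_ge_scale: "ord_ge a F \<Longrightarrow> ord_ge a (\<lambda>w. c * F w)"
  using ord_ge_mult[of 0 "\<lambda>_. c" a F] ord_ge_0[OF polys.const[of c 0]] by simp

lemma ord_ge_sum:
  "finite T \<Longrightarrow> (\<And>i. i \<in> T \<Longrightarrow> ord_ge a (f i)) \<Longrightarrow> ord_ge a (\<lambda>w. \<Sum>i\<in>T. f i w)"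
  by (induction T rule: finite_induct) (auto intro: ord_ge_add ord_ge_zero)

lemma ord_ge_power: "ord_ge a F \<Longrightarrow> ord_ge (a * n) (\<lambda>w. F w ^ n)"
proof (induction n)
  case 0
  show ?case using ord_ge_0[OF polys.const] by simp
next
  case (Suc n)
  then show ?case using ord_ge_mult[of a F "a * n" "\<lambda>w. F w ^ n"] by simp
qed

lemma ord_ge_prod:
  "finite T \<Longrightarrow> (\<And>i. i \<in> T \<Longrightarrow> ord_ge (a i) (f i)) \<Longrightarrow> ord_ge (\<Sum>i\<in>T. a i) (\<lambda>w. \<Prod>i\<in>T. f i w)"
  by (induction T rule: finite_induct) (auto intro: ord_ge_mult ord_ge_0[OF polys.const])

section \<open>Linear independence of monomials modulo high order\<close>

lemma digits_less:
  fixes \<beta> :: "nat \<Rightarrow> nat"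
  assumes "\<And>i. i < s \<Longrightarrow> \<beta> i < D"
  shows "(\<Sum>i<s. \<beta> i * D ^ i) < D ^ s"
  using assms
proof (induction s)
  case (Suc s)
  have "(\<Sum>i<s. \<beta> i * D ^ i) < D ^ s" using Suc by simp
  moreover have "\<beta> s * D ^ s + D ^ s \<le> D * D ^ s"
    using Suc.prems[of s] mult_le_mono1[of "Suc (\<beta> s)" D "D ^ s"] by simp
  ultimately show ?case by simp
qed simp

lemma digits_inj:
  fixes \<beta> \<gamma> :: "nat \<Rightarrow> nat"
  assumes "\<And>i. i < s \<Longrightarrow> \<beta> i < D" "\<And>i. i < s \<Longrightarrow> \<gamma> i < D"
    and "(\<Sum>i<s. \<beta> i * D ^ i) = (\<Sum>i<s. \<gamma> i * D ^ i)" "i < s"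
  shows "\<beta> i = \<gamma> i"
  using assms
proof (induction s)
  case (Suc s)
  have l: "(\<Sum>i<s. \<beta> i * D ^ i) < D ^ s" "(\<Sum>i<s. \<gamma> i * D ^ i) < D ^ s"
    using Suc.prems by (auto intro!: digits_less)
  have D: "D ^ s \<noteq> 0" using l by linarith
  have "\<beta> s = ((\<Sum>i<s. \<beta> i * D ^ i) + \<beta> s * D ^ s) div D ^ s"
    using l D by (subst div_mult_self1) simp_all
  also have "\<dots> = ((\<Sum>i<s. \<gamma> i * D ^ i) + \<gamma> s * D ^ s) div D ^ s" using Suc.prems(3) by simp
  also have "\<dots> = \<gamma> s" using l D by (subst div_mult_self1) simp_all
  finally have e: "\<beta> s = \<gamma> s" .
  then have "(\<Sum>i<s. \<beta> i * D ^ i) = (\<Sum>i<s. \<gamma> i * D ^ i)" using Suc.prems(3) by simp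
  then show ?case using Suc e by (cases "i = s") auto
qed simp

abbreviation box :: "nat \<Rightarrow> nat \<Rightarrow> (nat \<Rightarrow> nat) set" where
  "box s D \<equiv> PiE {..<s} (\<lambda>_. {..<D})"

text \<open>Kronecker substitution \<open>w i = x ^ (D ^ i)\<close> separates the monomials of the box.\<close>
lemma monom_fun_independent:
  fixes c :: "(nat \<Rightarrow> nat) \<Rightarrow> 'k::field"
  assumes inf: "infinite (UNIV :: 'k set)"
    and L: "s * D \<le> L" and s: "0 < s"
    and ord: "ord_ge L (\<lambda>w. \<Sum>\<beta>\<in>box s D. c \<beta> * monom_fun s \<beta> w)"
    and \<beta>: "\<beta> \<in> box s D"
  shows "c \<beta> = 0"
proof -
  define code where "code \<beta> = (\<Sum>i<s. \<beta> i * D ^ i)" for \<beta> :: "nat \<Rightarrow> nat"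
  have fin: "finite (box s D)" by (intro finite_PiE) auto
  have deg: "(\<Sum>i<s. \<gamma> i) < L" if "\<gamma> \<in> box s D" for \<gamma>
  proof -
    have "(\<Sum>i<s. \<gamma> i) < (\<Sum>i<s. D)"
      by (rule sum_strict_mono) (use that s in \<open>auto simp: PiE_def Pi_def\<close>)
    then show ?thesis using L by simp
  qed
  have poly_0: "p = 0" if "\<And>x. poly p x = 0" for p :: "'k poly"
    using poly_roots_finite[of p] that inf by auto
  \<comment> \<open>On the line through the point with coordinates \<open>x ^ (D ^ i)\<close> the
    sum is a polynomial in \<open>a\<close> of degree below \<open>L\<close> that is divisible by
    \<open>a ^ L\<close>, hence zero. Setting \<open>a = 1\<close> gives the claim.\<close>
  have val: "(\<Sum>\<gamma>\<in>box s D. c \<gamma> * x ^ code \<gamma>) = 0" for x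
  proof -
    obtain Q where Q: "\<And>a. (\<Sum>\<gamma>\<in>box s D. c \<gamma> * monom_fun s \<gamma> (\<lambda>i. a * x ^ (D ^ i))) = a ^ L * poly Q a"
      using ord unfolding ord_ge_def by (auto dest!: spec[of _ "\<lambda>i. x ^ (D ^ i)"])
    have mf: "monom_fun s \<gamma> (\<lambda>i. a * x ^ (D ^ i)) = x ^ code \<gamma> * a ^ (\<Sum>i<s. \<gamma> i)" for a \<gamma>
    proof -
      have "(a * x ^ (D ^ i)) ^ \<gamma> i = x ^ (\<gamma> i * D ^ i) * a ^ \<gamma> i" for i
        by (simp add: power_mult_distrib mult.commute flip: power_mult)
      then show ?thesis unfolding monom_fun_def code_def by (simp add: prod.distrib power_sum)
    qed
    define P where "P = (\<Sum>\<gamma>\<in>box s D. monom (c \<gamma> * x ^ code \<gamma>) (\<Sum>i<s. \<gamma> i))"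
    have "poly (P - monom 1 L * Q) a = 0" for a
      using Q[of a] by (simp add: P_def poly_sum poly_monom mf mult.assoc)
    then have PQ: "P = monom 1 L * Q" using poly_0[of "P - monom 1 L * Q"] by simp
    have "coeff P k = 0" for k
    proof (cases "k < L")
      case True
      then show ?thesis by (simp add: PQ coeff_monom_mult)
    next
      case False
      then show ?thesis using deg unfolding P_def by (auto simp: coeff_sum intro!: sum.neutral)
    qed
    then have "P = 0" by (simp add: poly_eq_iff)
    then have "poly P 1 = 0" by simp
    then show ?thesis by (simp add: P_def poly_sum poly_monom)
  qed
  \<comment> \<open>The codes are numbers written in base \<open>D\<close>, so distinct members of
    the box have distinct codes and each \<open>c \<beta>\<close> is a coefficient of
    \<open>R\<close>.\<close>
  define R where "R = (\<Sum>\<gamma>\<in>box s D. monom (c \<gamma>) (code \<gamma>))"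
  have "R = 0" by (rule poly_0) (use val in \<open>simp add: R_def poly_sum poly_monom\<close>)
  have "code \<gamma> = code \<beta> \<longleftrightarrow> \<gamma> = \<beta>" if "\<gamma> \<in> box s D" for \<gamma>
  proof
    assume e: "code \<gamma> = code \<beta>"
    show "\<gamma> = \<beta>"
    proof (rule PiE_ext[OF that \<beta>])
      fix i assume "i \<in> {..<s}"
      then show "\<gamma> i = \<beta> i"
        using digits_inj[of s \<gamma> D \<beta> i] e that \<beta> unfolding code_def by (auto simp: PiE_def Pi_def)
    qed
  qed simp
  then have "coeff R (code \<beta>) = (\<Sum>\<gamma>\<in>box s D. if \<gamma> = \<beta> then c \<gamma> else 0)"
    unfolding R_def coeff_sum by (intro sum.cong) auto
  also have "\<dots> = c \<beta>" using fin \<beta> by simp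
  finally show ?thesis using \<open>R = 0\<close> by simp
qed

section \<open>Counting monomials against products of the equations\<close>

lemma homogeneous_system_solution:
  fixes a :: "'b \<Rightarrow> 'g \<Rightarrow> 'k::field"
  assumes "finite G" "finite B" "card G < card B"
  shows "\<exists>c. (\<exists>b\<in>B. c b \<noteq> 0) \<and> (\<forall>g\<in>G. (\<Sum>b\<in>B. c b * a b g) = 0)"
  using assms
proof (induction G arbitrary: B a rule: finite_induct)
  case empty
  then obtain b where "b \<in> B" by fastforce
  then show ?case by (intro exI[of _ "\<lambda>_. 1"]) auto
next
  case (insert g G)
  show ?case
  proof (cases "\<forall>b\<in>B. a b g = 0")
    case True
    have "card G < card B" using insert by simp
    from insert.IH[OF insert.prems(1) this, of a] True show ?thesis by auto
  next
    case False
    then obtain b0 where b0: "b0 \<in> B" "a b0 g \<noteq> 0" by auto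
    \<comment> \<open>Equation \<open>g\<close> eliminates the unknown \<open>b0\<close>:
      \<open>a'\<close> is the matrix after this pivot step, and \<open>d\<close> below restores the
      value at \<open>b0\<close>.\<close>
    define a' where "a' b g' = a b g' - a b g / a b0 g * a b0 g'" for b g'
    have "card G < card (B - {b0})" using insert b0 by simp
    then obtain c where c: "\<exists>b\<in>B - {b0}. c b \<noteq> 0" "\<forall>g'\<in>G. (\<Sum>b\<in>B - {b0}. c b * a' b g') = 0"
      using insert.IH[of "B - {b0}" a'] insert.prems by auto
    define d where "d = c(b0 := - (\<Sum>b\<in>B - {b0}. c b * a b g) / a b0 g)"
    have key: "(\<Sum>b\<in>B. d b * a b g') = (\<Sum>b\<in>B - {b0}. c b * a' b g')" for g'
    proof -
      have "(\<Sum>b\<in>B. d b * a b g') = d b0 * a b0 g' + (\<Sum>b\<in>B - {b0}. d b * a b g')"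
        using b0 insert.prems(1) by (simp add: sum.remove)
      also have "(\<Sum>b\<in>B - {b0}. d b * a b g') = (\<Sum>b\<in>B - {b0}. c b * a b g')"
        by (rule sum.cong) (auto simp: d_def)
      also have "d b0 * a b0 g' = - ((\<Sum>b\<in>B - {b0}. c b * a b g) * (a b0 g' / a b0 g))"
        by (simp add: d_def)
      also have "(\<Sum>b\<in>B - {b0}. c b * a b g) * (a b0 g' / a b0 g) =
          (\<Sum>b\<in>B - {b0}. c b * (a b g / a b0 g * a b0 g'))"
        by (simp add: sum_distrib_right sum_divide_distrib mult.assoc)
      finally show ?thesis
        by (simp add: a'_def right_diff_distrib sum_subtractf)
    qed
    have "a' b g = 0" for b using b0 by (simp add: a'_def)
    then have "\<forall>g'\<in>insert g G. (\<Sum>b\<in>B. d b * a b g') = 0" using c key by auto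
    moreover have "\<exists>b\<in>B. d b \<noteq> 0" using c by (auto simp: d_def)
    ultimately show ?thesis by blast
  qed
qed

text \<open>Counting modulo functions of order \<open>L = s D\<close>: the \<open>D ^ s\<close> monomials of the box are
  independent, but they lie in the span of the products \<open>f ^ \<alpha> w ^ \<gamma>\<close> with \<open>\<alpha> \<in> box r L\<close> and
  \<open>\<gamma> \<in> box s K\<close>.\<close>
theorem nilpotent_coordinates_bound:
  fixes f :: "nat \<Rightarrow> (nat \<Rightarrow> 'k::field) \<Rightarrow> 'k"
  assumes inf: "infinite (UNIV :: 'k set)"
    and f: "\<And>j. j < r \<Longrightarrow> f j \<in> polys s" "\<And>j. j < r \<Longrightarrow> f j (\<lambda>_. 0) = 0"
    and nil: "\<And>i. i < s \<Longrightarrow> \<exists>h c. h \<in> polys s \<and> h (\<lambda>_. 0) \<noteq> 0 \<and> (\<forall>j<r. c j \<in> polys s) \<and>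
        (\<forall>w. h w * w i ^ K = (\<Sum>j<r. c j w * f j w))"
  shows "s \<le> r"
proof (rule ccontr)
  assume "\<not> s \<le> r"
  then have rs: "r < s" by simp
  then have s: "0 < s" by simp
  \<comment> \<open>This \<open>D\<close> makes the final count strict:
    \<open>card G = L ^ r * K ^ s\<close> equals \<open>(s ^ r * K ^ s) * D ^ r\<close>, which is
    below \<open>D ^ (r + 1)\<close> and hence below \<open>D ^ s\<close>. With
    \<open>L = s * D\<close> every monomial of the box has degree below \<open>L\<close>.\<close>
  define D where "D = Suc (s ^ r * K ^ s)"
  define L where "L = s * D"
  define fp where "fp \<alpha> w = (\<Prod>j<r. f j w ^ \<alpha> j)" for \<alpha> :: "nat \<Rightarrow> nat" and w
  define G where "G = box r L \<times> box s K"
  define \<phi> where "\<phi> g w = fp (fst g) w * monom_fun s (snd g) w" for g w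
  have finG: "finite G" unfolding G_def by (intro finite_cartesian_product finite_PiE) auto
  define good where "good u \<longleftrightarrow> (\<exists>a. ord_ge L (\<lambda>w. u w - (\<Sum>g\<in>G. a g * \<phi> g w)))" for u
  have good_ord: "good u" if "ord_ge L u" for u
    unfolding good_def by (rule exI[of _ "\<lambda>_. 0"]) (use that in simp)
  have good_add: "good (\<lambda>w. u w + v w)" if g: "good u" "good v" for u v
  proof -
    obtain a b where "ord_ge L (\<lambda>w. u w - (\<Sum>g\<in>G. a g * \<phi> g w))" "ord_ge L (\<lambda>w. v w - (\<Sum>g\<in>G. b g * \<phi> g w))"
      using g unfolding good_def by auto
    from ord_ge_add[OF this] show ?thesis
      unfolding good_def by (intro exI[of _ "\<lambda>g. a g + b g"]) (simp add: algebra_simps sum.distrib)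
  qed
  have good_scale: "good (\<lambda>w. x * u w)" if g: "good u" for u x
  proof -
    obtain a where "ord_ge L (\<lambda>w. u w - (\<Sum>g\<in>G. a g * \<phi> g w))"
      using g unfolding good_def by auto
    from ord_ge_scale[OF this, of x] show ?thesis
      unfolding good_def by (intro exI[of _ "\<lambda>g. x * a g"]) (simp add: algebra_simps sum_distrib_left)
  qed
  have good_sum: "good (\<lambda>w. \<Sum>i\<in>T. u i w)" if "finite T" "\<And>i. i \<in> T \<Longrightarrow> good (u i)" for T :: "nat set" and u
    using that by (induction T rule: finite_induct) (auto intro: good_add good_ord ord_ge_zero)
  have fp_ord: "ord_ge (\<Sum>j<r. \<alpha> j) (fp \<alpha>)" for \<alpha>
  proof -
    have "ord_ge (\<alpha> j) (\<lambda>w. f j w ^ \<alpha> j)" if "j < r" for j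
      using ord_ge_power[OF ord_ge_1[OF f(1) f(2)], OF that that] by simp
    then show ?thesis unfolding fp_def[abs_def] by (intro ord_ge_prod) auto
  qed
  have fp_Suc: "f j w * fp \<alpha> w = fp (\<alpha>(j := Suc (\<alpha> j))) w" if "j < r" for j w \<alpha>
    using that by (simp add: fp_def prod.remove[of "{..<r}" j] algebra_simps)
  have fp_restrict: "fp (restrict \<alpha> {..<r}) w = fp \<alpha> w" for \<alpha> w
    unfolding fp_def by (rule prod.cong) auto
  have mf_restrict: "monom_fun s (restrict \<beta> {..<s}) w = monom_fun s \<beta> w" for \<beta> and w :: "nat \<Rightarrow> 'k"
    unfolding monom_fun_def by (rule prod.cong) auto
  \<comment> \<open>Each rewriting of a power \<open>w i ^ K\<close> adds one factor
    \<open>f j\<close>. Since every \<open>f j\<close> vanishes at the origin, products with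
    \<open>L\<close> or more such factors have order \<open>L\<close> and are negligible, which ends
    the induction.\<close>
  have main: "good (\<lambda>w. fp \<alpha> w * u w)" if "u \<in> polys s" for \<alpha> u
    using that
  proof (induction "L - (\<Sum>j<r. \<alpha> j)" arbitrary: \<alpha> u rule: less_induct)
    case (less \<alpha> u)
    show ?case
    proof (cases "(\<Sum>j<r. \<alpha> j) < L")
      case False
      have "ord_ge ((\<Sum>j<r. \<alpha> j) + 0) (\<lambda>w. fp \<alpha> w * u w)"
        by (intro ord_ge_mult fp_ord ord_ge_0[OF less.prems])
      then show ?thesis using False by (intro good_ord) (auto elim: ord_ge_mono)
    next
      case True
      have step: "good (\<lambda>w. fp \<alpha> w * (f j w * v w))" if "j < r" "v \<in> polys s" for j v
      proof -
        have "(\<Sum>i<r. (\<alpha>(j := Suc (\<alpha> j))) i) = Suc (\<Sum>i<r. \<alpha> i)"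
          using that(1) by (simp add: sum.remove[of "{..<r}" j])
        then have "good (\<lambda>w. fp (\<alpha>(j := Suc (\<alpha> j))) w * v w)"
          using True that(2) by (intro less.hyps) auto
        then show ?thesis by (simp add: that(1) mult.left_commute flip: fp_Suc mult.assoc)
      qed
      from less.prems have "u \<in> monom_span s" by (rule polys_subset_monom_span)
      then show ?thesis
      proof induction
        case (add u v)
        then show ?case using good_add[OF add.IH] by (simp add: algebra_simps)
      next
        case (monom x \<beta>)
        have "good (\<lambda>w. fp \<alpha> w * monom_fun s \<beta> w)"
        proof (cases "\<forall>i<s. \<beta> i < K")
          case T: True
          define g where "g = (restrict \<alpha> {..<r}, restrict \<beta> {..<s})"
          have "\<alpha> j < L" if "j < r" for j
            using True member_le_sum[of j "{..<r}" \<alpha>] that by auto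
          then have "g \<in> G" using T unfolding g_def G_def by auto
          have "fp \<alpha> w * monom_fun s \<beta> w = (\<Sum>g'\<in>G. (if g' = g then 1 else 0) * \<phi> g' w)" for w
          proof -
            have "(\<Sum>g'\<in>G. (if g' = g then 1 else 0) * \<phi> g' w) = (\<Sum>g'\<in>G. if g' = g then \<phi> g' w else 0)"
              by (rule sum.cong) auto
            also have "\<dots> = \<phi> g w" using finG \<open>g \<in> G\<close> by simp
            finally show ?thesis by (simp add: \<phi>_def g_def fp_restrict mf_restrict)
          qed
          then show ?thesis unfolding good_def
            by (intro exI[of _ "\<lambda>g'. if g' = g then 1 else 0"]) (simp add: ord_ge_zero)
        next
          case F: False
          then obtain i where i: "i < s" "K \<le> \<beta> i" by auto
          define \<beta>' where "\<beta>' = \<beta>(i := \<beta> i - K)"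
          obtain h c where h: "h \<in> polys s" "h (\<lambda>_. 0) \<noteq> 0" "\<And>j. j < r \<Longrightarrow> c j \<in> polys s"
            "\<And>w. h w * w i ^ K = (\<Sum>j<r. c j w * f j w)" using nil[OF i(1)] by blast
          define h0 where "h0 = h (\<lambda>_. 0)"
          \<comment> \<open>\<open>h\<close> is a unit near the origin:
            \<open>h = h0 * (1 - e)\<close> with \<open>e\<close> vanishing there, so the truncated
            geometric series \<open>v\<close> inverts \<open>h\<close> up to \<open>e ^ L\<close>, a
            term of order \<open>L\<close>.\<close>
          define e where "e w = 1 + (- 1 / h0) * h w" for w
          have eP: "e \<in> polys s" unfolding e_def[abs_def] by (intro polys.intros h)
          have "e (\<lambda>_. 0) = 0" using h(2) by (simp add: e_def h0_def)
          then have eL: "ord_ge L (\<lambda>w. e w ^ L)" using ord_ge_power[OF ord_ge_1[OF eP]] by simp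
          define v where "v w = (1 / h0) * (\<Sum>k<L. e w ^ k)" for w
          have vP: "v \<in> polys s" unfolding v_def[abs_def]
            by (intro polys.intros polys_sum polys_power eP) auto
          have inv: "v w * h w + e w ^ L = 1" for w
          proof -
            have "h w = h0 * (1 - e w)" using h(2) by (simp add: e_def h0_def)
            then have "v w * h w = (1 - e w) * (\<Sum>k<L. e w ^ k)" using h(2) by (simp add: v_def h0_def)
            also have "\<dots> = 1 - e w ^ L" by (simp add: one_diff_power_eq)
            finally show ?thesis by simp
          qed
          have mf: "monom_fun s \<beta> w = w i ^ K * monom_fun s \<beta>' w" for w :: "nat \<Rightarrow> 'k"
            using i by (simp add: monom_fun_def \<beta>'_def prod.remove[of "{..<s}" i] flip: power_add mult.assoc)
          have eq: "fp \<alpha> w * monom_fun s \<beta> w = (fp \<alpha> w * monom_fun s \<beta> w) * e w ^ L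
             + (\<Sum>j<r. fp \<alpha> w * (f j w * (c j w * v w * monom_fun s \<beta>' w)))" for w
          proof -
            have "fp \<alpha> w * monom_fun s \<beta> w = fp \<alpha> w * monom_fun s \<beta> w * (v w * h w + e w ^ L)"
              by (simp add: inv)
            also have "\<dots> = (fp \<alpha> w * monom_fun s \<beta> w) * e w ^ L + fp \<alpha> w * v w * monom_fun s \<beta>' w * (h w * w i ^ K)"
              by (simp add: mf algebra_simps)
            also have "h w * w i ^ K = (\<Sum>j<r. c j w * f j w)" by (rule h(4))
            also have "fp \<alpha> w * v w * monom_fun s \<beta>' w * (\<Sum>j<r. c j w * f j w) =
                (\<Sum>j<r. fp \<alpha> w * (f j w * (c j w * v w * monom_fun s \<beta>' w)))"
              by (simp add: sum_distrib_left mult_ac)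
            finally show ?thesis .
          qed
          have "good (\<lambda>w. (fp \<alpha> w * monom_fun s \<beta> w) * e w ^ L
             + (\<Sum>j<r. fp \<alpha> w * (f j w * (c j w * v w * monom_fun s \<beta>' w))))"
          proof (intro good_add good_sum step polys.mult h vP monom_fun_polys)
            have "fp \<alpha> \<in> polys s" unfolding fp_def[abs_def] by (intro polys_prod polys_power f) auto
            from ord_ge_mult[OF ord_ge_0[OF polys.mult[OF this monom_fun_polys]] eL]
            have "ord_ge (0 + L) (\<lambda>w. (fp \<alpha> w * monom_fun s \<beta> w) * e w ^ L)" .
            then show "good (\<lambda>w. (fp \<alpha> w * monom_fun s \<beta> w) * e w ^ L)" by (intro good_ord) simp
          qed auto
          then show ?thesis unfolding eq[symmetric] .
        qed
        from good_scale[OF this, of x] show ?case by (simp add: algebra_simps)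
      qed
    qed
  qed
  define a where "a \<beta> = (SOME a. ord_ge L (\<lambda>w. monom_fun s \<beta> w - (\<Sum>g\<in>G. a g * \<phi> g w)))" for \<beta>
  have a: "ord_ge L (\<lambda>w. monom_fun s \<beta> w - (\<Sum>g\<in>G. a \<beta> g * \<phi> g w))" for \<beta>
  proof -
    have "\<exists>a. ord_ge L (\<lambda>w. monom_fun s \<beta> w - (\<Sum>g\<in>G. a g * \<phi> g w))"
      using main[OF monom_fun_polys, of "\<lambda>_. 0" \<beta>] unfolding good_def fp_def by simp
    then show ?thesis unfolding a_def by (rule someI_ex)
  qed
  have finB: "finite (box s D)" by (intro finite_PiE) auto
  have "card G = L ^ r * K ^ s" by (simp add: G_def card_cartesian_product card_PiE)
  also have "\<dots> = (s ^ r * K ^ s) * D ^ r" by (simp add: L_def power_mult_distrib)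
  also have "\<dots> < D * D ^ r" by (intro mult_strict_right_mono) (auto simp: D_def)
  also have "\<dots> \<le> D ^ s" using rs power_increasing[of "Suc r" s D] by (simp add: D_def)
  also have "\<dots> = card (box s D)" by (simp add: card_PiE)
  \<comment> \<open>With more box monomials than elements of \<open>G\<close>, some nontrivial
    combination of the monomials has no component along any \<open>\<phi> g\<close>. It therefore
    has order at least \<open>L\<close>, contrary to independence.\<close>
  finally obtain c where c: "\<exists>\<beta>\<in>box s D. c \<beta> \<noteq> 0" "\<forall>g\<in>G. (\<Sum>\<beta>\<in>box s D. c \<beta> * a \<beta> g) = 0"
    using homogeneous_system_solution[OF finG finB, of a] by blast
  have "ord_ge L (\<lambda>w. \<Sum>\<beta>\<in>box s D. c \<beta> * (monom_fun s \<beta> w - (\<Sum>g\<in>G. a \<beta> g * \<phi> g w)))"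
    by (intro ord_ge_sum finB ord_ge_scale a)
  moreover have "(\<Sum>\<beta>\<in>box s D. c \<beta> * (monom_fun s \<beta> w - (\<Sum>g\<in>G. a \<beta> g * \<phi> g w))) =
      (\<Sum>\<beta>\<in>box s D. c \<beta> * monom_fun s \<beta> w)" for w
  proof -
    have "(\<Sum>\<beta>\<in>box s D. c \<beta> * (\<Sum>g\<in>G. a \<beta> g * \<phi> g w)) =
        (\<Sum>\<beta>\<in>box s D. \<Sum>g\<in>G. c \<beta> * a \<beta> g * \<phi> g w)"
      by (simp add: sum_distrib_left mult.assoc)
    also have "\<dots> = (\<Sum>g\<in>G. \<Sum>\<beta>\<in>box s D. c \<beta> * a \<beta> g * \<phi> g w)" by (rule sum.swap)
    also have "\<dots> = (\<Sum>g\<in>G. (\<Sum>\<beta>\<in>box s D. c \<beta> * a \<beta> g) * \<phi> g w)"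
      by (simp add: sum_distrib_right)
    also have "\<dots> = 0" using c(2) by simp
    finally show ?thesis by (simp add: right_diff_distrib sum_subtractf)
  qed
  ultimately have "ord_ge L (\<lambda>w. \<Sum>\<beta>\<in>box s D. c \<beta> * monom_fun s \<beta> w)" by simp
  from monom_fun_independent[OF inf _ s this] c(1) show False by (auto simp: L_def)
qed

section \<open>Polynomial functions on jets and the generalized equation\<close>

lemma coord_simps [simp]: "xv i (a, b, c) = a i" "yv i (a, b, c) = b i" "zv i (a, b, c) = c i"
  by (simp_all add: xv_def yv_def zv_def)

lemma Rm_induct [consumes 1, case_names const varx vary varz add mult]:
  assumes "f \<in> Rm m" "\<And>c. P (\<lambda>_. c)"
    "\<And>i. i \<le> m \<Longrightarrow> P (\<lambda>p. xv i p)" "\<And>i. i \<le> m \<Longrightarrow> P (\<lambda>p. yv i p)" "\<And>i. i \<le> m \<Longrightarrow> P (\<lambda>p. zv i p)"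
    "\<And>f g. f \<in> Rm m \<Longrightarrow> g \<in> Rm m \<Longrightarrow> P f \<Longrightarrow> P g \<Longrightarrow> P (\<lambda>p. f p + g p)"
    "\<And>f g. f \<in> Rm m \<Longrightarrow> g \<in> Rm m \<Longrightarrow> P f \<Longrightarrow> P g \<Longrightarrow> P (\<lambda>p. f p * g p)"
  shows "P f"
  using assms by (induction rule: Rm.induct) auto

lemma Rm_uminus: "f \<in> Rm m \<Longrightarrow> (\<lambda>p. - f p) \<in> Rm m"
  using Rm.mult[OF Rm.const[of "-1"], of f m] by simp

lemma Rm_diff: "f \<in> Rm m \<Longrightarrow> g \<in> Rm m \<Longrightarrow> (\<lambda>p. f p - g p) \<in> Rm m"
  using Rm.add[OF _ Rm_uminus, of f m g] by simp

lemma Rm_power: "f \<in> Rm m \<Longrightarrow> (\<lambda>p. f p ^ n) \<in> Rm m"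
  by (induction n) (auto intro: Rm.intros)

lemma Rm_sum: "(\<And>i. i \<in> T \<Longrightarrow> f i \<in> Rm m) \<Longrightarrow> (\<lambda>p. \<Sum>i\<in>T. f i p) \<in> Rm m"
  by (induction T rule: infinite_finite_induct) (auto intro: Rm.intros)

lemmas Rm_intros = Rm.intros Rm_uminus Rm_diff Rm_power Rm_sum

lemma Rm_comp:
  assumes "u \<in> Rm M"
    and "\<And>i. i \<le> M \<Longrightarrow> (\<lambda>p. xv i (\<psi> p)) \<in> Rm M'"
    and "\<And>i. i \<le> M \<Longrightarrow> (\<lambda>p. yv i (\<psi> p)) \<in> Rm M'"
    and "\<And>i. i \<le> M \<Longrightarrow> (\<lambda>p. zv i (\<psi> p)) \<in> Rm M'"
  shows "(\<lambda>p. u (\<psi> p)) \<in> Rm M'"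
  using assms(1) by (induction rule: Rm_induct) (auto intro: Rm.intros assms)

lemma Rm_mono: "u \<in> Rm M \<Longrightarrow> M \<le> M' \<Longrightarrow> u \<in> Rm M'"
  by (induction rule: Rm.induct) (auto intro: Rm.intros)

lemma Rm_cong:
  assumes "u \<in> Rm M" "\<And>i. i \<le> M \<Longrightarrow> xv i p = xv i q \<and> yv i p = yv i q \<and> zv i p = zv i q"
  shows "u p = u q"
  using assms(1) by (induction rule: Rm_induct) (auto simp: assms(2))

definition lin :: "'k::comm_ring_1 jpt \<Rightarrow> 'k jpt \<Rightarrow> 'k \<Rightarrow> 'k jpt" where
  "lin p q t = (\<lambda>i. xv i p + t * (xv i q - xv i p), \<lambda>i. yv i p + t * (yv i q - yv i p),
     \<lambda>i. zv i p + t * (zv i q - zv i p))"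

lemma jpt_eqI: "(\<And>i. xv i p = xv i q) \<Longrightarrow> (\<And>i. yv i p = yv i q) \<Longrightarrow> (\<And>i. zv i p = zv i q) \<Longrightarrow> p = q"
  by (cases p; cases q) auto

lemma lin_0 [simp]: "lin p q 0 = p" and lin_1 [simp]: "lin p q 1 = q"
  by (auto intro!: jpt_eqI simp: lin_def)

lemma Rm_lin: "u \<in> Rm M \<Longrightarrow> \<exists>P. \<forall>t. u (lin p q t) = poly P t"
proof (induction rule: Rm_induct)
  case (const c)
  show ?case by (rule exI[of _ "[:c:]"]) simp
next
  case (varx i)
  show ?case by (rule exI[of _ "[:xv i p, xv i q - xv i p:]"]) (simp add: lin_def)
next
  case (vary i)
  show ?case by (rule exI[of _ "[:yv i p, yv i q - yv i p:]"]) (simp add: lin_def)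
next
  case (varz i)
  show ?case by (rule exI[of _ "[:zv i p, zv i q - zv i p:]"]) (simp add: lin_def)
next
  case (add f g)
  then obtain P Q where "\<And>t. f (lin p q t) = poly P t" "\<And>t. g (lin p q t) = poly Q t" by blast
  then show ?case by (intro exI[of _ "P + Q"]) simp
next
  case (mult f g)
  then obtain P Q where "\<And>t. f (lin p q t) = poly P t" "\<And>t. g (lin p q t) = poly Q t" by blast
  then show ?case by (intro exI[of _ "P * Q"]) simp
qed

text \<open>Euclid's argument: over a finite field the product of all \<open>[:- a, 1:]\<close> plus
  1 has positive degree but takes the value 1 everywhere.\<close>

lemma infinite_alg_closed: "infinite (UNIV :: 'k::alg_closed_field set)"
proof
  assume fin: "finite (UNIV :: 'k set)"
  define p where "p = (\<Prod>a\<in>UNIV. [:- a, 1:]) + (1 :: 'k poly)"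
  have d: "degree (\<Prod>a\<in>(UNIV::'k set). [:- a, 1:]) = card (UNIV :: 'k set)"
    by (subst degree_prod_sum_eq) auto
  have pos: "0 < card (UNIV :: 'k set)" using fin by (simp add: card_gt_0_iff)
  then have "degree p > 0" unfolding p_def by (subst degree_add_eq_left) (auto simp: d)
  then obtain x where "poly p x = 0" using alg_closed_imp_poly_has_root by blast
  moreover have "poly p x = 1" using fin by (simp add: p_def poly_prod)
  ultimately show False by simp
qed

lemma poly_nonzero_point:
  fixes P :: "'k::alg_closed_field poly"
  assumes "P \<noteq> 0"
  shows "\<exists>t. poly P t \<noteq> 0"
  using poly_roots_finite[OF assms] infinite_alg_closed[where 'k = 'k] by (cases "\<forall>t. poly P t = 0") auto

text \<open>On the line joining \<open>p\<close> and \<open>q\<close> both functions become nonzero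
  polynomials in one variable, and their product has a nonroot. This is the irreducibility of affine
  space.\<close>

lemma Rm_common_nonzero:
  fixes f g d :: "'k::alg_closed_field jpt \<Rightarrow> 'k"
  assumes "f \<in> Rm M" "g \<in> Rm M" "f p \<noteq> 0" "g q \<noteq> 0"
  shows "\<exists>r. f r \<noteq> 0 \<and> g r \<noteq> 0"
proof -
  obtain P Q where PQ: "\<And>t. f (lin p q t) = poly P t" "\<And>t. g (lin p q t) = poly Q t"
    using Rm_lin[OF assms(1)] Rm_lin[OF assms(2)] by metis
  have "poly P 0 \<noteq> 0" "poly Q 1 \<noteq> 0" using assms(3,4) by (simp_all flip: PQ)
  then have "P * Q \<noteq> 0" by auto
  then obtain t where "poly (P * Q) t \<noteq> 0" using poly_nonzero_point by blast
  then show ?thesis by (intro exI[of _ "lin p q t"]) (simp add: PQ)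
qed

section \<open>Ideals of polynomial functions and substitution\<close>

definition is_ideal :: "nat \<Rightarrow> ('k::comm_ring_1 jpt \<Rightarrow> 'k) set \<Rightarrow> bool" where
  "is_ideal M N \<longleftrightarrow> N \<subseteq> Rm M \<and> (\<lambda>_. 0) \<in> N \<and> (\<forall>f\<in>N. \<forall>g\<in>N. (\<lambda>p. f p + g p) \<in> N) \<and>
     (\<forall>h\<in>Rm M. \<forall>f\<in>N. (\<lambda>p. h p * f p) \<in> N)"

lemma is_idealD:
  assumes "is_ideal M N"
  shows "f \<in> N \<Longrightarrow> f \<in> Rm M" "(\<lambda>_. 0) \<in> N" "f \<in> N \<Longrightarrow> g \<in> N \<Longrightarrow> (\<lambda>p. f p + g p) \<in> N"
    "h \<in> Rm M \<Longrightarrow> f \<in> N \<Longrightarrow> (\<lambda>p. h p * f p) \<in> N"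
  using assms unfolding is_ideal_def by auto

lemma is_ideal_diff: "is_ideal M N \<Longrightarrow> f \<in> N \<Longrightarrow> g \<in> N \<Longrightarrow> (\<lambda>p. f p - g p) \<in> N"
  using is_idealD(3)[of M N f "\<lambda>p. - 1 * g p"] is_idealD(4)[of M N "\<lambda>_. - 1" g]
  by (auto intro: Rm.const)

text \<open>Congruences modulo an ideal pass through sums and products, so it is enough to compare
  coordinates. It serves to replace coordinates by constants to which they are congruent.\<close>

lemma is_ideal_subst:
  assumes I: "is_ideal M N"
    and "u \<in> Rm M"
    and "\<And>i. i \<le> M \<Longrightarrow> (\<lambda>p. xv i (\<kappa> p)) \<in> Rm M" "\<And>i. i \<le> M \<Longrightarrow> (\<lambda>p. xv i p - xv i (\<kappa> p)) \<in> N"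
    and "\<And>i. i \<le> M \<Longrightarrow> (\<lambda>p. yv i (\<kappa> p)) \<in> Rm M" "\<And>i. i \<le> M \<Longrightarrow> (\<lambda>p. yv i p - yv i (\<kappa> p)) \<in> N"
    and "\<And>i. i \<le> M \<Longrightarrow> (\<lambda>p. zv i (\<kappa> p)) \<in> Rm M" "\<And>i. i \<le> M \<Longrightarrow> (\<lambda>p. zv i p - zv i (\<kappa> p)) \<in> N"
  shows "(\<lambda>p. u p - u (\<kappa> p)) \<in> N"
  using assms(2)
proof (induction rule: Rm_induct)
  case (const c)
  show ?case using is_idealD(2)[OF I] by simp
next
  case (add f g)
  from is_idealD(3)[OF I add.IH] show ?case by (simp add: algebra_simps)
next
  case (mult f g)
  have "(\<lambda>p. f p * (g p - g (\<kappa> p)) + g (\<kappa> p) * (f p - f (\<kappa> p))) \<in> N"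
    by (intro is_idealD(3)[OF I] is_idealD(4)[OF I] mult Rm_comp[of g M \<kappa> M]) (auto intro: assms)
  then show ?case by (simp add: algebra_simps)
qed (use assms in auto)

lemma gen_ideal_is_ideal:
  assumes "F \<subseteq> Rm M"
  shows "is_ideal M (gen_ideal M F)"
proof -
  have "u \<in> Rm M" if "u \<in> gen_ideal M F" for u
    using that by induction (use assms in \<open>auto intro: Rm.intros\<close>)
  then show ?thesis unfolding is_ideal_def by (auto intro: gen_ideal.intros)
qed

lemma gen_ideal_least:
  assumes "is_ideal M N" "F \<subseteq> N"
  shows "gen_ideal M F \<subseteq> N"
proof
  fix u assume "u \<in> gen_ideal M F"
  then show "u \<in> N" by induction (use assms is_idealD[OF assms(1)] in auto)
qed

lemma gen_ideal_vanish:
  assumes "u \<in> gen_ideal M F" "\<And>f. f \<in> F \<Longrightarrow> f p = 0"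
  shows "u p = 0"
  using assms(1) by induction (auto simp: assms(2))

lemma gen_ideal_comp:
  assumes "u \<in> gen_ideal M F"
    and "\<And>f. f \<in> F \<Longrightarrow> (\<lambda>p. f (\<psi> p)) \<in> gen_ideal M' F'"
    and "\<And>h. h \<in> Rm M \<Longrightarrow> (\<lambda>p. h (\<psi> p)) \<in> Rm M'"
  shows "(\<lambda>p. u (\<psi> p)) \<in> gen_ideal M' F'"
  using assms(1) by induction (auto intro: gen_ideal.intros assms)

lemma gen_ideal_sum_repr:
  assumes "u \<in> gen_ideal M F" "finite F"
  shows "\<exists>c. (\<forall>f\<in>F. c f \<in> Rm M) \<and> (\<forall>p. u p = (\<Sum>f\<in>F. c f p * f p))"
  using assms(1)
proof induction
  case zero
  show ?case by (rule exI[of _ "\<lambda>_ _. 0"]) (auto intro: Rm.const)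
next
  case (gen f)
  have "(\<Sum>g\<in>F. (if g = f then 1 else 0) * g p) = (\<Sum>g\<in>F. if g = f then g p else 0)" for p
    by (rule sum.cong) auto
  then show ?case using gen assms(2)
    by (intro exI[of _ "\<lambda>g _. if g = f then 1 else 0"]) (auto intro: Rm.const)
next
  case (add f g)
  then obtain c d where "\<forall>f\<in>F. c f \<in> Rm M" "\<forall>p. f p = (\<Sum>f\<in>F. c f p * f p)"
    "\<forall>f\<in>F. d f \<in> Rm M" "\<forall>p. g p = (\<Sum>f\<in>F. d f p * f p)" by blast
  then show ?case
    by (intro exI[of _ "\<lambda>f p. c f p + d f p"]) (auto intro: Rm.add simp: sum.distrib algebra_simps)
next
  case (smult h f)
  then obtain c where "\<forall>f\<in>F. c f \<in> Rm M" "\<forall>p. f p = (\<Sum>f\<in>F. c f p * f p)" by blast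
  then show ?case using smult
    by (intro exI[of _ "\<lambda>f p. h p * c f p"]) (auto intro: Rm.mult simp: sum_distrib_left algebra_simps)
qed

section \<open>The generalized equation and its symmetries\<close>

definition jg :: "'k::comm_ring_1 fps \<Rightarrow> 'k fps \<Rightarrow> 'k fps \<Rightarrow> 'k fps \<Rightarrow> 'k fps \<Rightarrow> 'k fps \<Rightarrow> 'k fps" where
  "jg A B C x y z = x^2 + y^2 * z + y * z^2 + x * (A * y^2 + B * y * z + C * z^2)"

text \<open>The sequences are not cut off: coefficient \<open>j\<close> involves only coordinates up
  to \<open>j\<close>, so the number of equations can vary independently of the ambient truncation
  order.\<close>

definition jf :: "'k::comm_ring_1 fps \<Rightarrow> 'k fps \<Rightarrow> 'k fps \<Rightarrow> nat \<Rightarrow> 'k jpt \<Rightarrow> 'k" where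
  "jf A B C j = (\<lambda>(a, b, c). fps_nth (jg A B C (Abs_fps a) (Abs_fps b) (Abs_fps c)) j)"

text \<open>With weights 3, 2, 2 the terms \<open>x^2\<close>, \<open>y^2 * z\<close> and
  \<open>y * z^2\<close> have weight 6 and the cross term has weight 7; the surplus factor is
  absorbed by \<open>A\<close>, \<open>B\<close> and \<open>C\<close>.\<close>

lemma jg_scale: "jg A B C (t ^ 3 * x) (t ^ 2 * y) (t ^ 2 * z) = t ^ 6 * jg (t * A) (t * B) (t * C) x y z"
  by (simp add: jg_def algebra_simps eval_nat_numeral)

lemma jg_swap: "jg A B C x z y = jg C B A x y z"
  by (simp add: jg_def algebra_simps)

text \<open>In characteristic 2 the map taking \<open>(y, z)\<close> to \<open>(y + z, y)\<close>
  permutes the three linear factors of \<open>y * z * (y + z)\<close> cyclically. The new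
  coefficients come from writing the cross term in the new variables.\<close>

lemma jg_shear:
  assumes "(2 :: 'a::comm_ring_1 fps) = 0"
  shows "jg A B C x y z = jg C B (A + B + C) x (y + z) (y :: 'a fps)"
proof -
  have "jg C B (A + B + C) x (y + z) y =
      jg A B C x y z + 2 * (y * y * y + y * y * z + x * (C * y * y + C * y * z + B * y * y))"
    by (simp add: jg_def algebra_simps power2_eq_square)
  then show ?thesis using assms by simp
qed

text \<open>The terms of the expansion that mix \<open>y\<close> with \<open>\<delta>\<close> carry
  a factor 2, so the increment does not depend on \<open>y\<close>. This makes the equations
  triangular in the coefficients of \<open>y\<close>.\<close>

lemma jg_add:
  assumes "(2 :: 'a::comm_ring_1 fps) = 0"
  shows "jg A B C x (y + \<delta>) z =
    jg A B C x y z + \<delta> * z^2 + \<delta>^2 * z + ((x * A) * \<delta>^2 + (x * B) * \<delta> * (z :: 'a fps))"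
proof -
  have "jg A B C x (y + \<delta>) z =
    jg A B C x y z + \<delta> * z^2 + \<delta>^2 * z + ((x * A) * \<delta>^2 + (x * B) * \<delta> * z) + 2 * (y * \<delta> * z + x * A * y * \<delta>)"
    by (simp add: jg_def algebra_simps power2_eq_square)
  then show ?thesis using assms by simp
qed

lemma jf_simps: "jf A B C j (a, b, c) = fps_nth (jg A B C (Abs_fps a) (Abs_fps b) (Abs_fps c)) j"
  by (simp add: jf_def)

definition Rm_fps :: "nat \<Rightarrow> ('k::comm_ring_1 jpt \<Rightarrow> 'k fps) \<Rightarrow> bool" where
  "Rm_fps M F \<longleftrightarrow> (\<forall>i\<le>M. (\<lambda>p. fps_nth (F p) i) \<in> Rm M)"

lemma Rm_fps_intros:
  fixes F H :: "'k::comm_ring_1 jpt \<Rightarrow> 'k fps"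
  shows "Rm_fps M (\<lambda>_. A)"
  "Rm_fps M F \<Longrightarrow> Rm_fps M H \<Longrightarrow> Rm_fps M (\<lambda>p. F p + H p)"
  "Rm_fps M F \<Longrightarrow> Rm_fps M H \<Longrightarrow> Rm_fps M (\<lambda>p. F p * H p)"
  "Rm_fps M (\<lambda>p::'k jpt. Abs_fps (fst p))" "Rm_fps M (\<lambda>p::'k jpt. Abs_fps (fst (snd p)))"
  "Rm_fps M (\<lambda>p::'k jpt. Abs_fps (snd (snd p)))"
proof -
  have "(\<lambda>p::'k jpt. fst p i) \<in> Rm M" "(\<lambda>p::'k jpt. fst (snd p) i) \<in> Rm M" "(\<lambda>p::'k jpt. snd (snd p) i) \<in> Rm M"
    if "i \<le> M" for i
    using Rm.varx[OF that, where 'k = 'k] Rm.vary[OF that, where 'k = 'k] Rm.varz[OF that, where 'k = 'k]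
    by (simp_all add: xv_def yv_def zv_def case_prod_beta')
  then show "Rm_fps M (\<lambda>p::'k jpt. Abs_fps (fst p))" "Rm_fps M (\<lambda>p::'k jpt. Abs_fps (fst (snd p)))"
  "Rm_fps M (\<lambda>p::'k jpt. Abs_fps (snd (snd p)))"
    by (simp_all add: Rm_fps_def)
qed (auto simp: Rm_fps_def fps_mult_nth intro!: Rm_intros)

lemma jf_Rm: "j \<le> M \<Longrightarrow> jf A B C j \<in> Rm M"
proof -
  assume "j \<le> M"
  have "Rm_fps M (\<lambda>p. jg A B C (Abs_fps (fst p)) (Abs_fps (fst (snd p))) (Abs_fps (snd (snd p))))"
    unfolding jg_def power2_eq_square by (intro Rm_fps_intros)
  then show "jf A B C j \<in> Rm M" using \<open>j \<le> M\<close> by (simp add: Rm_fps_def jf_def case_prod_beta')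
qed

definition trunc :: "nat \<Rightarrow> 'k::zero jpt \<Rightarrow> 'k jpt" where
  "trunc m p = (\<lambda>i. if i \<le> m then xv i p else 0, \<lambda>i. if i \<le> m then yv i p else 0, \<lambda>i. if i \<le> m then zv i p else 0)"

lemma trunc_simps: "trunc m (a, b, c) =
    (\<lambda>i. if i \<le> m then a i else 0, \<lambda>i. if i \<le> m then b i else 0, \<lambda>i. if i \<le> m then c i else 0)"
  unfolding trunc_def coord_simps ..

lemma trunc_jet_space: "trunc m p \<in> jet_space m"
  by (simp add: trunc_def jet_space_def)

lemma Rm_trunc: "u \<in> Rm m \<Longrightarrow> u (trunc m p) = u p"
  by (rule Rm_cong) (auto simp: trunc_def)

lemma gj_eq_jf: "j \<le> m \<Longrightarrow> gj m j = jf 0 1 0 j"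
proof
  fix p :: "'a jpt"
  assume "j \<le> m"
  obtain a b c where p: "p = (a, b, c)" by (cases p)
  have "gj m j p = jf 0 1 0 j (trunc m p)"
    by (simp add: p gj_def jf_def trunc_simps arc_def jg_def gpoly_def mult.assoc)
  then show "gj m j p = jf 0 1 0 j p" using Rm_trunc[OF jf_Rm[OF \<open>j \<le> m\<close>]] by simp
qed

lemma Gm_eq: "Gm m = {jf 0 1 0 j |j. j < Suc m}"
  using gj_eq_jf unfolding Gm_def by (force simp: less_Suc_eq_le)

lemma fps_X_power_dvdI: "(\<And>i. i < e \<Longrightarrow> a i = 0) \<Longrightarrow> Abs_fps a = fps_X ^ e * Abs_fps (\<lambda>i. a (i + e))"
  by (auto simp: fps_eq_iff fps_X_power_mult_nth)

lemma jf_shift: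
  "jf A B C j (\<lambda>i. if i < 3 then 0 else a (i - 3), \<lambda>i. if i < 2 then 0 else b (i - 2), \<lambda>i. if i < 2 then 0 else c (i - 2)) =
   (if j < 6 then 0 else jf (fps_X * A) (fps_X * B) (fps_X * C) (j - 6) (a, b, c))"
proof -
  let ?x = "Abs_fps a" and ?y = "Abs_fps b" and ?z = "Abs_fps c"
  have s: "Abs_fps (\<lambda>i. if i < 3 then 0 else a (i - 3)) = fps_X ^ 3 * ?x"
    "Abs_fps (\<lambda>i. if i < 2 then 0 else b (i - 2)) = fps_X ^ 2 * ?y"
    "Abs_fps (\<lambda>i. if i < 2 then 0 else c (i - 2)) = fps_X ^ 2 * ?z"
    by (auto simp: fps_eq_iff fps_X_power_mult_nth)
  show ?thesis by (simp add: jf_def s jg_scale fps_X_power_mult_nth)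
qed

lemma jf_swap: "jf A B C j (a, c, b) = jf C B A j (a, b, c)"
  by (simp add: jf_def jg_swap)

section \<open>Varying the coefficients of y in characteristic 2\<close>

locale char_two =
  fixes K :: "'k::alg_closed_field itself"
  assumes char2: "CHAR('k) = 2"
begin

lemma two_fps: "(2 :: 'k fps) = 0"
  using of_nat_CHAR[where 'a = "'k fps"] by (simp add: char2)

lemma two_zero: "(2 :: 'k) = 0"
  using of_nat_CHAR[where 'a = 'k] by (simp add: char2)

lemma add_self [simp]: "x + x = (0 :: 'k)"
  using two_zero by (metis mult_2 mult_zero_left)

lemma diff_eq_add: "x - y = x + (y :: 'k)"
  by (rule minus_CHAR_2[OF char2])

lemma square_add: "(x + y)^2 = x^2 + (y :: 'k)^2"
  by (simp add: power2_sum two_zero)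

lemma jf_shear: "jf A B C j (a, b, c) = jf C B (A + B + C) j (a, \<lambda>i. b i + c i, b :: nat \<Rightarrow> 'k)"
proof -
  have e: "Abs_fps (\<lambda>i. b i + c i) = Abs_fps b + Abs_fps c" by (simp add: fps_eq_iff)
  show ?thesis unfolding jf_simps e
    by (rule arg_cong[OF jg_shear[OF two_fps], where f = "\<lambda>F. fps_nth F j"])
qed

text \<open>A comparison of orders: \<open>\<delta> * z^2\<close> starts at \<open>3 * e + k\<close>
  and \<open>\<delta>^2 * z\<close> at \<open>3 * e + 2 * k\<close>. The cross terms come at least
  one order after \<open>3 * e + k\<close> because \<open>x * A\<close> and \<open>x * B\<close> are
  divisible by \<open>fps_X ^ (e + 1)\<close>.\<close>

lemma jg_step:
  fixes x y z \<delta> :: "'k fps"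
  assumes "z = fps_X ^ e * z'" "x * A = fps_X ^ (e + 1) * u" "x * B = fps_X ^ (e + 1) * v"
    and "\<delta> = fps_X ^ (e + k) * \<delta>'"
  shows "jg A B C x (y + \<delta>) z = jg A B C x y z +
     fps_X ^ (3 * e + k) * (\<delta>' * z'^2 + fps_X ^ k * (\<delta>'^2 * z') + fps_X * (fps_X ^ k * u * \<delta>'^2 + v * \<delta>' * z'))"
proof -
  have e3: "3 * e + k = e + e + e + k" by simp
  have "jg A B C x (y + \<delta>) z = jg A B C x y z + \<delta> * z^2 + \<delta>^2 * z + ((x * A) * \<delta>^2 + (x * B) * \<delta> * z)"
    by (rule jg_add[OF two_fps])
  also have "\<dots> = jg A B C x y z +
     fps_X ^ (3 * e + k) * (\<delta>' * z'^2 + fps_X ^ k * (\<delta>'^2 * z') + fps_X * (fps_X ^ k * u * \<delta>'^2 + v * \<delta>' * z'))"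
    unfolding assms e3 power_add power_one_right by (simp add: power2_eq_square algebra_simps)
  finally show ?thesis .
qed

text \<open>Equation \<open>j + 2 * e\<close> is the first to notice a change of \<open>y\<close> at
  index \<open>j\<close>, and it does so with the factor \<open>c e ^ 2\<close>. At
  \<open>j = e\<close> the quadratic term has the same order, hence the extra summand.\<close>

lemma jf_step:
  assumes c: "\<And>i. i < e \<Longrightarrow> c i = 0"
    and u: "Abs_fps a * A = fps_X ^ (e + 1) * u" and v: "Abs_fps a * B = fps_X ^ (e + 1) * v"
    and j: "e \<le> j" and b: "\<And>i. i < j \<Longrightarrow> b' i = (b i :: 'k)"
  shows "i < j + 2 * e \<Longrightarrow> jf A B C i (a, b', c) = jf A B C i (a, b, c)"
    and "jf A B C (j + 2 * e) (a, b', c) = jf A B C (j + 2 * e) (a, b, c) + (b' j - b j) * c e ^ 2 +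
          (if j = e then (b' j - b j) ^ 2 * c e else 0)"
proof -
  define k where "k = j - e"
  define \<delta> where "\<delta> = Abs_fps (\<lambda>i. b' i - b i)"
  define \<delta>' where "\<delta>' = Abs_fps (\<lambda>i. b' (i + j) - b (i + j))"
  define z' where "z' = Abs_fps (\<lambda>i. c (i + e))"
  have z: "Abs_fps c = fps_X ^ e * z'" unfolding z'_def using c by (rule fps_X_power_dvdI)
  have ek: "e + k = j" using j by (simp add: k_def)
  have d: "\<delta> = fps_X ^ (e + k) * \<delta>'" unfolding ek \<delta>_def \<delta>'_def
    by (rule fps_X_power_dvdI) (simp add: b)
  have b': "Abs_fps b' = Abs_fps b + \<delta>" by (simp add: fps_eq_iff \<delta>_def)
  define R where "R = \<delta>' * z'^2 + fps_X ^ k * (\<delta>'^2 * z') + fps_X * (fps_X ^ k * u * \<delta>'^2 + v * \<delta>' * z')"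
  have jk: "j + 2 * e = 3 * e + k" using j by (simp add: k_def)
  have eq: "jg A B C (Abs_fps a) (Abs_fps b') (Abs_fps c) = jg A B C (Abs_fps a) (Abs_fps b) (Abs_fps c) + fps_X ^ (j + 2 * e) * R"
    unfolding b' jk R_def by (rule jg_step[OF z u v d])
  show "jf A B C i (a, b', c) = jf A B C i (a, b, c)" if "i < j + 2 * e"
    using that by (simp add: jf_def eq fps_X_power_mult_nth)
  have "fps_nth R 0 = (b' j - b j) * c e ^ 2 + (if j = e then (b' j - b j) ^ 2 * c e else 0)"
  proof (cases "k = 0")
    case True
    then have "j = e" using j by (simp add: k_def)
    then show ?thesis using True by (simp add: R_def \<delta>'_def z'_def fps_mult_nth_0 fps_power_zeroth)
  next
    case False
    then have "j \<noteq> e" by (simp add: k_def)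
    then show ?thesis using False
      by (simp add: R_def \<delta>'_def z'_def fps_mult_nth_0 fps_power_zeroth)
  qed
  then show "jf A B C (j + 2 * e) (a, b', c) = jf A B C (j + 2 * e) (a, b, c) + (b' j - b j) * c e ^ 2 +
          (if j = e then (b' j - b j) ^ 2 * c e else 0)"
    by (simp only: jf_simps eq fps_add_nth fps_X_power_mult_nth) simp
qed

end

section \<open>Graphs over affine space\<close>

definition origin :: "'k::zero jpt" where
  "origin = (\<lambda>_. 0, \<lambda>_. 0, \<lambda>_. 0)"

lemma origin_simps [simp]: "xv i origin = 0" "yv i origin = 0" "zv i origin = 0"
  by (simp_all add: origin_def)

definition mix :: "nat set \<Rightarrow> nat set \<Rightarrow> nat set \<Rightarrow> 'k jpt \<Rightarrow> 'k jpt \<Rightarrow> 'k jpt" where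
  "mix X Y Z p q = (\<lambda>i. if i \<in> X then xv i p else xv i q, \<lambda>i. if i \<in> Y then yv i p else yv i q,
     \<lambda>i. if i \<in> Z then zv i p else zv i q)"

lemma mix_simps [simp]:
  "xv i (mix X Y Z p q) = (if i \<in> X then xv i p else xv i q)"
  "yv i (mix X Y Z p q) = (if i \<in> Y then yv i p else yv i q)"
  "zv i (mix X Y Z p q) = (if i \<in> Z then zv i p else zv i q)"
  by (simp_all add: mix_def)

lemma Rm_if: "(P \<Longrightarrow> f \<in> Rm M) \<Longrightarrow> (\<not> P \<Longrightarrow> g \<in> Rm M) \<Longrightarrow> (\<lambda>q. if P then f q else g q) \<in> Rm M"
  by (cases P) simp_all

text \<open>\<open>X\<close>, \<open>Y\<close>, \<open>Z\<close> index the dependent coordinates,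
  and \<open>mix X Y Z origin\<close> projects to the free ones by zeroing the rest.
  \<open>lift\<close> asks only that free coordinates with \<open>d\<close> nonzero extend to a zero
  of \<open>J\<close>; that they determine the dependent ones is expressed by \<open>red\<close>
  below.\<close>

locale graph_chart = char_two K for K :: "'k::alg_closed_field itself" +
  fixes M :: nat and X Y Z :: "nat set" and J :: "('k jpt \<Rightarrow> 'k) set" and d :: "'k jpt \<Rightarrow> 'k"
  assumes J: "is_ideal M J" and d: "d \<in> Rm M" "\<And>q. d (mix X Y Z origin q) = d q"
    and lift: "\<And>q. d q \<noteq> 0 \<Longrightarrow> \<exists>p. (\<forall>u\<in>J. u p = 0) \<and> mix X Y Z origin p = mix X Y Z origin q"
begin

definition free :: "('k jpt \<Rightarrow> 'k) \<Rightarrow> bool" where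
  "free F \<longleftrightarrow> F \<in> Rm M \<and> (\<forall>q. F (mix X Y Z origin q) = F q)"

text \<open>Squares are used because only the square of a coordinate of the chart need be a function of
  the free coordinates.\<close>
definition red :: "('k jpt \<Rightarrow> 'k) \<Rightarrow> bool" where
  "red u \<longleftrightarrow> u \<in> Rm M \<and> (\<exists>N F. free F \<and> (\<lambda>q. d q ^ N * u q ^ 2 - F q) \<in> J)"

lemma free_intros:
  "free (\<lambda>_. c)" "free d" "free F \<Longrightarrow> free G \<Longrightarrow> free (\<lambda>q. F q + G q)"
  "free F \<Longrightarrow> free G \<Longrightarrow> free (\<lambda>q. F q * G q)" "free F \<Longrightarrow> free (\<lambda>q. F q ^ n)"
  unfolding free_def using d by (auto intro: Rm_intros)

lemma red_free: "free F \<Longrightarrow> red F"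
  unfolding red_def using is_idealD(2)[OF J]
  by (auto simp: free_def intro!: exI[of _ 0] exI[of _ "\<lambda>q. F q ^ 2"] Rm_intros)

lemma red_J: "u \<in> J \<Longrightarrow> red u"
  unfolding red_def using is_idealD(1)[OF J] is_idealD(4)[OF J, of u u]
  by (auto intro!: exI[of _ 0] exI[of _ "\<lambda>_. 0"] free_intros simp: power2_eq_square)

text \<open>Squaring is additive in characteristic 2, so no mixed term \<open>u q * v q\<close>
  arises.\<close>

lemma red_add:
  assumes "red u" "red v"
  shows "red (\<lambda>q. u q + v q)"
proof -
  obtain N F N' F' where *: "free F" "(\<lambda>q. d q ^ N * u q ^ 2 - F q) \<in> J"
    "free F'" "(\<lambda>q. d q ^ N' * v q ^ 2 - F' q) \<in> J" using assms unfolding red_def by blast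
  have "(\<lambda>q. d q ^ N' * (d q ^ N * u q ^ 2 - F q) + d q ^ N * (d q ^ N' * v q ^ 2 - F' q)) \<in> J"
    by (intro is_idealD[OF J] Rm_power d *)
  also have "(\<lambda>q. d q ^ N' * (d q ^ N * u q ^ 2 - F q) + d q ^ N * (d q ^ N' * v q ^ 2 - F' q)) =
      (\<lambda>q. d q ^ (N + N') * (u q + v q) ^ 2 - (d q ^ N' * F q + d q ^ N * F' q))"
    by (simp add: square_add power_add algebra_simps)
  finally show ?thesis using assms unfolding red_def
    by (intro conjI exI[of _ "N + N'"] exI[of _ "\<lambda>q. d q ^ N' * F q + d q ^ N * F' q"] free_intros * Rm.intros) auto
qed

lemma red_mult:
  assumes "red u" "red v"
  shows "red (\<lambda>q. u q * v q)"
proof -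
  obtain N F N' F' where *: "free F" "(\<lambda>q. d q ^ N * u q ^ 2 - F q) \<in> J"
    "free F'" "(\<lambda>q. d q ^ N' * v q ^ 2 - F' q) \<in> J" using assms unfolding red_def by blast
  have R: "v \<in> Rm M" "F \<in> Rm M" using assms * by (auto simp: red_def free_def)
  have "(\<lambda>q. (d q ^ N' * v q ^ 2) * (d q ^ N * u q ^ 2 - F q) + F q * (d q ^ N' * v q ^ 2 - F' q)) \<in> J"
    by (intro is_idealD[OF J] Rm_power Rm.mult d * R)
  also have "(\<lambda>q. (d q ^ N' * v q ^ 2) * (d q ^ N * u q ^ 2 - F q) + F q * (d q ^ N' * v q ^ 2 - F' q)) =
      (\<lambda>q. d q ^ (N + N') * (u q * v q) ^ 2 - F q * F' q)"
    by (simp add: power_mult_distrib power_add algebra_simps)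
  finally show ?thesis using assms unfolding red_def
    by (intro conjI exI[of _ "N + N'"] exI[of _ "\<lambda>q. F q * F' q"] free_intros * Rm.intros) auto
qed

text \<open>Multiplication by \<open>d q ^ e * u q + v q\<close> turns the congruence into one of
  squares. This is how an equation is solved for a dependent coordinate.\<close>

lemma red_div:
  assumes "u \<in> Rm M" "red v" "(\<lambda>q. d q ^ e * u q - v q) \<in> J"
  shows "red u"
proof -
  obtain N F where *: "free F" "(\<lambda>q. d q ^ N * v q ^ 2 - F q) \<in> J" using assms unfolding red_def by blast
  have v: "v \<in> Rm M" using assms by (simp add: red_def)
  have "(\<lambda>q. (d q ^ N * (d q ^ e * u q + v q)) * (d q ^ e * u q - v q) + (d q ^ N * v q ^ 2 - F q)) \<in> J"
    by (intro is_idealD[OF J] Rm_power Rm.mult Rm.add d * assms v)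
  also have "(\<lambda>q. (d q ^ N * (d q ^ e * u q + v q)) * (d q ^ e * u q - v q) + (d q ^ N * v q ^ 2 - F q)) =
      (\<lambda>q. d q ^ (N + 2 * e) * u q ^ 2 - F q)"
    unfolding power_add power_mult mult_2 power2_eq_square by (simp add: algebra_simps)
  finally show ?thesis using assms * unfolding red_def by blast
qed

lemma red_comp:
  assumes "u \<in> Rm M" "\<And>i. i \<le> M \<Longrightarrow> red (\<lambda>q. xv i (\<kappa> q))" "\<And>i. i \<le> M \<Longrightarrow> red (\<lambda>q. yv i (\<kappa> q))"
    "\<And>i. i \<le> M \<Longrightarrow> red (\<lambda>q. zv i (\<kappa> q))"
  shows "red (\<lambda>q. u (\<kappa> q))"
  using assms(1) by (induction rule: Rm_induct) (auto intro: assms red_add red_mult red_free free_intros)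

definition chart :: "'k jpt set" where
  "chart = {p. d p \<noteq> 0 \<and> (\<forall>u\<in>J. u p = 0)}"

lemma free_eq:
  assumes "free F" "mix X Y Z origin p = mix X Y Z origin q"
  shows "F p = F q"
proof -
  have *: "F (mix X Y Z origin q) = F q" for q using assms(1) unfolding free_def by blast
  show ?thesis using *[of p] *[of q] unfolding assms(2) by (rule trans[OF sym])
qed

lemma d_lift: "mix X Y Z origin p = mix X Y Z origin q \<Longrightarrow> d p = d q"
  by (rule free_eq[OF free_intros(2)])

context
  assumes coords: "\<And>i. i \<le> M \<Longrightarrow> red (xv i)" "\<And>i. i \<le> M \<Longrightarrow> red (yv i)" "\<And>i. i \<le> M \<Longrightarrow> red (zv i)"
begin

lemma red_all: "u \<in> Rm M \<Longrightarrow> red u"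
  using red_comp[of u "\<lambda>p. p"] coords by auto

text \<open>A Nullstellensatz for the chart. Modulo \<open>J\<close>, some
  \<open>d ^ N * u ^ 2\<close> is a function \<open>F\<close> of the free coordinates; by
  \<open>lift\<close> it vanishes wherever \<open>d\<close> does not, so \<open>d * F\<close> is the
  zero function and one more factor \<open>d\<close> removes \<open>F\<close> from the
  congruence.\<close>

lemma chart_vanish:
  assumes u: "u \<in> Rm M" and van: "\<And>p. p \<in> chart \<Longrightarrow> u p = 0"
  shows "\<exists>N. (\<lambda>q. d q ^ N * u q ^ 2) \<in> J"
proof -
  obtain N F where *: "free F" "(\<lambda>q. d q ^ N * u q ^ 2 - F q) \<in> J" using red_all[OF u] unfolding red_def by blast
  have "d q * F q = 0" for q
  proof (cases "d q = 0")
    case False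
    then obtain p where p: "\<forall>u\<in>J. u p = 0" "mix X Y Z origin p = mix X Y Z origin q" using lift by blast
    have "p \<in> chart" using p False d_lift[OF p(2)] by (simp add: chart_def)
    then have "u p = 0" by (rule van)
    then have "F p = 0" using bspec[OF p(1) *(2)] by simp
    moreover have "F p = F q" using *(1) p(2) by (rule free_eq)
    ultimately show ?thesis by simp
  qed simp
  moreover have "(\<lambda>q. d q * (d q ^ N * u q ^ 2 - F q)) \<in> J" by (intro is_idealD[OF J] d *)
  moreover have "d q * (d q ^ N * u q ^ 2 - F q) = d q ^ Suc N * u q ^ 2 - d q * F q" for q
    by (simp add: right_diff_distrib mult.assoc)
  ultimately have "(\<lambda>q. d q ^ Suc N * u q ^ 2) \<in> J" by (simp only: diff_zero)
  then show ?thesis by blast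
qed

text \<open>Both functions are compared with functions of the free coordinates, where two nonzero
  functions have a common point of nonvanishing; \<open>lift\<close> brings that point back to the
  chart.\<close>

lemma chart_irreducible:
  assumes u: "u \<in> Rm M" "v \<in> Rm M" and pq: "p \<in> chart" "q \<in> chart" "u p \<noteq> 0" "v q \<noteq> 0"
  shows "\<exists>r\<in>chart. u r \<noteq> 0 \<and> v r \<noteq> 0"
proof -
  obtain N F where F: "free F" "(\<lambda>q. d q ^ N * u q ^ 2 - F q) \<in> J" using red_all[OF u(1)] unfolding red_def by blast
  obtain N' G where G: "free G" "(\<lambda>q. d q ^ N' * v q ^ 2 - G q) \<in> J" using red_all[OF u(2)] unfolding red_def by blast
  have eq: "F r = d r ^ N * u r ^ 2" "G r = d r ^ N' * v r ^ 2" if "r \<in> chart" for r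
    using bspec[of J "\<lambda>u. u r = 0", OF _ F(2)] bspec[of J "\<lambda>u. u r = 0", OF _ G(2)] that
    by (simp_all add: chart_def)
  have "d p * F p \<noteq> 0" "d q * G q \<noteq> 0" using pq by (simp_all add: eq) (simp_all add: chart_def)
  then obtain r where r: "d r * F r \<noteq> 0" "d r * G r \<noteq> 0"
    using Rm_common_nonzero[of "\<lambda>q. d q * F q" M "\<lambda>q. d q * G q" p q] F(1) G(1) d
    by (auto simp: free_def intro: Rm.mult)
  then obtain s where s: "\<forall>u\<in>J. u s = 0" "mix X Y Z origin s = mix X Y Z origin r" using lift[of r] by auto
  have "s \<in> chart" using s r d_lift[OF s(2)] by (simp add: chart_def)
  moreover have "F s = F r" "G s = G r" using F(1) G(1) s(2) by (auto intro: free_eq)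
  ultimately show ?thesis using r eq[of s] by (intro bexI[of _ s]) auto
qed

end

end

section \<open>Solving the equations for the coefficients of y\<close>

context char_two
begin

text \<open>For \<open>j > e\<close>, equation \<open>j + 2 * e\<close> is solved by adjusting
  \<open>b j\<close>, with invertible factor \<open>c e ^ 2\<close>, and the adjustment leaves all
  earlier equations alone. Equations below \<open>3 * e + 1\<close> see only \<open>b i\<close> with
  \<open>i \<le> e\<close>, which stay as they are, so these equations are assumed.\<close>

lemma solve_y:
  assumes c: "\<And>i. i < e \<Longrightarrow> c i = 0" and ce: "c e \<noteq> (0 :: 'k)"
    and u: "Abs_fps a * A = fps_X ^ (e + 1) * u" and v: "Abs_fps a * B = fps_X ^ (e + 1) * v"
    and base: "\<And>i. i < 3 * e + 1 \<Longrightarrow> i < n \<Longrightarrow> jf A B C i (a, b, c) = 0"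
  shows "\<exists>b'. (\<forall>i. i \<le> e \<or> n \<le> i + 2 * e \<longrightarrow> b' i = b i) \<and> (\<forall>i<n. jf A B C i (a, b', c) = 0)"
  using base
proof (induction n)
  case (Suc n)
  then obtain b' where b': "\<And>i. i \<le> e \<or> n \<le> i + 2 * e \<Longrightarrow> b' i = b i" "\<And>i. i < n \<Longrightarrow> jf A B C i (a, b', c) = 0"
    by force
  show ?case
  proof (cases "n < 3 * e + 1")
    case True
    then show ?thesis using Suc.prems by (intro exI[of _ b]) auto
  next
    case False
    define j where "j = n - 2 * e"
    have j: "j + 2 * e = n" "e < j" using False by (auto simp: j_def)
    define b'' where "b'' = b'(j := b' j + jf A B C n (a, b', c) / c e ^ 2)"
    have agree: "b'' i = b' i" if "i < j" for i using that by (simp add: b''_def)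
    note step = jf_step[where C = C and c = c and b = b' and b' = b'' and j = j, OF c u v less_imp_le[OF j(2)] agree]
    have "jf A B C i (a, b'', c) = 0" if "i < Suc n" for i
    proof (cases "i = n")
      case False
      then show ?thesis using that step(1)[where i = i] b'(2)[of i] by (simp add: j)
    next
      case True
      then show ?thesis using step(2) j ce by (simp add: b''_def)
    qed
    moreover have "b'' i = b i" if "i \<le> e \<or> Suc n \<le> i + 2 * e" for i
      using that j b'(1)[of i] by (auto simp: b''_def)
    ultimately show ?thesis by blast
  qed
qed auto

lemma fps_const_0_dvd: "fps_nth A 0 = 0 \<Longrightarrow> \<exists>A'. A = fps_X * (A' :: 'k fps)"
proof -
  assume "fps_nth A 0 = 0"
  then have "A = fps_X * fps_shift 1 A" by (simp add: fps_eq_iff fps_X_mult_nth)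
  then show ?thesis ..
qed

lemma jf_0:
  assumes "fps_nth A 0 = 0" "fps_nth B 0 = 0" "fps_nth C 0 = 0"
  shows "jf A B C 0 p = xv 0 p ^ 2 + yv 0 p ^ 2 * zv 0 p + yv 0 p * zv 0 (p :: 'k jpt) ^ 2"
  using assms by (cases p) (simp add: jf_def jg_def fps_mult_nth_0 fps_power_zeroth)

text \<open>Every term of the equation has order at least 4 here. The bound 4 is
  \<open>3 * e + 1\<close> for \<open>e = 1\<close>, the range of equations that
  \<open>solve_y\<close> wants in advance.\<close>

lemma jf_low:
  assumes "a 0 = 0" "a 1 = 0" "b 0 = 0" "b 1 = 0" "c 0 = 0" "i < 4"
  shows "jf A B C i (a, b, c) = (0 :: 'k)"
proof -
  define a' b' c' where "a' = Abs_fps (\<lambda>i. a (i + 2))" "b' = Abs_fps (\<lambda>i. b (i + 2))" "c' = Abs_fps (\<lambda>i. c (i + 1))"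
  have e: "Abs_fps a = fps_X ^ 2 * a'" "Abs_fps b = fps_X ^ 2 * b'" "Abs_fps c = fps_X ^ 1 * c'"
    unfolding a'_b'_c'_def by (rule fps_X_power_dvdI; use assms in \<open>auto simp: less_2_cases_iff\<close>)+
  have "jg A B C (Abs_fps a) (Abs_fps b) (Abs_fps c) = fps_X ^ 4 *
    (a'^2 + fps_X * b'^2 * c' + b' * c'^2 + a' * (fps_X ^ 2 * A * b'^2 + fps_X * B * b' * c' + C * c'^2))"
    unfolding e jg_def by (simp add: algebra_simps eval_nat_numeral)
  then show ?thesis using assms by (simp add: jf_def fps_X_power_mult_nth)
qed

text \<open>The algebraic counterpart of \<open>solve_y\<close>: modulo \<open>J\<close>, equation
  \<open>j + 2 * e\<close> expresses \<open>zv e ^ 2 * yv j\<close> through the coordinates of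
  \<open>x\<close> and \<open>z\<close> and the \<open>yv i\<close> with \<open>i < j\<close>, so
  \<open>red\<close> propagates by induction. \<open>Xe\<close>, \<open>Ye\<close>,
  \<open>Ze\<close> record coordinates that lie in \<open>J\<close>.\<close>

lemma graph_chart_coords_y:
  assumes G: "graph_chart M X Y Z (J :: ('k jpt \<Rightarrow> 'k) set) (zv e)"
    and DJ: "\<And>i. i \<in> Xe \<Longrightarrow> xv i \<in> J" "\<And>i. i \<in> Ye \<Longrightarrow> yv i \<in> J" "\<And>i. i \<in> Ze \<Longrightarrow> zv i \<in> J"
    and jfJ: "\<And>j. j < n \<Longrightarrow> jf A B C j \<in> J" and n: "n \<le> M + 1"
    and Ze: "Ze = {..<e}" 
    and ord: "\<And>a. (\<And>i. i \<in> Xe \<Longrightarrow> a i = 0) \<Longrightarrow> \<exists>u v. Abs_fps a * A = fps_X ^ (e + 1) * u \<and> Abs_fps a * B = fps_X ^ (e + 1) * v"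
    and Y: "\<And>j. j \<in> Y \<Longrightarrow> j \<in> Ye \<or> e < j \<and> j + 2 * e < n"
    and x: "\<And>i. i \<le> M \<Longrightarrow> graph_chart.red M X Y Z J (zv e) (xv i)"
    and z: "\<And>i. i \<le> M \<Longrightarrow> graph_chart.red M X Y Z J (zv e) (zv i)"
  shows "i \<le> M \<Longrightarrow> graph_chart.red M X Y Z J (zv e) (yv i)"
proof -
  interpret graph_chart K M X Y Z J "zv e" by (rule G)
  assume "i \<le> M"
  then show "red (yv i)"
  proof (induction i rule: less_induct)
    case (less j)
    consider "j \<notin> Y" | "j \<in> Ye" | "e < j" "j + 2 * e < n" "j \<notin> Ye" using Y by blast
    then show ?case
    proof cases
      case 1
      then have "free (yv j)" using less.prems by (simp add: free_def Rm.vary)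
      then show ?thesis by (rule red_free)
    next
      case 2
      then show ?thesis using DJ red_J by blast
    next
      case 3
      \<comment> \<open>\<open>\<kappa>0\<close> zeroes coordinates lying in \<open>J\<close>, which
        changes nothing modulo \<open>J\<close>. \<open>\<kappa>\<close> also zeroes
        \<open>yv i\<close> for \<open>i \<ge> j\<close>, which isolates the part of the equation
        free of \<open>yv j\<close>.\<close>
      define \<kappa>0 where "\<kappa>0 = mix Xe Ye Ze (origin :: 'k jpt)"
      define \<kappa> where "\<kappa> = mix Xe (Ye \<union> {j..}) Ze (origin :: 'k jpt)"
      have jM: "j + 2 * e \<le> M" using 3 n by simp
      have eq: "jf A B C (j + 2 * e) (\<kappa>0 q) = zv e q ^ 2 * yv j q - jf A B C (j + 2 * e) (\<kappa> q)" for q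
      proof -
        define a where "a i = (if i \<in> Xe then 0 else xv i q)" for i
        define b where "b i = (if i \<in> Ye \<union> {j..} then 0 else yv i q)" for i
        define b' where "b' i = (if i \<in> Ye then 0 else yv i q)" for i
        define c where "c i = (if i \<in> Ze then 0 else zv i q)" for i
        have \<kappa>: "\<kappa> q = (a, b, c)" "\<kappa>0 q = (a, b', c)"
          by (auto intro!: jpt_eqI simp: \<kappa>_def \<kappa>0_def a_def b_def c_def b'_def)
        obtain u v where uv: "Abs_fps a * A = fps_X ^ (e + 1) * u" "Abs_fps a * B = fps_X ^ (e + 1) * v"
          using ord[of a] by (auto simp: a_def)
        have "jf A B C (j + 2 * e) (a, b', c) = jf A B C (j + 2 * e) (a, b, c) + (b' j - b j) * c e ^ 2 +
          (if j = e then (b' j - b j) ^ 2 * c e else 0)"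
          by (rule jf_step(2)[OF _ uv]) (use 3 in \<open>auto simp: c_def Ze b_def b'_def\<close>)
        then show ?thesis using 3 by (simp add: \<kappa> b'_def b_def c_def Ze diff_eq_add algebra_simps)
      qed
      have "(\<lambda>q. jf A B C (j + 2 * e) q - jf A B C (j + 2 * e) (\<kappa>0 q)) \<in> J"
      proof (rule is_ideal_subst[OF J jf_Rm[OF jM]])
        fix i assume "i \<le> M"
        show "(\<lambda>p. xv i (\<kappa>0 p)) \<in> Rm M" "(\<lambda>p. yv i (\<kappa>0 p)) \<in> Rm M" "(\<lambda>p. zv i (\<kappa>0 p)) \<in> Rm M"
          unfolding \<kappa>0_def using \<open>i \<le> M\<close> by (simp_all add: Rm_if Rm.intros)
        show "(\<lambda>p. xv i p - xv i (\<kappa>0 p)) \<in> J"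
          using DJ(1)[of i] is_idealD(2)[OF J] by (cases "i \<in> Xe") (simp_all add: \<kappa>0_def)
        show "(\<lambda>p. yv i p - yv i (\<kappa>0 p)) \<in> J"
          using DJ(2)[of i] is_idealD(2)[OF J] by (cases "i \<in> Ye") (simp_all add: \<kappa>0_def)
        show "(\<lambda>p. zv i p - zv i (\<kappa>0 p)) \<in> J"
          using DJ(3)[of i] is_idealD(2)[OF J] by (cases "i \<in> Ze") (simp_all add: \<kappa>0_def)
      qed
      from is_ideal_diff[OF J jfJ[OF 3(2)] this] have "(\<lambda>q. zv e q ^ 2 * yv j q - jf A B C (j + 2 * e) (\<kappa> q)) \<in> J"
        by (simp add: eq)
      moreover have "red (\<lambda>q. jf A B C (j + 2 * e) (\<kappa> q))"
      proof (rule red_comp[OF jf_Rm[OF jM]])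
        fix i assume i: "i \<le> M"
        have "red (\<lambda>_. 0)" by (intro red_free free_intros)
        then show "red (\<lambda>q. xv i (\<kappa> q))" "red (\<lambda>q. zv i (\<kappa> q))" "red (\<lambda>q. yv i (\<kappa> q))"
          unfolding \<kappa>_def using x[OF i] z[OF i] less.IH[of i] i
          by (cases "i \<in> Xe"; cases "i \<in> Ze"; cases "i \<in> Ye \<union> {j..}"; auto simp: not_le)+
      qed
      ultimately show ?thesis using less.prems red_div[of "yv j"] by (blast intro: Rm.vary)
    qed
  qed
qed

end

section \<open>The charts of the jet spaces\<close>

definition jset :: "'k::comm_ring_1 fps \<Rightarrow> 'k fps \<Rightarrow> 'k fps \<Rightarrow> nat \<Rightarrow> ('k jpt \<Rightarrow> 'k) set" where
  "jset A B C n = {jf A B C j |j. j < n}"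

definition line_gens :: "'k::comm_ring_1 fps \<Rightarrow> 'k fps \<Rightarrow> 'k fps \<Rightarrow> nat \<Rightarrow> ('k jpt \<Rightarrow> 'k) set" where
  "line_gens A B C n = {xv 0, xv 1, yv 0, yv 1, zv 0} \<union> jset A B C n"

lemma jset_Rm: "n \<le> M + 1 \<Longrightarrow> jset A B C n \<subseteq> Rm M"
  by (auto simp: jset_def intro: jf_Rm)

lemma line_gens_Rm: "n \<le> M + 1 \<Longrightarrow> 1 \<le> M \<Longrightarrow> line_gens A B C n \<subseteq> Rm M"
  using jset_Rm[of n M A B C] by (auto simp: line_gens_def intro: Rm.intros)

lemma gen_ideal_zero_iff: "(\<forall>u\<in>gen_ideal M F. u p = 0) \<longleftrightarrow> (\<forall>f\<in>F. f p = 0)"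
  using gen_ideal_vanish[of _ M F p] gen_ideal.gen[of _ F M] by blast

context char_two
begin

text \<open>The case \<open>e = 0\<close>: equation \<open>j > 0\<close> gives \<open>yv j\<close>
  with factor \<open>zv 0 ^ 2\<close>, while equation 0 gives only the square of
  \<open>xv 0\<close>, whose root exists over an algebraically closed field.\<close>

lemma smooth_chart:
  assumes ABC: "fps_nth A 0 = 0" "fps_nth B 0 = 0" "fps_nth C 0 = 0" and n: "n \<le> M + 1"
  defines "J \<equiv> gen_ideal M (jset A B C n) :: ('k jpt \<Rightarrow> 'k) set"
    and "X \<equiv> {i. i = 0 \<and> 0 < n}" and "Y \<equiv> {j. 0 < j \<and> j < n}"
  shows "graph_chart M X Y {} J (zv 0)"
    and "i \<le> M \<Longrightarrow> graph_chart.red M X Y {} J (zv 0) (xv i)"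
    and "i \<le> M \<Longrightarrow> graph_chart.red M X Y {} J (zv 0) (yv i)"
    and "i \<le> M \<Longrightarrow> graph_chart.red M X Y {} J (zv 0) (zv i)"
proof -
  have J: "is_ideal M J" unfolding J_def by (rule gen_ideal_is_ideal[OF jset_Rm[OF n]])
  have ord: "\<exists>u v. Abs_fps a * A = fps_X ^ (0 + 1) * u \<and> Abs_fps a * B = fps_X ^ (0 + 1) * v" for a
  proof -
    obtain A' B' where "A = fps_X * A'" "B = fps_X * B'" using fps_const_0_dvd ABC by metis
    then show ?thesis
      by (intro exI[of _ "Abs_fps a * A'"] exI[of _ "Abs_fps a * B'"]) (simp add: algebra_simps)
  qed
  show G: "graph_chart M X Y {} J (zv 0)"
  proof (unfold_locales)
    fix q :: "'k jpt" assume q: "zv 0 q \<noteq> 0"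
    define r where "r = yv 0 q ^ 2 * zv 0 q + yv 0 q * zv 0 q ^ 2"
    obtain x0 where x0: "x0 ^ 2 = r" using nth_root_exists[of 2 r] by auto
    define a where "a i = (if i = 0 \<and> 0 < n then x0 else xv i q)" for i
    obtain u v where uv: "Abs_fps a * A = fps_X ^ (0 + 1) * u" "Abs_fps a * B = fps_X ^ (0 + 1) * v" using ord by blast
    have "jf A B C 0 (a, \<lambda>i. yv i q, \<lambda>i. zv i q) = 0" if "0 < n"
      using that jf_0[OF ABC, of "(a, \<lambda>i. yv i q, \<lambda>i. zv i q)"] x0
      by (simp add: a_def r_def add.assoc two_zero)
    then have "\<exists>b'. (\<forall>i. i \<le> 0 \<or> n \<le> i + 2 * 0 \<longrightarrow> b' i = yv i q) \<and> (\<forall>i<n. jf A B C i (a, b', \<lambda>i. zv i q) = 0)"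
      by (intro solve_y[OF _ _ uv]) (use q in auto)
    then obtain b' where b': "\<And>i. i = 0 \<or> n \<le> i \<Longrightarrow> b' i = yv i q" "\<And>i. i < n \<Longrightarrow> jf A B C i (a, b', \<lambda>i. zv i q) = 0"
      by auto
    show "\<exists>p. (\<forall>u\<in>J. u p = 0) \<and> mix X Y {} origin p = mix X Y {} origin q"
    proof (intro exI conjI)
      show "\<forall>u\<in>J. u (a, b', \<lambda>i. zv i q) = 0"
        unfolding J_def gen_ideal_zero_iff using b'(2) by (auto simp: jset_def)
      show "mix X Y {} origin (a, b', \<lambda>i. zv i q) = mix X Y {} origin q"
        using b'(1) by (auto intro!: jpt_eqI simp: a_def X_def Y_def not_less)
    qed
  qed (use J in \<open>auto intro: Rm.intros\<close>)
  interpret graph_chart K M X Y "{}" J "zv 0" by (rule G)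
  show x: "red (xv i)" if "i \<le> M" for i
  proof (cases "i \<in> X")
    case False
    then show ?thesis using that by (intro red_free) (simp add: free_def Rm.varx)
  next
    case True
    then have i: "i = 0" "0 < n" by (auto simp: X_def)
    define F :: "'k jpt \<Rightarrow> 'k" where "F q = yv 0 q ^ 2 * zv 0 q + yv 0 q * zv 0 q ^ 2" for q
    have "free F" unfolding free_def F_def[abs_def] by (auto simp: Y_def intro!: Rm_intros)
    moreover have "jf A B C 0 \<in> J" unfolding J_def jset_def using i by (auto intro: gen_ideal.gen)
    then have "(\<lambda>q. zv 0 q ^ 0 * xv 0 q ^ 2 - F q) \<in> J"
    proof -
      have "(\<lambda>q. zv 0 q ^ 0 * xv 0 q ^ 2 - F q) = jf A B C 0"
        unfolding F_def diff_eq_add by (rule ext) (simp add: jf_0[OF ABC] add.assoc)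
      then show ?thesis using \<open>jf A B C 0 \<in> J\<close> by simp
    qed
    ultimately show ?thesis unfolding red_def i(1) by (blast intro: Rm.varx)
  qed
  show z: "red (zv i)" if "i \<le> M" for i
    using that by (intro red_free) (simp add: free_def Rm.varz)
  show "red (yv i)" if "i \<le> M" for i
    by (rule graph_chart_coords_y[OF G, where Xe = "{}" and Ye = "{}" and Ze = "{}" and n = n and A = A and B = B and C = C])
      (use x z n that ord in \<open>auto simp: Y_def J_def jset_def intro: gen_ideal.gen\<close>)
qed

text \<open>The case \<open>e = 1\<close>: equation \<open>j + 2\<close> gives \<open>yv j\<close>
  for \<open>j \<ge> 2\<close> with factor \<open>zv 1 ^ 2\<close>. Since \<open>x\<close> has order
  at least 2, the cross term has the divisibility that \<open>solve_y\<close> asks for with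
  arbitrary \<open>A\<close>, \<open>B\<close>, \<open>C\<close>.\<close>

lemma line_chart:
  fixes A B C :: "'k fps"
  assumes n: "n \<le> M + 1" "1 \<le> M"
  defines "J \<equiv> gen_ideal M (line_gens A B C n) :: ('k jpt \<Rightarrow> 'k) set"
    and "X \<equiv> {0, 1}" and "Y \<equiv> {0, 1} \<union> {j. j + 2 < n}" and "Z \<equiv> {0}"
  shows "graph_chart M X Y Z J (zv 1)"
    and "i \<le> M \<Longrightarrow> graph_chart.red M X Y Z J (zv 1) (xv i)"
    and "i \<le> M \<Longrightarrow> graph_chart.red M X Y Z J (zv 1) (yv i)"
    and "i \<le> M \<Longrightarrow> graph_chart.red M X Y Z J (zv 1) (zv i)"
proof -
  have J: "is_ideal M J" unfolding J_def by (rule gen_ideal_is_ideal[OF line_gens_Rm[OF n]])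
  have ord: "\<exists>u v. Abs_fps a * A = fps_X ^ (1 + 1) * u \<and> Abs_fps a * B = fps_X ^ (1 + 1) * v"
    if "\<And>i. i \<in> {0, 1} \<Longrightarrow> a i = 0" for a
  proof -
    have "Abs_fps a = fps_X ^ 2 * Abs_fps (\<lambda>i. a (i + 2))"
      by (rule fps_X_power_dvdI) (use that in \<open>auto simp: less_2_cases_iff\<close>)
    then show ?thesis
      by (intro exI[of _ "Abs_fps (\<lambda>i. a (i + 2)) * A"] exI[of _ "Abs_fps (\<lambda>i. a (i + 2)) * B"])
        (simp add: power2_eq_square mult.assoc)
  qed
  show G: "graph_chart M X Y Z J (zv 1)"
  proof (unfold_locales)
    fix q :: "'k jpt" assume q: "zv 1 q \<noteq> 0"
    define a where "a i = (if i \<in> X then 0 else xv i q)" for i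
    define b where "b i = (if i \<in> {0, 1} then 0 else yv i q)" for i
    define c where "c i = (if i \<in> Z then 0 else zv i q)" for i
    obtain u v where uv: "Abs_fps a * A = fps_X ^ (1 + 1) * u" "Abs_fps a * B = fps_X ^ (1 + 1) * v"
      using ord[of a] by (auto simp: a_def X_def)
    have "jf A B C i (a, b, c) = 0" if "i < 4" for i
      by (rule jf_low) (use that in \<open>auto simp: a_def b_def c_def X_def Z_def\<close>)
    then have "\<exists>b'. (\<forall>i. i \<le> 1 \<or> n \<le> i + 2 * 1 \<longrightarrow> b' i = b i) \<and> (\<forall>i<n. jf A B C i (a, b', c) = 0)"
      by (intro solve_y[OF _ _ uv]) (use q in \<open>auto simp: c_def Z_def\<close>)
    then obtain b' where b': "\<And>i. i \<le> 1 \<or> n \<le> i + 2 \<Longrightarrow> b' i = b i" "\<And>i. i < n \<Longrightarrow> jf A B C i (a, b', c) = 0"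
      by auto
    have b01: "b' 0 = 0" "b' 1 = 0" using b'(1)[of 0] b'(1)[of 1] by (auto simp: b_def)
    show "\<exists>p. (\<forall>u\<in>J. u p = 0) \<and> mix X Y Z origin p = mix X Y Z origin q"
    proof (intro exI conjI)
      show "\<forall>u\<in>J. u (a, b', c) = 0"
        unfolding J_def gen_ideal_zero_iff using b'(2) b01
        by (auto simp: line_gens_def jset_def a_def c_def X_def Z_def)
      show "mix X Y Z origin (a, b', c) = mix X Y Z origin q"
        using b'(1) by (auto intro!: jpt_eqI simp: a_def b_def c_def Y_def not_less)
    qed
  qed (use J n in \<open>auto intro: Rm.intros simp: Z_def\<close>)
  interpret graph_chart K M X Y Z J "zv 1" by (rule G)
  have mem: "xv 0 \<in> J" "xv 1 \<in> J" "yv 0 \<in> J" "yv 1 \<in> J" "zv 0 \<in> J" "\<And>j. j < n \<Longrightarrow> jf A B C j \<in> J"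
    unfolding J_def line_gens_def jset_def by (auto intro: gen_ideal.gen)
  show x: "red (xv i)" if "i \<le> M" for i
  proof (cases "i \<in> X")
    case True
    then show ?thesis using mem red_J by (auto simp: X_def)
  next
    case False
    then show ?thesis using that by (intro red_free) (simp add: free_def Rm.varx)
  qed
  show z: "red (zv i)" if "i \<le> M" for i
  proof (cases "i \<in> Z")
    case True
    then show ?thesis using mem red_J by (auto simp: Z_def)
  next
    case False
    then show ?thesis using that by (intro red_free) (simp add: free_def Rm.varz)
  qed
  show "red (yv i)" if "i \<le> M" for i
    by (rule graph_chart_coords_y[OF G, where Xe = "{0, 1}" and Ye = "{0, 1}" and Ze = "{0}" and n = n and A = A and B = B and C = C])
      (use x z n that ord mem in \<open>auto simp: Y_def\<close>)
qed

section \<open>Vanishing and irreducibility on the charts\<close>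

abbreviation on_jets :: "'k fps \<Rightarrow> 'k fps \<Rightarrow> 'k fps \<Rightarrow> nat \<Rightarrow> 'k jpt \<Rightarrow> bool" where
  "on_jets A B C n p \<equiv> \<forall>j<n. jf A B C j p = 0"

abbreviation on_line :: "'k fps \<Rightarrow> 'k fps \<Rightarrow> 'k fps \<Rightarrow> nat \<Rightarrow> 'k jpt \<Rightarrow> bool" where
  "on_line A B C n p \<equiv> on_jets A B C n p \<and> xv 0 p = 0 \<and> xv 1 p = 0 \<and> yv 0 p = 0 \<and> yv 1 p = 0 \<and> zv 0 p = 0"

lemma smooth_chart_vanish:
  assumes "fps_nth A 0 = 0" "fps_nth B 0 = 0" "fps_nth C 0 = 0" "n \<le> M + 1"
    and "u \<in> Rm M" "\<And>p. on_jets A B C n p \<Longrightarrow> zv 0 p \<noteq> 0 \<Longrightarrow> u p = 0"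
  shows "\<exists>N. (\<lambda>q. zv 0 q ^ N * u q ^ 2) \<in> gen_ideal M (jset A B C n)"
proof -
  note G = smooth_chart[OF assms(1-4)]
  have ch: "r \<in> graph_chart.chart (gen_ideal M (jset A B C n)) (zv 0) \<longleftrightarrow> zv 0 r \<noteq> 0 \<and> on_jets A B C n r" for r
    unfolding graph_chart.chart_def[OF G(1)] mem_Collect_eq gen_ideal_zero_iff by (auto simp: jset_def)
  show ?thesis
    by (rule graph_chart.chart_vanish[OF G(1) G(2-4) assms(5)]) (use assms(6) ch in blast)+
qed

lemma smooth_chart_irreducible:
  assumes "fps_nth A 0 = 0" "fps_nth B 0 = 0" "fps_nth C 0 = 0" "n \<le> M + 1"
    and "u \<in> Rm M" "v \<in> Rm M"
    and "on_jets A B C n p" "zv 0 p \<noteq> 0" "u p \<noteq> 0" "on_jets A B C n q" "zv 0 q \<noteq> 0" "v q \<noteq> 0"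
  shows "\<exists>r. on_jets A B C n r \<and> zv 0 r \<noteq> 0 \<and> u r \<noteq> 0 \<and> v r \<noteq> 0"
proof -
  note G = smooth_chart[OF assms(1-4)]
  have ch: "r \<in> graph_chart.chart (gen_ideal M (jset A B C n)) (zv 0) \<longleftrightarrow> zv 0 r \<noteq> 0 \<and> on_jets A B C n r" for r
    unfolding graph_chart.chart_def[OF G(1)] mem_Collect_eq gen_ideal_zero_iff by (auto simp: jset_def)
  have "p \<in> graph_chart.chart (gen_ideal M (jset A B C n)) (zv 0)" "q \<in> graph_chart.chart (gen_ideal M (jset A B C n)) (zv 0)"
    unfolding ch using assms by auto
  from graph_chart.chart_irreducible[OF G(1) G(2-4) assms(5,6) this assms(9) assms(12)]
  obtain r where "r \<in> graph_chart.chart (gen_ideal M (jset A B C n)) (zv 0)" "u r \<noteq> 0" "v r \<noteq> 0" by blast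
  then show ?thesis unfolding ch by blast
qed

lemma line_chart_vanish:
  assumes "n \<le> M + 1" "1 \<le> M"
    and "u \<in> Rm M" "\<And>p. on_line A B C n p \<Longrightarrow> zv 1 p \<noteq> 0 \<Longrightarrow> u p = 0"
  shows "\<exists>N. (\<lambda>q. zv 1 q ^ N * u q ^ 2) \<in> gen_ideal M (line_gens A B C n)"
proof -
  note G = line_chart[where A = A and B = B and C = C, OF assms(1-2)]
  have ch: "r \<in> graph_chart.chart (gen_ideal M (line_gens A B C n)) (zv 1) \<longleftrightarrow> zv 1 r \<noteq> 0 \<and> on_line A B C n r" for r
    unfolding graph_chart.chart_def[OF G(1)] mem_Collect_eq gen_ideal_zero_iff by (auto simp: jset_def line_gens_def)
  show ?thesis
    by (rule graph_chart.chart_vanish[OF G(1) G(2-4) assms(3)]) (use assms(4) ch in blast)+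
qed

lemma line_chart_irreducible:
  assumes "n \<le> M + 1" "1 \<le> M" "u \<in> Rm M" "v \<in> Rm M"
    and "on_line A B C n p" "zv 1 p \<noteq> 0" "u p \<noteq> 0" "on_line A B C n q" "zv 1 q \<noteq> 0" "v q \<noteq> 0"
  shows "\<exists>r. on_line A B C n r \<and> zv 1 r \<noteq> 0 \<and> u r \<noteq> 0 \<and> v r \<noteq> 0"
proof -
  note G = line_chart[where A = A and B = B and C = C, OF assms(1-2)]
  have ch: "r \<in> graph_chart.chart (gen_ideal M (line_gens A B C n)) (zv 1) \<longleftrightarrow> zv 1 r \<noteq> 0 \<and> on_line A B C n r" for r
    unfolding graph_chart.chart_def[OF G(1)] mem_Collect_eq gen_ideal_zero_iff by (auto simp: jset_def line_gens_def)
  have "p \<in> graph_chart.chart (gen_ideal M (line_gens A B C n)) (zv 1)" "q \<in> graph_chart.chart (gen_ideal M (line_gens A B C n)) (zv 1)"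
    unfolding ch using assms by auto
  from graph_chart.chart_irreducible[OF G(1) G(2-4) assms(3,4) this assms(7) assms(10)]
  obtain r where "r \<in> graph_chart.chart (gen_ideal M (line_gens A B C n)) (zv 1)" "u r \<noteq> 0" "v r \<noteq> 0" by blast
  then show ?thesis unfolding ch by blast
qed

lemma line_chart_nonempty:
  fixes A B C :: "'k fps"
  shows "\<exists>p. on_line A B C n p \<and> zv 1 p \<noteq> 0"
proof -
  define M where "M = n + 1"
  note G = line_chart[where A = A and B = B and C = C and n = n and M = M]
  define q :: "'k jpt" where "q = (\<lambda>_. 0, \<lambda>_. 0, \<lambda>_. 1)"
  have M: "n \<le> M + 1" "1 \<le> M" by (auto simp: M_def)
  interpret graph_chart K M "{0, 1}" "{0, 1} \<union> {j. j + 2 < n}" "{0}" "gen_ideal M (line_gens A B C n)" "zv 1"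
    by (rule G(1)[OF M])
  have "zv 1 q \<noteq> 0" by (simp add: q_def)
  from lift[OF this] obtain p where p: "\<forall>u\<in>gen_ideal M (line_gens A B C n). u p = 0"
    "mix {0, 1} ({0, 1} \<union> {j. j + 2 < n}) {0} origin p = mix {0, 1} ({0, 1} \<union> {j. j + 2 < n}) {0} origin q" by blast
  have "zv 1 p = zv 1 q" by (rule d_lift[OF p(2)])
  then show ?thesis using p(1) unfolding gen_ideal_zero_iff
    by (intro exI[of _ p]) (auto simp: line_gens_def jset_def q_def)
qed

end

section \<open>Local radicals\<close>

context char_two
begin

text \<open>The polynomials that become nilpotent in the local ring at \<open>p\<close> of the
  quotient by \<open>F\<close>. Exponents are powers of 2 so that closure under addition follows
  from Frobenius.\<close>

definition local_rad :: "nat \<Rightarrow> ('k jpt \<Rightarrow> 'k) set \<Rightarrow> 'k jpt \<Rightarrow> ('k jpt \<Rightarrow> 'k) set" where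
  "local_rad M F p = {u \<in> Rm M. \<exists>g\<in>Rm M. \<exists>k. g p \<noteq> 0 \<and> (\<lambda>q. g q * u q ^ (2 ^ k)) \<in> gen_ideal M F}"

lemma add_power_two_power: "(x + y) ^ (2 ^ k) = x ^ (2 ^ k) + (y :: 'k) ^ (2 ^ k)"
proof (induction k)
  case (Suc k)
  have "(x + y) ^ (2 ^ Suc k) = ((x + y) ^ (2 ^ k)) ^ 2" by (simp add: mult.commute flip: power_mult)
  also have "\<dots> = (x ^ (2 ^ k)) ^ 2 + (y ^ (2 ^ k)) ^ 2" by (simp add: Suc square_add)
  also have "\<dots> = x ^ (2 ^ Suc k) + y ^ (2 ^ Suc k)" by (simp add: mult.commute flip: power_mult)
  finally show ?case .
qed simp

lemma gen_ideal_raise: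
  assumes "(\<lambda>q. g q * u q ^ a) \<in> gen_ideal M F" "u \<in> Rm M" "a \<le> b"
  shows "(\<lambda>q. g q * u q ^ b) \<in> gen_ideal M F"
proof -
  have "(\<lambda>q. u q ^ (b - a) * (g q * u q ^ a)) \<in> gen_ideal M F"
    by (intro gen_ideal.smult Rm_power assms)
  moreover have "u q ^ (b - a) * (g q * u q ^ a) = g q * u q ^ b" for q
    using assms(3) by (simp add: mult.left_commute flip: power_add)
  ultimately show ?thesis by simp
qed

lemma local_rad_ideal: "is_ideal M (local_rad M F p)"
  unfolding is_ideal_def
proof (intro conjI ballI)
  show "local_rad M F p \<subseteq> Rm M" by (auto simp: local_rad_def)
  show "(\<lambda>_. 0) \<in> local_rad M F p"
    unfolding local_rad_def by (auto intro!: Rm.const bexI[of _ "\<lambda>_. 1"] exI[of _ 0] gen_ideal.zero)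
next
  fix u v assume "u \<in> local_rad M F p" "v \<in> local_rad M F p"
  then obtain g h k l where *: "g \<in> Rm M" "g p \<noteq> 0" "(\<lambda>q. g q * u q ^ (2 ^ k)) \<in> gen_ideal M F" "u \<in> Rm M"
    "h \<in> Rm M" "h p \<noteq> 0" "(\<lambda>q. h q * v q ^ (2 ^ l)) \<in> gen_ideal M F" "v \<in> Rm M" by (auto simp: local_rad_def)
  have "(\<lambda>q. g q * u q ^ (2 ^ (k + l))) \<in> gen_ideal M F" "(\<lambda>q. h q * v q ^ (2 ^ (k + l))) \<in> gen_ideal M F"
    by (rule gen_ideal_raise[OF *(3,4)], simp, rule gen_ideal_raise[OF *(7,8)], simp)
  from gen_ideal.add[OF gen_ideal.smult[OF *(5) this(1)] gen_ideal.smult[OF *(1) this(2)]]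
  have "(\<lambda>q. (g q * h q) * (u q + v q) ^ (2 ^ (k + l))) \<in> gen_ideal M F"
    by (simp add: add_power_two_power algebra_simps)
  then show "(\<lambda>q. u q + v q) \<in> local_rad M F p"
    using * unfolding local_rad_def by (auto intro!: Rm.add bexI[of _ "\<lambda>q. g q * h q"] Rm.mult)
next
  fix h u :: "'k jpt \<Rightarrow> 'k" assume h: "h \<in> Rm M" and "u \<in> local_rad M F p"
  then obtain g k where *: "g \<in> Rm M" "g p \<noteq> 0" "(\<lambda>q. g q * u q ^ (2 ^ k)) \<in> gen_ideal M F" "u \<in> Rm M"
    by (auto simp: local_rad_def)
  have "(\<lambda>q. h q ^ (2 ^ k) * (g q * u q ^ (2 ^ k))) \<in> gen_ideal M F"
    by (intro gen_ideal.smult Rm_power h *)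
  then have "(\<lambda>q. g q * (h q * u q) ^ (2 ^ k)) \<in> gen_ideal M F"
    by (simp add: power_mult_distrib mult.left_commute)
  then show "(\<lambda>q. h q * u q) \<in> local_rad M F p"
    using * h unfolding local_rad_def by (auto intro: Rm.mult)
qed

lemma local_rad_gen: "f \<in> F \<Longrightarrow> f \<in> Rm M \<Longrightarrow> f \<in> local_rad M F p"
  unfolding local_rad_def by (auto intro!: Rm.const bexI[of _ "\<lambda>_. 1"] exI[of _ 0] gen_ideal.gen)

lemma local_rad_radical:
  assumes "u \<in> Rm M" "(\<lambda>q. u q ^ j) \<in> local_rad M F p"
  shows "u \<in> local_rad M F p"
proof -
  obtain g k where *: "g \<in> Rm M" "g p \<noteq> 0" "(\<lambda>q. g q * (u q ^ j) ^ (2 ^ k)) \<in> gen_ideal M F"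
    using assms by (auto simp: local_rad_def)
  then have "(\<lambda>q. g q * u q ^ (j * 2 ^ k)) \<in> gen_ideal M F" by (simp add: power_mult)
  moreover have "j * 2 ^ k \<le> 2 ^ (j + k)" using less_exp[of j] by (simp add: power_add)
  ultimately have "(\<lambda>q. g q * u q ^ (2 ^ (j + k))) \<in> gen_ideal M F" using gen_ideal_raise assms(1) by blast
  then show ?thesis using * assms(1) unfolding local_rad_def by blast
qed

lemma local_rad_cancel:
  assumes "u \<in> Rm M" "w \<in> Rm M" "w p \<noteq> 0" "(\<lambda>q. w q * u q) \<in> local_rad M F p"
  shows "u \<in> local_rad M F p"
proof -
  obtain g k where *: "g \<in> Rm M" "g p \<noteq> 0" "(\<lambda>q. g q * (w q * u q) ^ (2 ^ k)) \<in> gen_ideal M F"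
    using assms by (auto simp: local_rad_def)
  then have "(\<lambda>q. (g q * w q ^ (2 ^ k)) * u q ^ (2 ^ k)) \<in> gen_ideal M F"
    by (simp add: power_mult_distrib mult.assoc)
  then show ?thesis using * assms unfolding local_rad_def
    by (auto intro!: bexI[of _ "\<lambda>q. g q * w q ^ (2 ^ k)"] Rm_intros)
qed

text \<open>If all centered coordinates were nilpotent in the local ring, the equations would
  isolate \<open>p\<close>; by \<open>nilpotent_coordinates_bound\<close> this takes at least as
  many equations as coordinates.\<close>

lemma coords_not_local_rad:
  assumes F: "finite F" "F \<subseteq> Rm M" "\<And>f. f \<in> F \<Longrightarrow> f p = 0" "card F < 3 * (M + 1)"
    and x: "\<And>i. i \<le> M \<Longrightarrow> (\<lambda>q. xv i q - xv i p) \<in> local_rad M F p"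
    and y: "\<And>i. i \<le> M \<Longrightarrow> (\<lambda>q. yv i q - yv i p) \<in> local_rad M F p"
    and z: "\<And>i. i \<le> M \<Longrightarrow> (\<lambda>q. zv i q - zv i p) \<in> local_rad M F p"
  shows False
proof -
  define s where "s = 3 * (M + 1)"
  \<comment> \<open>Recentering at \<open>p\<close>; the three families of coordinates are
    interleaved by the index modulo 3.\<close>
  define pt where "pt w = (\<lambda>i. xv i p + w (3 * i), \<lambda>i. yv i p + w (3 * i + 1), \<lambda>i. zv i p + w (3 * i + 2))"
    for w :: "nat \<Rightarrow> 'k"
  have pt_0: "pt (\<lambda>_. 0) = p" by (auto intro!: jpt_eqI simp: pt_def)
  have pt_polys: "(\<lambda>w. u (pt w)) \<in> polys s" if "u \<in> Rm M" for u
    using that by (induction rule: Rm_induct) (auto simp: pt_def s_def intro!: polys.intros)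
  obtain f where f: "bij_betw f {..<card F} F"
    using ex_bij_betw_nat_finite[OF F(1)] by (auto simp: atLeast0LessThan)
  have coord: "\<exists>u\<in>local_rad M F p. \<forall>w. u (pt w) = w i" if "i < s" for i
  proof -
    define j where "j = i div 3"
    have j: "j \<le> M" using that by (simp add: j_def s_def less_mult_imp_div_less)
    have "i = 3 * j \<or> i = 3 * j + 1 \<or> i = 3 * j + 2" unfolding j_def by presburger
    then consider "i = 3 * j" | "i = 3 * j + 1" | "i = 3 * j + 2" by blast
    then show ?thesis
      by cases (rule bexI[OF _ x[OF j]] bexI[OF _ y[OF j]] bexI[OF _ z[OF j]]; simp add: pt_def)+
  qed
  define P where "P i k \<longleftrightarrow> (\<exists>u g. (\<forall>w. u (pt w) = w i) \<and> u \<in> Rm M \<and> g \<in> Rm M \<and> g p \<noteq> 0 \<and>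
      (\<lambda>q. g q * u q ^ (2 ^ k)) \<in> gen_ideal M F)" for i k
  have "\<forall>i. \<exists>k. i < s \<longrightarrow> P i k"
    using coord unfolding local_rad_def P_def by blast
  then obtain k where k: "\<And>i. i < s \<Longrightarrow> P i (k i)" by metis
  define K where "K = (\<Sum>i<s. 2 ^ k i :: nat)"
  have "s \<le> card F"
  proof (rule nilpotent_coordinates_bound[where f = "\<lambda>j w. f j (pt w)" and K = K])
    show "infinite (UNIV :: 'k set)" by (rule infinite_alg_closed)
  next
    fix j assume "j < card F"
    then have "f j \<in> F" using f by (auto simp: bij_betw_def)
    then show "(\<lambda>w. f j (pt w)) \<in> polys s" "f j (pt (\<lambda>_. 0)) = 0"
      using F(2,3) by (auto intro: pt_polys simp: pt_0)
  next
    fix i assume i: "i < s"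
    then obtain u g where u: "\<forall>w. u (pt w) = w i" "u \<in> Rm M" "g \<in> Rm M" "g p \<noteq> 0" "(\<lambda>q. g q * u q ^ (2 ^ k i)) \<in> gen_ideal M F"
      using k[OF i] unfolding P_def by blast
    have "2 ^ k i \<le> K" unfolding K_def by (rule member_le_sum) (use i in auto)
    from gen_ideal_raise[OF u(5,2) this] have "(\<lambda>q. g q * u q ^ K) \<in> gen_ideal M F" .
    from gen_ideal_sum_repr[OF this F(1)] obtain c where
      c: "\<forall>f\<in>F. c f \<in> Rm M" "\<forall>p. g p * u p ^ K = (\<Sum>f\<in>F. c f p * f p)" by blast
    have "(\<Sum>h\<in>F. c h q * h q) = (\<Sum>j<card F. c (f j) q * f j q)" for q
      by (rule sum.reindex_bij_betw[OF f, symmetric])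
    then have "g (pt w) * w i ^ K = (\<Sum>j<card F. c (f j) (pt w) * f j (pt w))" for w
      using spec[OF c(2), of "pt w"] u(1) by simp
    moreover have "\<forall>j<card F. (\<lambda>w. c (f j) (pt w)) \<in> polys s"
      using c(1) f by (auto simp: bij_betw_def intro!: pt_polys)
    ultimately show "\<exists>h c. h \<in> polys s \<and> h (\<lambda>_. 0) \<noteq> 0 \<and> (\<forall>j<card F. c j \<in> polys s) \<and>
        (\<forall>w. h w * w i ^ K = (\<Sum>j<card F. c j w * f j (pt w)))"
      using u(3,4) pt_polys by (intro exI[of _ "\<lambda>w. g (pt w)"] exI[of _ "\<lambda>j w. c (f j) (pt w)"]) (simp add: pt_0)
  qed
  then show False using F(4) by (simp add: s_def)
qed

text \<open>The cubic part has order at least \<open>3 * e\<close> and the cross term order at least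
  \<open>i + 2 * e + 1\<close>. Both exceed \<open>2 * i\<close>, so only \<open>x^2\<close>
  contributes.\<close>

lemma jf_square:
  assumes ABC: "fps_nth A 0 = 0" "fps_nth B 0 = 0" "fps_nth C 0 = 0"
    and a: "\<And>k. k < i \<Longrightarrow> a k = 0" and bc: "\<And>k. k < e \<Longrightarrow> b k = 0" "\<And>k. k < e \<Longrightarrow> c k = 0"
    and i: "i \<le> e" "1 \<le> e"
  shows "jf A B C (2 * i) (a, b, c) = (a i :: 'k) ^ 2"
proof -
  define a' b' c' where "a' = Abs_fps (\<lambda>k. a (k + i))" "b' = Abs_fps (\<lambda>k. b (k + e))" "c' = Abs_fps (\<lambda>k. c (k + e))"
  have e: "Abs_fps a = fps_X ^ i * a'" "Abs_fps b = fps_X ^ e * b'" "Abs_fps c = fps_X ^ e * c'"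
    unfolding a'_b'_c'_def by (rule fps_X_power_dvdI; use a bc in simp)+
  obtain A' B' C' where ABC': "A = fps_X * A'" "B = fps_X * B'" "C = fps_X * C'" using fps_const_0_dvd ABC by metis
  define R where "R = a' * (A' * b'^2 + B' * b' * c' + C' * c'^2)"
  have s: "3 * e = e + e + e" "2 * i = i + i" "i + 2 * e + 1 = i + e + e + 1" by simp_all
  define m where "m = i + 2 * e + 1"
  have "jg A B C (Abs_fps a) (Abs_fps b) (Abs_fps c) = fps_X ^ (2 * i) * a'^2 + fps_X ^ (3 * e) * (b'^2 * c' + b' * c'^2) +
      fps_X ^ m * R"
    unfolding m_def e ABC' jg_def R_def s power_add power_one_right by (simp add: algebra_simps power2_eq_square)
  moreover have "2 * i < m" "2 * i < 3 * e" using i by (simp_all add: m_def)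
  ultimately show ?thesis by (simp add: jf_simps fps_X_power_mult_nth a'_b'_c'_def power2_eq_square)
qed

text \<open>Coordinates congruent to their values at \<open>p\<close> may be frozen there, so an
  equation can be evaluated as if they were constants.\<close>

lemma local_rad_subst:
  assumes "u \<in> local_rad M F p"
    and "\<And>i. i \<le> M \<Longrightarrow> i \<in> X \<Longrightarrow> (\<lambda>q. xv i q - xv i p) \<in> local_rad M F p"
    and "\<And>i. i \<le> M \<Longrightarrow> i \<in> Y \<Longrightarrow> (\<lambda>q. yv i q - yv i p) \<in> local_rad M F p"
    and "\<And>i. i \<le> M \<Longrightarrow> i \<in> Z \<Longrightarrow> (\<lambda>q. zv i q - zv i p) \<in> local_rad M F p"
  shows "(\<lambda>q. u (mix X Y Z p q)) \<in> local_rad M F p"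
proof -
  note I = local_rad_ideal[of M F p]
  have "(\<lambda>q. u q - u (mix X Y Z p q)) \<in> local_rad M F p"
  proof (rule is_ideal_subst[OF I is_idealD(1)[OF I assms(1)]])
    fix i assume i: "i \<le> M"
    show "(\<lambda>q. xv i (mix X Y Z p q)) \<in> Rm M" "(\<lambda>q. yv i (mix X Y Z p q)) \<in> Rm M" "(\<lambda>q. zv i (mix X Y Z p q)) \<in> Rm M"
      using i by (simp_all add: Rm_if Rm.intros)
    show "(\<lambda>q. xv i q - xv i (mix X Y Z p q)) \<in> local_rad M F p"
      using assms(2)[OF i] is_idealD(2)[OF I] by (cases "i \<in> X") simp_all
    show "(\<lambda>q. yv i q - yv i (mix X Y Z p q)) \<in> local_rad M F p"
      using assms(3)[OF i] is_idealD(2)[OF I] by (cases "i \<in> Y") simp_all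
    show "(\<lambda>q. zv i q - zv i (mix X Y Z p q)) \<in> local_rad M F p"
      using assms(4)[OF i] is_idealD(2)[OF I] by (cases "i \<in> Z") simp_all
  qed
  from is_ideal_diff[OF I assms(1) this] show ?thesis by simp
qed

text \<open>After fixing the coordinates \<open>x\<^sub>i\<close> (\<open>i \<ge> a\<close>), \<open>y\<^sub>i\<close> (\<open>i \<ge> b\<close>) and \<open>z\<^sub>i\<close> (\<open>i \<ge> e\<close>) more than \<open>n\<close>
  coordinates remain, while the \<open>n\<close> equations make all of them locally nilpotent.\<close>
lemma stratum_not_local_rad:
  assumes ABC: "fps_nth A 0 = 0" "fps_nth B 0 = 0" "fps_nth C 0 = 0"
    and e: "1 \<le> e" and n: "1 \<le> n" and M: "n + e \<le> M"
    and p: "on_jets A B C n p" "\<And>i. i < e \<Longrightarrow> yv i p = 0" "\<And>i. i < e \<Longrightarrow> zv i p = 0"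
    and ze: "3 * e < n \<Longrightarrow> zv e p \<noteq> 0"
    and nil: "\<And>F. jset A B C n \<subseteq> F \<Longrightarrow> F \<subseteq> Rm M \<Longrightarrow> (\<And>f. f \<in> F \<Longrightarrow> f p = 0) \<Longrightarrow>
       (\<forall>i<e. yv i \<in> local_rad M F p \<and> zv i \<in> local_rad M F p)"
  shows False
proof -
  \<comment> \<open>\<open>a\<close>, \<open>b\<close>, \<open>e\<close> count the coordinates of
    \<open>x\<close>, \<open>y\<close>, \<open>z\<close> left unfixed. Equations
    \<open>2 * i < n\<close> with \<open>i \<le> e\<close> dispose of \<open>xv i\<close>, equations
    \<open>j + 2 * e < n\<close> with \<open>e \<le> j\<close> of \<open>yv j\<close>. If
    \<open>3 * e < n\<close>, the sum \<open>a + b + e\<close> is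
    \<open>(e + 1) + (n - 2 * e) + e = n + 1\<close>; otherwise it is \<open>a + 2 * e\<close>,
    which exceeds \<open>n\<close> as well.\<close>
  define a where "a = min (e + 1) ((n + 1) div 2)"
  define b where "b = max e (n - 2 * e)"
  define FX where "FX = (\<lambda>i q. xv i q - xv i p) ` {a..M}"
  define FY where "FY = (\<lambda>i q. yv i q - yv i p) ` {b..M}"
  define FZ where "FZ = (\<lambda>i q. zv i q - zv i p) ` {e..M}"
  define F where "F = jset A B C n \<union> (FX \<union> (FY \<union> FZ))"
  define N where "N = local_rad M F p"
  have jsetI: "jset A B C n = (\<lambda>j. jf A B C j) ` {..<n}" by (auto simp: jset_def)
  have fin: "finite F" by (simp add: F_def jsetI FX_def FY_def FZ_def)
  have "card F \<le> n + ((M + 1 - a) + ((M + 1 - b) + (M + 1 - e)))"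
    unfolding F_def jsetI FX_def FY_def FZ_def
    by (intro order.trans[OF card_Un_le] add_mono order.trans[OF card_image_le]) auto
  moreover have "n < a + b + e" "a \<le> M + 1" "b \<le> M + 1" "e \<le> M + 1"
    using e n M by (auto simp: a_def b_def min_def max_def)
  moreover have "c < 3 * m" if "c \<le> n + (x + (y + z))" "n < a + b + e" "x + a = m" "y + b = m" "z + e = m"
    for c x y z m :: nat using that by linarith
  ultimately have card: "card F < 3 * (M + 1)" by (metis le_add_diff_inverse2)
  have FRm: "F \<subseteq> Rm M"
    using M jset_Rm[of n M A B C] by (auto simp: F_def FX_def FY_def FZ_def intro!: Rm_intros)
  have Fp: "f p = 0" if "f \<in> F" for f
    using that p(1) by (auto simp: F_def FX_def FY_def FZ_def jset_def)
  have low: "yv i \<in> N" "zv i \<in> N" if "i < e" for i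
    using nil[of F] FRm Fp that unfolding N_def by (auto simp: F_def)
  have jfN: "jf A B C j \<in> N" if "j < n" for j
    using that M unfolding N_def by (intro local_rad_gen jf_Rm) (auto simp: F_def jset_def)
  have lowy: "(\<lambda>q. yv i q - yv i p) \<in> N" if "i < e" for i using low(1)[OF that] p(2)[OF that] by simp
  have z: "(\<lambda>q. zv i q - zv i p) \<in> N" if "i \<le> M" for i
  proof (cases "i < e")
    case True
    then show ?thesis using low(2) p(3) by simp
  next
    case False
    then show ?thesis unfolding N_def using that FRm
      by (intro local_rad_gen) (auto simp: F_def FZ_def intro!: Rm_intros)
  qed
  \<comment> \<open>With the lower coordinates frozen, equation \<open>2 * i\<close> reads
    \<open>xv i ^ 2 = 0\<close>, both at \<open>p\<close> and modulo the local radical.\<close>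
  have xlow: "xv i p = 0 \<and> xv i \<in> N" if "i < a" for i
    using that
  proof (induction i rule: less_induct)
    case (less i)
    have i: "i \<le> e" "2 * i < n" using less.prems by (auto simp: a_def)
    have eq: "jf A B C (2 * i) (mix {..<i} {..<e} {..<e} p q) = xv i q ^ 2" for q
    proof -
      have "jf A B C (2 * i) (mix {..<i} {..<e} {..<e} p q) = (if i \<in> {..<i} then xv i p else xv i q) ^ 2"
        unfolding mix_def using less p e i by (intro jf_square[OF ABC]) auto
      then show ?thesis by simp
    qed
    have "mix {..<i} {..<e} {..<e} p p = p" by (auto intro!: jpt_eqI)
    then have "xv i p ^ 2 = 0" using eq[of p] p(1) i by simp
    moreover have "(\<lambda>q. jf A B C (2 * i) (mix {..<i} {..<e} {..<e} p q)) \<in> N"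
      unfolding N_def
      by (rule local_rad_subst; (use jfN[OF i(2)] less p low in \<open>auto simp: N_def\<close>))
    then have "xv i \<in> N" unfolding eq N_def using i M e n
      by (intro local_rad_radical[of "xv i" M 2]) (auto intro: Rm.varx)
    ultimately show ?case by simp
  qed
  have x: "(\<lambda>q. xv i q - xv i p) \<in> N" if "i \<le> M" for i
  proof (cases "i < a")
    case True
    then show ?thesis using xlow by simp
  next
    case False
    then show ?thesis unfolding N_def using that FRm
      by (intro local_rad_gen) (auto simp: F_def FX_def intro!: Rm_intros)
  qed
  have y: "(\<lambda>q. yv j q - yv j p) \<in> N" if "j \<le> M" for j
    using that
  proof (induction j rule: less_induct)
    case (less j)
    consider "j < e" | "b \<le> j" | "e \<le> j" "j < b" by linarith
    then show ?case
    proof cases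
      case 1
      then show ?thesis by (rule lowy)
    next
      case 2
      then show ?thesis unfolding N_def using less.prems FRm
        by (intro local_rad_gen) (auto simp: F_def FY_def intro!: Rm_intros)
    next
      case 3
      then have j: "j + 2 * e < n" "3 * e < n" and ae: "a = e + 1" using e n by (auto simp: b_def a_def)
      define b' where "b' q i = (if i \<in> {..<j} \<union> {b..} then yv i p else yv i q)" for q i
      have mix: "mix UNIV ({..<j} \<union> {b..}) UNIV p q = (\<lambda>i. xv i p, b' q, \<lambda>i. zv i p)" for q
        by (auto intro!: jpt_eqI simp: b'_def)
      have pe: "(\<lambda>i. xv i p, \<lambda>i. yv i p, \<lambda>i. zv i p) = p" by (auto intro!: jpt_eqI)
      define x' where "x' = Abs_fps (\<lambda>i. xv (i + (e + 1)) p)"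
      have "Abs_fps (\<lambda>i. xv i p) = fps_X ^ (e + 1) * x'"
        unfolding x'_def by (rule fps_X_power_dvdI) (use xlow ae in auto)
      then have uv: "Abs_fps (\<lambda>i. xv i p) * A = fps_X ^ (e + 1) * (x' * A)" "Abs_fps (\<lambda>i. xv i p) * B = fps_X ^ (e + 1) * (x' * B)"
        by (simp_all add: mult.assoc)
      \<comment> \<open>The cofactor of \<open>yv j q - yv j p\<close> in equation
        \<open>j + 2 * e\<close>; its second summand stems from the quadratic term at
        \<open>j = e\<close>. At \<open>p\<close> it equals \<open>zv e p ^ 2\<close>, so it is a
        unit there and cancels.\<close>
      define w where "w q = zv e p ^ 2 + (if j = e then (yv j q - yv j p) * zv e p else 0)" for q
      have eq: "jf A B C (j + 2 * e) (mix UNIV ({..<j} \<union> {b..}) UNIV p q) = w q * (yv j q - yv j p)" for q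
      proof -
        have "jf A B C (j + 2 * e) (\<lambda>i. xv i p, b' q, \<lambda>i. zv i p) =
          jf A B C (j + 2 * e) (\<lambda>i. xv i p, \<lambda>i. yv i p, \<lambda>i. zv i p) + (b' q j - yv j p) * zv e p ^ 2 +
          (if j = e then (b' q j - yv j p) ^ 2 * zv e p else 0)"
          by (rule jf_step(2)[OF _ uv]) (use p 3 in \<open>auto simp: b'_def\<close>)
        moreover have "b' q j = yv j q" using 3 by (simp add: b'_def)
        moreover define d where "d = yv j q - yv j p"
        moreover have "jf A B C (j + 2 * e) (\<lambda>i. xv i p, \<lambda>i. yv i p, \<lambda>i. zv i p) = 0"
          using p(1) j unfolding pe by simp
        ultimately have "jf A B C (j + 2 * e) (\<lambda>i. xv i p, b' q, \<lambda>i. zv i p) =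
            d * zv e p ^ 2 + (if j = e then d ^ 2 * zv e p else 0)" by (simp only: add_0)
        then show ?thesis unfolding mix w_def d_def[symmetric] by (simp add: power2_eq_square algebra_simps)
      qed
      have "(\<lambda>q. jf A B C (j + 2 * e) (mix UNIV ({..<j} \<union> {b..}) UNIV p q)) \<in> N"
        unfolding N_def
      proof (rule local_rad_subst)
        show "jf A B C (j + 2 * e) \<in> local_rad M F p" using jfN j by (simp add: N_def)
        fix i assume i: "i \<le> M"
        show "(\<lambda>q. xv i q - xv i p) \<in> local_rad M F p" "(\<lambda>q. zv i q - zv i p) \<in> local_rad M F p"
          using x z i by (simp_all add: N_def)
        assume "i \<in> {..<j} \<union> {b..}"
        then show "(\<lambda>q. yv i q - yv i p) \<in> local_rad M F p"
        proof
          assume "i \<in> {..<j}"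
          then show ?thesis using less.IH[of i] i by (simp add: N_def)
        next
          assume "i \<in> {b..}"
          then show ?thesis using i FRm
            by (intro local_rad_gen) (auto simp: F_def FY_def intro!: Rm_intros)
        qed
      qed
      then have "(\<lambda>q. w q * (yv j q - yv j p)) \<in> local_rad M F p" unfolding eq N_def .
      moreover have "w \<in> Rm M" unfolding w_def[abs_def] using less.prems by (auto intro!: Rm_intros Rm_if)
      moreover have "w p \<noteq> 0" using ze[OF j(2)] by (simp add: w_def)
      moreover have "(\<lambda>q. yv j q - yv j p) \<in> Rm M" using less.prems by (intro Rm_diff Rm.vary Rm.const)
      ultimately show ?thesis unfolding N_def by (blast intro: local_rad_cancel)
    qed
  qed
  show False
    by (rule coords_not_local_rad[OF fin FRm Fp card]) (use x y z in \<open>simp_all add: N_def\<close>)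
qed

end

section \<open>Density of the smooth locus\<close>

definition swapj :: "'k jpt \<Rightarrow> 'k jpt" where
  "swapj p = (\<lambda>i. xv i p, \<lambda>i. zv i p, \<lambda>i. yv i p)"

text \<open>Takes the line \<open>yv 1 + zv 1 = 0\<close> to \<open>yv 1 = 0\<close>, and the new
  \<open>zv 1\<close> is the old \<open>yv 1\<close>. So the third line, with \<open>yv 1\<close>
  inverted, is studied in the chart of the first.\<close>

definition shearj :: "'k::comm_ring_1 jpt \<Rightarrow> 'k jpt" where
  "shearj p = (\<lambda>i. xv i p, \<lambda>i. yv i p + zv i p, \<lambda>i. yv i p)"

definition unshearj :: "'k::comm_ring_1 jpt \<Rightarrow> 'k jpt" where
  "unshearj p = (\<lambda>i. xv i p, \<lambda>i. zv i p, \<lambda>i. yv i p + zv i p)"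

lemma swapj_simps [simp]:
  "xv i (swapj p) = xv i p" "yv i (swapj p) = zv i p" "zv i (swapj p) = yv i p"
  by (simp_all add: swapj_def)

lemma shearj_simps [simp]:
  "xv i (shearj p) = xv i p" "yv i (shearj p) = yv i p + zv i p" "zv i (shearj p) = yv i p"
  by (simp_all add: shearj_def)

lemma unshearj_simps [simp]:
  "xv i (unshearj p) = xv i p" "yv i (unshearj p) = zv i p" "zv i (unshearj p) = yv i p + zv i p"
  by (simp_all add: unshearj_def)

lemma swapj_swapj [simp]: "swapj (swapj p) = p"
  by (auto intro!: jpt_eqI)

lemma Rm_swapj: "u \<in> Rm M \<Longrightarrow> (\<lambda>p. u (swapj p)) \<in> Rm M"
  by (erule Rm_comp) (simp_all add: Rm.intros)

lemma Rm_shearj: "u \<in> Rm M \<Longrightarrow> (\<lambda>p. u (shearj p)) \<in> Rm M"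
  by (erule Rm_comp) (simp_all add: Rm.intros)

lemma Rm_unshearj: "u \<in> Rm M \<Longrightarrow> (\<lambda>p. u (unshearj p)) \<in> Rm M"
  by (erule Rm_comp) (simp_all add: Rm.intros)

lemma jf_swapj: "jf A B C j (swapj p) = jf C B A j p"
  by (cases p) (simp add: swapj_def jf_swap)

definition line2_gens :: "'k::comm_ring_1 fps \<Rightarrow> 'k fps \<Rightarrow> 'k fps \<Rightarrow> nat \<Rightarrow> ('k jpt \<Rightarrow> 'k) set" where
  "line2_gens A B C n = {xv 0, xv 1, yv 0, zv 0, zv 1} \<union> jset A B C n"

definition line3_gens :: "'k::comm_ring_1 fps \<Rightarrow> 'k fps \<Rightarrow> 'k fps \<Rightarrow> nat \<Rightarrow> ('k jpt \<Rightarrow> 'k) set" where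
  "line3_gens A B C n = {xv 0, xv 1, yv 0, zv 0, \<lambda>p. yv 1 p + zv 1 p} \<union> jset A B C n"

context char_two
begin

lemma shearj_unshearj [simp]: "shearj (unshearj p) = (p :: 'k jpt)" "unshearj (shearj p) = p"
  by (auto intro!: jpt_eqI simp: add.assoc add.left_commute[of "yv _ _"] two_zero)

lemma jf_shearj: "jf A B C j (p :: 'k jpt) = jf C B (A + B + C) j (shearj p)"
  by (cases p) (simp add: shearj_def jf_shear[of A B C])

lemma jf_unshearj: "jf A B C j (unshearj p) = jf C B (A + B + C) j (p :: 'k jpt)"
  using jf_shearj[of A B C j "unshearj p"] by simp

lemma gen_ideal_swapj:
  "u \<in> gen_ideal M (jset C B A n) \<Longrightarrow> (\<lambda>p. u (swapj p)) \<in> gen_ideal M (jset A B C n)"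
  "u \<in> gen_ideal M (line_gens C B A n) \<Longrightarrow> (\<lambda>p. u (swapj p)) \<in> gen_ideal M (line2_gens A B C n)"
proof -
  have "(\<lambda>p. f (swapj p)) \<in> jset A B C n" if "f \<in> jset C B A n" for f
    using that by (auto simp: jset_def jf_swapj)
  moreover from this have "(\<lambda>p. f (swapj p)) \<in> line2_gens A B C n" if "f \<in> line_gens C B A n" for f
    using that unfolding line_gens_def line2_gens_def by auto
  ultimately show
    "u \<in> gen_ideal M (jset C B A n) \<Longrightarrow> (\<lambda>p. u (swapj p)) \<in> gen_ideal M (jset A B C n)"
    "u \<in> gen_ideal M (line_gens C B A n) \<Longrightarrow> (\<lambda>p. u (swapj p)) \<in> gen_ideal M (line2_gens A B C n)"
    by (blast intro: gen_ideal_comp gen_ideal.gen Rm_swapj)+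
qed

lemma gen_ideal_shearj:
  fixes A B C :: "'k fps"
  assumes "u \<in> gen_ideal M (line_gens C B (A + B + C) n)"
  shows "(\<lambda>p. u (shearj p)) \<in> gen_ideal M (line3_gens A B C n)"
  using assms
proof (rule gen_ideal_comp)
  fix f assume "f \<in> line_gens C B (A + B + C) n"
  moreover have "(\<lambda>p. jf C B (A + B + C) j (shearj p)) = jf A B C j" for j by (rule ext) (simp flip: jf_shearj)
  \<comment> \<open>Only \<open>yv 0\<close> fails to pull back to a generator; its pullback
    \<open>yv 0 + zv 0\<close> is a sum of two generators.\<close>
  ultimately have "f = yv 0 \<or> (\<lambda>p. f (shearj p)) \<in> line3_gens A B C n"
    unfolding line_gens_def line3_gens_def jset_def by auto
  moreover have "(\<lambda>p. yv 0 p + zv 0 p) \<in> gen_ideal M (line3_gens A B C n)"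
    by (intro gen_ideal.add gen_ideal.gen) (auto simp: line3_gens_def)
  ultimately show "(\<lambda>p. f (shearj p)) \<in> gen_ideal M (line3_gens A B C n)"
    by (auto intro: gen_ideal.gen)
qed (rule Rm_shearj)

lemma line2_chart_vanish:
  assumes "n \<le> M + 1" "1 \<le> M" "u \<in> Rm M"
    and "\<And>p. on_line C B A n p \<Longrightarrow> zv 1 p \<noteq> 0 \<Longrightarrow> u (swapj p) = 0"
  shows "\<exists>N. (\<lambda>q. yv 1 q ^ N * u q ^ 2) \<in> gen_ideal M (line2_gens A B C n)"
  using line_chart_vanish[OF assms(1,2) Rm_swapj[OF assms(3)] assms(4)] gen_ideal_swapj(2)[of _ M C B A n] by fastforce

lemma line3_chart_vanish:
  assumes "n \<le> M + 1" "1 \<le> M" "u \<in> Rm M"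
    and "\<And>p. on_line C B (A + B + C) n p \<Longrightarrow> zv 1 p \<noteq> 0 \<Longrightarrow> u (unshearj p) = 0"
  shows "\<exists>N. (\<lambda>q. yv 1 q ^ N * u q ^ 2) \<in> gen_ideal M (line3_gens A B C n)"
  using line_chart_vanish[OF assms(1,2) Rm_unshearj[OF assms(3)] assms(4)] gen_ideal_shearj[of _ M C B A n] by fastforce

lemma smooth_chart_vanish':
  assumes "fps_nth A 0 = 0" "fps_nth B 0 = 0" "fps_nth C 0 = 0" "n \<le> M + 1" "u \<in> Rm M"
    and "\<And>p. on_jets A B C n p \<Longrightarrow> yv 0 p \<noteq> 0 \<Longrightarrow> u p = 0"
  shows "\<exists>N. (\<lambda>q. yv 0 q ^ N * u q ^ 2) \<in> gen_ideal M (jset A B C n)"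
proof -
  have "\<exists>N. (\<lambda>q. zv 0 q ^ N * u (swapj q) ^ 2) \<in> gen_ideal M (jset C B A n)"
    by (rule smooth_chart_vanish[OF assms(3,2,1,4) Rm_swapj[OF assms(5)]]) (use assms(6) in \<open>auto simp: jf_swapj\<close>)
  then show ?thesis using gen_ideal_swapj(1)[of _ M C B A n] by fastforce
qed

section \<open>The strata of order one and two\<close>

lemma jf_3:
  assumes "a 0 = 0" "a 1 = 0" "b 0 = 0" "c 0 = (0 :: 'k)"
  shows "jf A B C 3 (a, b, c) = b 1 ^ 2 * c 1 + b 1 * c 1 ^ 2"
proof -
  define a' b' c' where "a' = Abs_fps (\<lambda>k. a (k + 2))" "b' = Abs_fps (\<lambda>k. b (k + 1))" "c' = Abs_fps (\<lambda>k. c (k + 1))"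
  have e: "Abs_fps a = fps_X ^ 2 * a'" "Abs_fps b = fps_X ^ 1 * b'" "Abs_fps c = fps_X ^ 1 * c'"
    unfolding a'_b'_c'_def by (rule fps_X_power_dvdI; use assms in \<open>auto simp: less_2_cases_iff\<close>)+
  define R where "R = a'^2 + a' * (A * b'^2 + B * b' * c' + C * c'^2)"
  have "jg A B C (Abs_fps a) (Abs_fps b) (Abs_fps c) = fps_X ^ 3 * (b'^2 * c' + b' * c'^2) + fps_X ^ 4 * R"
    unfolding e jg_def R_def by (simp add: algebra_simps eval_nat_numeral)
  then show ?thesis by (simp add: jf_simps fps_X_power_mult_nth a'_b'_c'_def power2_eq_square)
qed

text \<open>Since \<open>u\<close> is a unit of the local ring at \<open>p\<close>, the relation
  leaves a power of \<open>d\<close>.\<close>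

lemma local_rad_of_chart:
  assumes F: "F \<subseteq> Rm M" and d: "d \<in> Rm M" and u: "u \<in> Rm M" "u p \<noteq> 0"
    and m: "(\<lambda>q. d q ^ N * u q ^ 2) \<in> local_rad M F p"
  shows "d \<in> local_rad M F p"
proof -
  have "(\<lambda>q. d q ^ N) \<in> local_rad M F p"
    by (rule local_rad_cancel[of _ _ "\<lambda>q. u q ^ 2"]) (use m u d in \<open>auto intro: Rm_power simp: mult.commute\<close>)
  then show ?thesis using d local_rad_radical by blast
qed

text \<open>The same cancellation inside the ideal quotient by \<open>w\<close>, for the case that
  some generator in \<open>G\<close> enters the local radical only after multiplication by
  \<open>w\<close>.\<close>

lemma local_rad_mult_of_chart:
  assumes d: "d \<in> Rm M" and u: "u \<in> Rm M" "u p \<noteq> 0" and w: "w \<in> Rm M"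
    and G: "G \<subseteq> Rm M" "(\<lambda>q. d q ^ N * u q ^ 2) \<in> gen_ideal M G"
    and GN: "\<And>g. g \<in> G \<Longrightarrow> (\<lambda>q. w q * g q) \<in> local_rad M F p"
  shows "(\<lambda>q. w q * d q) \<in> local_rad M F p"
proof -
  note I = local_rad_ideal[of M F p]
  have "is_ideal M {v \<in> Rm M. (\<lambda>q. w q * v q) \<in> local_rad M F p}" (is "is_ideal M ?I")
    unfolding is_ideal_def
  proof (intro conjI ballI)
    show "(\<lambda>_. 0) \<in> ?I" using is_idealD(2)[OF I] by (auto intro: Rm.const)
  next
    fix f g :: "'k jpt \<Rightarrow> 'k" assume "f \<in> ?I" "g \<in> ?I"
    then show "(\<lambda>p. f p + g p) \<in> ?I"
      using is_idealD(3)[OF I, of "\<lambda>q. w q * f q" "\<lambda>q. w q * g q"] by (auto intro: Rm.add simp: distrib_left)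
  next
    fix h f :: "'k jpt \<Rightarrow> 'k" assume "h \<in> Rm M" "f \<in> ?I"
    then show "(\<lambda>p. h p * f p) \<in> ?I"
      using is_idealD(4)[OF I, of h "\<lambda>q. w q * f q"] by (auto intro: Rm.mult simp: mult.left_commute)
  qed auto
  from gen_ideal_least[OF this, of G] have "(\<lambda>q. d q ^ N * u q ^ 2) \<in> ?I" using G GN by blast
  then have "(\<lambda>q. u q ^ 2 * (w q * d q ^ N)) \<in> local_rad M F p" by (simp add: algebra_simps)
  then have wd: "(\<lambda>q. w q * d q ^ N) \<in> local_rad M F p"
    by (rule local_rad_cancel[rotated 3]) (use w d u in \<open>auto intro: Rm_power Rm.mult\<close>)
  have "(\<lambda>q. w q ^ N * d q) \<in> Rm M" by (intro Rm.mult Rm_power w d)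
  from is_idealD(4)[OF I this wd] have "(\<lambda>q. (w q ^ N * d q) * (w q * d q ^ N)) \<in> local_rad M F p" .
  moreover have "(w q ^ N * d q) * (w q * d q ^ N) = (w q * d q) ^ Suc N" for q
    by (simp add: power_mult_distrib algebra_simps)
  ultimately have "(\<lambda>q. (w q * d q) ^ Suc N) \<in> local_rad M F p" by (simp only:)
  then show ?thesis by (rule local_rad_radical[rotated]) (intro Rm.mult w d)
qed

text \<open>If \<open>u p\<close> were nonzero, the vanishing of \<open>u\<close> on the two smooth
  charts would put \<open>zv 0\<close> and \<open>yv 0\<close> into the local radical at
  \<open>p\<close>, which the count for \<open>e = 1\<close> forbids.\<close>

lemma stratum1_z:
  assumes ABC: "fps_nth A 0 = 0" "fps_nth B 0 = 0" "fps_nth C 0 = 0" and n: "1 \<le> n"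
    and u: "u \<in> Rm M" "\<And>p. on_jets A B C n p \<Longrightarrow> yv 0 p \<noteq> 0 \<or> zv 0 p \<noteq> 0 \<Longrightarrow> u p = 0"
    and p: "on_jets A B C n p" "yv 0 p = 0" "zv 0 p = 0" "n \<le> 3 \<or> zv 1 p \<noteq> 0"
  shows "u p = 0"
proof (rule ccontr)
  assume up: "u p \<noteq> 0"
  define M' where "M' = M + n + 1"
  have u': "u \<in> Rm M'" using Rm_mono[OF u(1)] by (simp add: M'_def)
  have nM: "n \<le> M' + 1" by (simp add: M'_def)
  obtain N1 where N1: "(\<lambda>q. zv 0 q ^ N1 * u q ^ 2) \<in> gen_ideal M' (jset A B C n)"
    using smooth_chart_vanish[OF ABC nM u'] u(2) by blast
  obtain N2 where N2: "(\<lambda>q. yv 0 q ^ N2 * u q ^ 2) \<in> gen_ideal M' (jset A B C n)"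
    using smooth_chart_vanish'[OF ABC nM u'] u(2) by blast
  show False
  proof (rule stratum_not_local_rad[OF ABC, of 1 n M' p])
    fix F assume F: "jset A B C n \<subseteq> F" "F \<subseteq> Rm M'"
    have sub: "gen_ideal M' (jset A B C n) \<subseteq> local_rad M' F p"
      by (rule gen_ideal_least[OF local_rad_ideal]) (use F in \<open>auto intro: local_rad_gen\<close>)
    show "\<forall>i<1. yv i \<in> local_rad M' F p \<and> zv i \<in> local_rad M' F p"
      using local_rad_of_chart[OF F(2) _ u' up subsetD[OF sub N1]] local_rad_of_chart[OF F(2) _ u' up subsetD[OF sub N2]]
      by (auto intro: Rm.intros)
  qed (use p n in \<open>auto simp: M'_def\<close>)
qed

lemma stratum1:
  assumes ABC: "fps_nth A 0 = 0" "fps_nth B 0 = 0" "fps_nth C 0 = 0" and n: "1 \<le> n"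
    and u: "u \<in> Rm M" "\<And>p. on_jets A B C n p \<Longrightarrow> yv 0 p \<noteq> 0 \<or> zv 0 p \<noteq> 0 \<Longrightarrow> u p = 0"
    and p: "on_jets A B C n p" "yv 0 p = 0" "zv 0 p = 0" "n \<le> 3 \<or> zv 1 p \<noteq> 0 \<or> yv 1 p \<noteq> 0"
  shows "u p = 0"
proof (cases "n \<le> 3 \<or> zv 1 p \<noteq> 0")
  case True
  show ?thesis by (rule stratum1_z[OF ABC n u p(1-3) True])
next
  case False
  have "u (swapj (swapj p)) = 0"
  proof (rule stratum1_z[OF ABC(3,2,1) n Rm_swapj[OF u(1)]])
    fix q assume "on_jets C B A n q" "yv 0 q \<noteq> 0 \<or> zv 0 q \<noteq> 0"
    then show "u (swapj q) = 0" by (intro u(2)) (auto simp: jf_swapj)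
  qed (use p False in \<open>auto simp: jf_swapj\<close>)
  then show ?thesis by simp
qed

text \<open>Now \<open>yv 1\<close> and \<open>zv 1\<close> have to be nilpotent too. By the case of
  order one, \<open>u\<close> vanishes on the charts of the three lines. The relations obtained
  there hold modulo different ideals and are combined through the third coefficient
  \<open>yv 1 * zv 1 * (yv 1 + zv 1)\<close>.\<close>

lemma stratum2_z:
  assumes ABC: "fps_nth A 0 = 0" "fps_nth B 0 = 0" "fps_nth C 0 = 0" and n: "4 \<le> n"
    and u: "u \<in> Rm M" "\<And>p. on_jets A B C n p \<Longrightarrow> yv 0 p \<noteq> 0 \<or> zv 0 p \<noteq> 0 \<Longrightarrow> u p = 0"
    and p: "on_jets A B C n p" "yv 0 p = 0" "zv 0 p = 0" "yv 1 p = 0" "zv 1 p = 0" "n \<le> 6 \<or> zv 2 p \<noteq> 0"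
  shows "u p = 0"
proof (rule ccontr)
  assume up: "u p \<noteq> 0"
  define M' where "M' = M + n + 2"
  have u': "u \<in> Rm M'" using Rm_mono[OF u(1)] by (simp add: M'_def)
  have nM: "n \<le> M' + 1" "1 \<le> M'" by (simp_all add: M'_def)
  have van: "u q = 0" if "on_jets A B C n q" "yv 0 q = 0" "zv 0 q = 0" "zv 1 q \<noteq> 0 \<or> yv 1 q \<noteq> 0" for q
    by (rule stratum1[OF ABC _ u that(1-3)]) (use that(4) n in auto)
  obtain N1 where N1: "(\<lambda>q. zv 0 q ^ N1 * u q ^ 2) \<in> gen_ideal M' (jset A B C n)"
    using smooth_chart_vanish[OF ABC nM(1) u'] u(2) by blast
  obtain N2 where N2: "(\<lambda>q. yv 0 q ^ N2 * u q ^ 2) \<in> gen_ideal M' (jset A B C n)"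
    using smooth_chart_vanish'[OF ABC nM(1) u'] u(2) by blast
  obtain K1 where K1: "(\<lambda>q. zv 1 q ^ K1 * u q ^ 2) \<in> gen_ideal M' (line_gens A B C n)"
    using line_chart_vanish[OF nM u'] van by blast
  have "u (swapj q) = 0" if "on_line C B A n q" "zv 1 q \<noteq> 0" for q
    by (rule van) (use that in \<open>auto simp: jf_swapj\<close>)
  from line2_chart_vanish[OF nM u' this]
  obtain K2 where K2: "(\<lambda>q. yv 1 q ^ K2 * u q ^ 2) \<in> gen_ideal M' (line2_gens A B C n)" by blast
  have "u (unshearj q) = 0" if "on_line C B (A + B + C) n q" "zv 1 q \<noteq> 0" for q
    by (rule van) (use that in \<open>auto simp: jf_unshearj\<close>)
  from line3_chart_vanish[OF nM u' this]
  obtain K3 where K3: "(\<lambda>q. yv 1 q ^ K3 * u q ^ 2) \<in> gen_ideal M' (line3_gens A B C n)" by blast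
  have px0: "xv 0 p = 0" using p(1-3) n jf_0[OF ABC, of p] by auto
  have sq1: "jf A B C 2 (mix {0} {0} {0} p q) = xv 1 q ^ 2" for q
    using jf_square[OF ABC, of 1 _ 1] p(2,3) px0 by (simp add: mix_def)
  have "mix {0} {0} {0} p p = p" by (auto intro!: jpt_eqI)
  then have px1: "xv 1 p = 0" using sq1[of p] p(1) n by simp
  show False
  proof (rule stratum_not_local_rad[OF ABC, of 2 n M' p])
    fix F assume F: "jset A B C n \<subseteq> F" "F \<subseteq> Rm M'"
    define N where "N = local_rad M' F p"
    have I: "is_ideal M' N" unfolding N_def by (rule local_rad_ideal)
    note I_add = is_idealD(3)[OF I] and I_mult = is_idealD(4)[OF I]
    have rad: "v \<in> N" if "(\<lambda>q. v q ^ k) \<in> N" "v \<in> Rm M'" for v k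
      using that local_rad_radical unfolding N_def by blast
    have jf: "jf A B C j \<in> N" if "j < n" for j
      using F that unfolding N_def by (intro local_rad_gen) (auto simp: jset_def)
    have sub: "gen_ideal M' (jset A B C n) \<subseteq> local_rad M' F p"
      by (rule gen_ideal_least[OF local_rad_ideal]) (use F in \<open>auto intro: local_rad_gen\<close>)
    have V: "xv 0 \<in> Rm M'" "xv 1 \<in> Rm M'" "yv 0 \<in> Rm M'" "yv 1 \<in> Rm M'" "zv 0 \<in> Rm M'" "zv 1 \<in> Rm M'"
      using nM by (auto intro: Rm.intros)
    have y0: "yv 0 \<in> N" and z0: "zv 0 \<in> N"
      using local_rad_of_chart[OF F(2) V(5) u' up subsetD[OF sub N1]] local_rad_of_chart[OF F(2) V(3) u' up subsetD[OF sub N2]]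
      by (simp_all add: N_def)
    have "(\<lambda>q. jf A B C 0 q + ((yv 0 q * zv 0 q) * yv 0 q + (yv 0 q * zv 0 q) * zv 0 q)) \<in> N"
      by (intro I_add I_mult jf y0 z0 Rm.mult V) (use n in simp)
    moreover have "jf A B C 0 q + ((yv 0 q * zv 0 q) * yv 0 q + (yv 0 q * zv 0 q) * zv 0 q) = xv 0 q ^ 2" for q
    proof -
      define s where "s = (yv 0 q * zv 0 q) * yv 0 q + (yv 0 q * zv 0 q) * zv 0 q"
      have "jf A B C 0 q + s = xv 0 q ^ 2 + (s + s)"
        by (simp only: jf_0[OF ABC]) (simp add: s_def power2_eq_square algebra_simps del: add_self)
      then show ?thesis by (simp add: s_def)
    qed
    ultimately have "(\<lambda>q. xv 0 q ^ 2) \<in> N" by simp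
    then have x0: "xv 0 \<in> N" using V(1) by (rule rad)
    have "(\<lambda>q. jf A B C 2 (mix {0} {0} {0} p q)) \<in> N"
      unfolding N_def
      by (rule local_rad_subst) (use jf[of 2] x0 y0 z0 px0 p n in \<open>auto simp: N_def\<close>)
    then have "(\<lambda>q. xv 1 q ^ 2) \<in> N" by (simp only: sq1)
    then have x1: "xv 1 \<in> N" using V(2) by (rule rad)
    have "jf A B C 3 (mix {0, 1} {0} {0} p q) = yv 1 q ^ 2 * zv 1 q + yv 1 q * zv 1 q ^ 2" for q
      unfolding mix_def using jf_3 px0 px1 p by simp
    moreover have "(\<lambda>q. jf A B C 3 (mix {0, 1} {0} {0} p q)) \<in> N"
      unfolding N_def
      by (rule local_rad_subst) (use jf[of 3] x0 x1 y0 z0 px0 px1 p n in \<open>auto simp: N_def\<close>)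
    ultimately have cubic: "(\<lambda>q. yv 1 q ^ 2 * zv 1 q + yv 1 q * zv 1 q ^ 2) \<in> N" by simp
    \<comment> \<open>Of the generators for the first line only \<open>yv 1\<close> is not yet known
      to lie in \<open>N\<close>, and \<open>w * yv 1\<close> is the cubic, which does. Hence
      \<open>w * zv 1\<close> and then \<open>w ^ 2\<close> lie in \<open>N\<close>.\<close>
    define w where "w q = zv 1 q * (yv 1 q + zv 1 q)" for q :: "'k jpt"
    have w: "w \<in> Rm M'" unfolding w_def[abs_def] by (intro Rm.mult Rm.add V)
    have "(\<lambda>q. w q * zv 1 q) \<in> N"
      unfolding N_def
    proof (rule local_rad_mult_of_chart[OF V(6) u' up w line_gens_Rm[OF nM] K1])
      fix g assume "g \<in> line_gens A B C n"
      then consider "g \<in> N" | "g = yv 1" using x0 x1 y0 z0 jf by (auto simp: line_gens_def jset_def)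
      then show "(\<lambda>q. w q * g q) \<in> local_rad M' F p"
      proof cases
        case 1
        then show ?thesis using I_mult[OF w] by (simp add: N_def)
      next
        case 2
        then show ?thesis using cubic by (simp add: N_def w_def power2_eq_square algebra_simps)
      qed
    qed
    from I_mult[OF _ this, of "\<lambda>q. yv 1 q + zv 1 q"] have "(\<lambda>q. (yv 1 q + zv 1 q) * (w q * zv 1 q)) \<in> N"
      using V by (auto intro: Rm.add)
    moreover have "(yv 1 q + zv 1 q) * (w q * zv 1 q) = w q ^ 2" for q
      by (simp add: w_def power2_eq_square mult_ac)
    ultimately have "(\<lambda>q. w q ^ 2) \<in> N" by simp
    then have wN: "w \<in> N" using w by (rule rad)
    \<comment> \<open>The same for the third line, whose exceptional generator
      \<open>yv 1 + zv 1\<close> has the cofactor \<open>v\<close> in the cubic.\<close>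
    define v where "v q = yv 1 q * zv 1 q" for q :: "'k jpt"
    have v: "v \<in> Rm M'" unfolding v_def[abs_def] by (intro Rm.mult V)
    have line3: "line3_gens A B C n \<subseteq> Rm M'" "line2_gens A B C n \<subseteq> Rm M'"
      using jset_Rm[OF nM(1)] V by (auto simp: line3_gens_def line2_gens_def intro: Rm.add)
    have "(\<lambda>q. v q * yv 1 q) \<in> N"
      unfolding N_def
    proof (rule local_rad_mult_of_chart[OF V(4) u' up v line3(1) K3])
      fix g assume "g \<in> line3_gens A B C n"
      then consider "g \<in> N" | "g = (\<lambda>q. yv 1 q + zv 1 q)" using x0 x1 y0 z0 jf by (auto simp: line3_gens_def jset_def)
      then show "(\<lambda>q. v q * g q) \<in> local_rad M' F p"
      proof cases
        case 1
        then show ?thesis using I_mult[OF v] by (simp add: N_def)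
      next
        case 2
        then show ?thesis using cubic by (simp add: N_def v_def power2_eq_square algebra_simps)
      qed
    qed
    from I_mult[OF V(6) this] have "(\<lambda>q. zv 1 q * (v q * yv 1 q)) \<in> N" .
    moreover have "zv 1 q * (v q * yv 1 q) = v q ^ 2" for q
      by (simp add: v_def power2_eq_square mult_ac)
    ultimately have "(\<lambda>q. v q ^ 2) \<in> N" by simp
    then have "v \<in> N" using v by (rule rad)
    \<comment> \<open>\<open>w - v\<close> is \<open>zv 1 ^ 2\<close>. Once \<open>zv 1\<close> is
      in \<open>N\<close>, so are all generators for the second line, and the relation there yields
      \<open>yv 1\<close>.\<close>
    from is_ideal_diff[OF I wN this] have "(\<lambda>q. zv 1 q ^ 2) \<in> N"
      by (simp add: w_def v_def power2_eq_square algebra_simps)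
    then have z1: "zv 1 \<in> N" using V(6) by (rule rad)
    have "line2_gens A B C n \<subseteq> N" using x0 x1 y0 z0 z1 jf by (auto simp: line2_gens_def jset_def)
    from gen_ideal_least[OF I this] K2 have "(\<lambda>q. yv 1 q ^ K2 * u q ^ 2) \<in> N" by blast
    then have y1: "yv 1 \<in> N" unfolding N_def by (rule local_rad_of_chart[OF F(2) V(4) u' up])
    show "\<forall>i<2. yv i \<in> local_rad M' F p \<and> zv i \<in> local_rad M' F p"
      using y0 y1 z0 z1 by (auto simp: N_def less_2_cases_iff)
  qed (use p n in \<open>auto simp: M'_def less_2_cases_iff\<close>)
qed

lemma stratum2:
  assumes ABC: "fps_nth A 0 = 0" "fps_nth B 0 = 0" "fps_nth C 0 = 0" and n: "4 \<le> n"
    and u: "u \<in> Rm M" "\<And>p. on_jets A B C n p \<Longrightarrow> yv 0 p \<noteq> 0 \<or> zv 0 p \<noteq> 0 \<Longrightarrow> u p = 0"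
    and p: "on_jets A B C n p" "yv 0 p = 0" "zv 0 p = 0" "yv 1 p = 0" "zv 1 p = 0" "n \<le> 6 \<or> zv 2 p \<noteq> 0 \<or> yv 2 p \<noteq> 0"
  shows "u p = 0"
proof (cases "n \<le> 6 \<or> zv 2 p \<noteq> 0")
  case True
  show ?thesis by (rule stratum2_z[OF ABC n u p(1-5) True])
next
  case False
  have "u (swapj (swapj p)) = 0"
  proof (rule stratum2_z[OF ABC(3,2,1) n Rm_swapj[OF u(1)]])
    fix q assume "on_jets C B A n q" "yv 0 q \<noteq> 0 \<or> zv 0 q \<noteq> 0"
    then show "u (swapj q) = 0" by (intro u(2)) (auto simp: jf_swapj)
  qed (use p False in \<open>auto simp: jf_swapj\<close>)
  then show ?thesis by simp
qed

section \<open>The weighted shift and the induction on the number of equations\<close>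

definition shift_jet :: "'k jpt \<Rightarrow> 'k jpt" where
  "shift_jet p = (\<lambda>i. if i < 3 then 0 else xv (i - 3) p, \<lambda>i. if i < 2 then 0 else yv (i - 2) p,
     \<lambda>i. if i < 2 then 0 else zv (i - 2) p)"

lemma shift_jet_simps [simp]:
  "xv i (shift_jet p) = (if i < 3 then 0 else xv (i - 3) p)"
  "yv i (shift_jet p) = (if i < 2 then 0 else yv (i - 2) p)"
  "zv i (shift_jet p) = (if i < 2 then 0 else zv (i - 2) p)"
  by (simp_all add: shift_jet_def)

lemma Rm_shift_jet: "u \<in> Rm M \<Longrightarrow> (\<lambda>p. u (shift_jet p)) \<in> Rm M"
  by (erule Rm_comp) (simp_all add: Rm_if Rm.intros)

lemma jf_shift_jet:
  "jf A B C j (shift_jet p) = (if j < 6 then 0 else jf (fps_X * A) (fps_X * B) (fps_X * C) (j - 6) p)"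
proof -
  have "(\<lambda>i. xv i p, \<lambda>i. yv i p, \<lambda>i. zv i p) = p" by (auto intro!: jpt_eqI)
  then show ?thesis using jf_shift[of A B C j "\<lambda>i. xv i p" "\<lambda>i. yv i p" "\<lambda>i. zv i p"] by (simp add: shift_jet_def)
qed

lemma on_jets_shift_jet:
  "on_jets A B C n (shift_jet p) \<longleftrightarrow> on_jets (fps_X * A) (fps_X * B) (fps_X * C) (n - 6) p"
proof
  assume *: "on_jets A B C n (shift_jet p)"
  show "on_jets (fps_X * A) (fps_X * B) (fps_X * C) (n - 6) p"
  proof (intro allI impI)
    fix j assume "j < n - 6"
    then show "jf (fps_X * A) (fps_X * B) (fps_X * C) j p = 0"
      using *[rule_format, of "j + 6"] jf_shift_jet[of A B C "j + 6" p] by simp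
  qed
qed (auto simp: jf_shift_jet)

lemma shift_jet_surj:
  assumes "\<And>i. i < 3 \<Longrightarrow> xv i p = 0" "\<And>i. i < 2 \<Longrightarrow> yv i p = 0 \<and> zv i p = 0"
  shows "shift_jet (\<lambda>i. xv (i + 3) p, \<lambda>i. yv (i + 2) p, \<lambda>i. zv (i + 2) p) = p"
  using assms by (auto intro!: jpt_eqI simp del: add_2_eq_Suc')

theorem smooth_locus_dense:
  assumes "fps_nth A 0 = 0" "fps_nth B 0 = 0" "fps_nth C 0 = 0"
    and "u \<in> Rm M" "\<And>p. on_jets A B C n p \<Longrightarrow> yv 0 p \<noteq> 0 \<or> zv 0 p \<noteq> 0 \<Longrightarrow> u p = 0"
    and "on_jets A B C n p"
  shows "u p = 0"
  using assms
\<comment> \<open>The series and \<open>u\<close> must vary: the shift multiplies \<open>A\<close>,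
  \<open>B\<close>, \<open>C\<close> by \<open>fps_X\<close> and composes \<open>u\<close> with
  \<open>shift_jet\<close>.\<close>
proof (induction n arbitrary: A B C u p rule: less_induct)
  case (less n)
  note ABC = less.prems(1-3) and u = less.prems(4,5) and p = less.prems(6)
  show ?case
  proof (cases "n = 0")
    case True
    \<comment> \<open>Without equations the jets form an affine space, where a nonzero
      \<open>u\<close> is nonzero at some point with \<open>zv 0\<close> nonzero.\<close>
    have "zv 0 \<in> Rm M" by (intro Rm.varz) simp
    moreover have "zv 0 (\<lambda>_. 0, \<lambda>_. 0, \<lambda>_. 1 :: 'k) \<noteq> 0" by simp
    ultimately have "\<exists>r. u r \<noteq> 0 \<and> zv 0 r \<noteq> 0" if "u p \<noteq> 0"
      using Rm_common_nonzero[OF u(1) _ that] by blast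
    then show ?thesis using u(2) True by blast
  next
    case False
    then have n: "1 \<le> n" by simp
    show ?thesis
    proof (cases "yv 0 p = 0 \<and> zv 0 p = 0")
      case False
      then show ?thesis using u(2) p by blast
    next
      case yz0: True
      show ?thesis
      proof (cases "n \<le> 3 \<or> zv 1 p \<noteq> 0 \<or> yv 1 p \<noteq> 0")
        case True
        show ?thesis by (rule stratum1[OF ABC n u p]) (use yz0 True in auto)
      next
        case yz1: False
        then have n4: "4 \<le> n" by simp
        show ?thesis
        proof (cases "n \<le> 6")
          case True
          show ?thesis by (rule stratum2[OF ABC n4 u p]) (use yz0 yz1 True in auto)
        next
          case n6: False
          define p' where "p' = (\<lambda>i. xv (i + 3) p, \<lambda>i. yv (i + 2) p, \<lambda>i. zv (i + 2) p)"
          have yz: "yv i p = 0 \<and> zv i p = 0" if "i < 2" for i using that yz0 yz1 by (auto simp: less_2_cases_iff)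
          have "xv i p = 0" if "i < 3" for i
            using that
          proof (induction i rule: less_induct)
            case (less i)
            have "jf A B C (2 * i) (\<lambda>i. xv i p, \<lambda>i. yv i p, \<lambda>i. zv i p) = xv i p ^ 2"
              by (rule jf_square[OF ABC, of _ _ 2]) (use less yz in auto)
            moreover have "(\<lambda>i. xv i p, \<lambda>i. yv i p, \<lambda>i. zv i p) = p" by (auto intro!: jpt_eqI)
            ultimately show ?case using p less.prems n6 by simp
          qed
          then have p': "shift_jet p' = p" unfolding p'_def using yz by (intro shift_jet_surj) auto
          \<comment> \<open>Order 0 before the shift is order 2 after it, so \<open>stratum2\<close>
            supplies the vanishing that the induction hypothesis asks for, and the hypothesis then
            covers all higher orders at once.\<close>
          have "u (shift_jet p') = 0"
          proof (rule less.IH[of "n - 6" "fps_X * A" "fps_X * B" "fps_X * C" "\<lambda>q. u (shift_jet q)"])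
            show "on_jets (fps_X * A) (fps_X * B) (fps_X * C) (n - 6) p'"
              using p unfolding on_jets_shift_jet[symmetric] p' .
            fix q assume "on_jets (fps_X * A) (fps_X * B) (fps_X * C) (n - 6) q" "yv 0 q \<noteq> 0 \<or> zv 0 q \<noteq> 0"
            then show "u (shift_jet q) = 0"
              by (intro stratum2[OF ABC n4 u]) (auto simp: on_jets_shift_jet[symmetric])
          qed (use n6 in \<open>auto intro: Rm_shift_jet u(1)\<close>)
          then show ?thesis by (simp add: p')
        qed
      qed
    qed
  qed
qed

end

section \<open>Irreducible components\<close>

lemma irreducible_closedI:
  assumes "zariski_closed m Z" "Z \<noteq> {}"
    and "\<And>f g p q. f \<in> Rm m \<Longrightarrow> g \<in> Rm m \<Longrightarrow> p \<in> Z \<Longrightarrow> q \<in> Z \<Longrightarrow> f p \<noteq> 0 \<Longrightarrow> g q \<noteq> 0 \<Longrightarrow>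
       \<exists>r\<in>Z. f r \<noteq> 0 \<and> g r \<noteq> 0"
  shows "irreducible_closed m Z"
  unfolding irreducible_closed_def
proof (intro conjI allI impI)
  fix A B assume AB: "zariski_closed m A" "zariski_closed m B" "Z \<subseteq> A \<union> B"
  obtain FA FB where F: "FA \<subseteq> Rm m" "A = zero_set m FA" "FB \<subseteq> Rm m" "B = zero_set m FB"
    using AB unfolding zariski_closed_def by blast
  have jet: "Z \<subseteq> jet_space m" using assms(1) by (auto simp: zariski_closed_def zero_set_def)
  show "Z \<subseteq> A \<or> Z \<subseteq> B"
  proof (rule ccontr)
    assume "\<not> (Z \<subseteq> A \<or> Z \<subseteq> B)"
    then obtain p q where pq: "p \<in> Z" "p \<notin> A" "q \<in> Z" "q \<notin> B" by blast
    then obtain f g where fg: "f \<in> FA" "f p \<noteq> 0" "g \<in> FB" "g q \<noteq> 0"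
      using jet F by (auto simp: zero_set_def)
    have "f \<in> Rm m" "g \<in> Rm m" using F fg by auto
    from assms(3)[OF this pq(1,3) fg(2,4)] obtain r where r: "r \<in> Z" "f r \<noteq> 0" "g r \<noteq> 0" by blast
    have "r \<notin> A" "r \<notin> B" using r fg unfolding F(2,4) zero_set_def by blast+
    then show False using AB(3) r(1) by blast
  qed
qed (fact assms)+

text \<open>Points are not confined to \<open>jet_space\<close>; \<open>trunc\<close> moves them
  there, as functions in \<open>Rm m\<close> ignore higher coordinates.\<close>

definition chart_of :: "('k::comm_ring_1 jpt \<Rightarrow> 'k) set \<Rightarrow> ('k jpt \<Rightarrow> 'k) \<Rightarrow> 'k jpt set" where
  "chart_of G d = {p. (\<forall>g\<in>G. g p = 0) \<and> d p \<noteq> 0}"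

lemma zero_set_saturate_subset:
  assumes "G \<subseteq> Rm m" "p \<in> zero_set m (saturate m (gen_ideal m G) d)" "g \<in> G"
  shows "g p = (0 :: 'k::idom)"
proof -
  have "(\<lambda>p. d p ^ 0 * g p) \<in> gen_ideal m G" using assms by (simp add: gen_ideal.gen)
  then have "g \<in> saturate m (gen_ideal m G) d" using assms unfolding saturate_def by blast
  then show ?thesis using assms by (simp add: zero_set_def)
qed

lemma chart_in_zero_set_saturate:
  assumes "p \<in> chart_of G d" "p \<in> jet_space m"
  shows "p \<in> zero_set m (saturate m (gen_ideal m G) (d :: _ \<Rightarrow> 'k::idom))"
  using assms gen_ideal_vanish[of _ m G p] unfolding zero_set_def saturate_def chart_of_def by fastforce

lemma chart_of_trunc:
  assumes "G \<subseteq> Rm m" "d \<in> Rm m" "p \<in> chart_of G d"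
  shows "trunc m p \<in> chart_of G d"
proof -
  have "g (trunc m p) = 0" if "g \<in> G" for g
  proof -
    have "g (trunc m p) = g p" using assms(1) that by (intro Rm_trunc) blast
    also have "g p = 0" using assms(3) that by (simp add: chart_of_def)
    finally show ?thesis .
  qed
  moreover have "d (trunc m p) \<noteq> 0" using assms(3) Rm_trunc[OF assms(2), of p] by (simp add: chart_of_def)
  ultimately show ?thesis unfolding chart_of_def by blast
qed

lemma zero_set_saturate_vanish:
  fixes d :: "'k::idom jpt \<Rightarrow> 'k"
  assumes van: "\<exists>N. (\<lambda>q. d q ^ N * u q ^ 2) \<in> gen_ideal m G"
    and u: "u \<in> Rm m" and p: "p \<in> zero_set m (saturate m (gen_ideal m G) d)"
  shows "u p = 0"
proof -
  have "(\<lambda>q. u q ^ 2) \<in> saturate m (gen_ideal m G) d" using van Rm_power[OF u] by (auto simp: saturate_def)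
  moreover have "\<forall>f\<in>saturate m (gen_ideal m G) d. f p = 0" using p by (simp add: zero_set_def)
  ultimately have "u p ^ 2 = 0" by (rule bspec[rotated])
  then show ?thesis by simp
qed

text \<open>By \<open>van\<close>, a function that vanishes on the chart vanishes on the zero set of
  the saturation, which is thus the closure of the chart. Nonvanishing can be tested on the chart,
  so irreducibility passes to the closure.\<close>

lemma saturate_irreducible:
  fixes d :: "'k::idom jpt \<Rightarrow> 'k"
  assumes G: "G \<subseteq> Rm m" "d \<in> Rm m" "chart_of G d \<noteq> {}"
    and van: "\<And>u. u \<in> Rm m \<Longrightarrow> (\<And>p. p \<in> chart_of G d \<Longrightarrow> u p = 0) \<Longrightarrow> \<exists>N. (\<lambda>q. d q ^ N * u q ^ 2) \<in> gen_ideal m G"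
    and irr: "\<And>u v p q. u \<in> Rm m \<Longrightarrow> v \<in> Rm m \<Longrightarrow> p \<in> chart_of G d \<Longrightarrow> q \<in> chart_of G d \<Longrightarrow> u p \<noteq> 0 \<Longrightarrow> v q \<noteq> 0 \<Longrightarrow>
       \<exists>r\<in>chart_of G d. u r \<noteq> 0 \<and> v r \<noteq> 0"
  shows "irreducible_closed m (zero_set m (saturate m (gen_ideal m G) d))" (is "irreducible_closed m ?Z")
proof (rule irreducible_closedI)
  show "zariski_closed m ?Z"
    unfolding zariski_closed_def by (rule exI[of _ "saturate m (gen_ideal m G) d"]) (simp add: saturate_def)
  have tr: "trunc m p \<in> ?Z" if "p \<in> chart_of G d" for p
    using chart_in_zero_set_saturate[OF chart_of_trunc[OF G(1,2) that] trunc_jet_space] .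
  then show "?Z \<noteq> {}" using G(3) by blast
  fix f g p q assume f: "f \<in> Rm m" "g \<in> Rm m" "p \<in> ?Z" "q \<in> ?Z" "f p \<noteq> 0" "g q \<noteq> 0"
  have "\<exists>p\<in>chart_of G d. u p \<noteq> 0" if u: "u \<in> Rm m" "p \<in> ?Z" "u p \<noteq> 0" for u p
  proof (rule ccontr)
    assume "\<not> ?thesis"
    then have "u p = 0" if "p \<in> chart_of G d" for p using that by blast
    from zero_set_saturate_vanish[OF van[OF u(1) this] u(1,2)] u(3) show False by blast
  qed
  from this[OF f(1,3,5)] this[OF f(2,4,6)] obtain p' q' where
    pq: "p' \<in> chart_of G d" "q' \<in> chart_of G d" "f p' \<noteq> 0" "g q' \<noteq> 0" by blast
  obtain r where "r \<in> chart_of G d" "f r \<noteq> 0" "g r \<noteq> 0" using irr[OF f(1,2) pq] by blast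
  then show "\<exists>r\<in>?Z. f r \<noteq> 0 \<and> g r \<noteq> 0"
    using tr Rm_trunc[OF f(1)] Rm_trunc[OF f(2)] by (intro bexI[of _ "trunc m r"]) auto
qed

section \<open>Low coefficients and the closures of the line charts\<close>

context char_two
begin

lemma jf_2: "a 0 = 0 \<Longrightarrow> b 0 = 0 \<Longrightarrow> c 0 = 0 \<Longrightarrow> jf A B C 2 (a, b, c) = (a 1 :: 'k) ^ 2"
proof -
  assume 0: "a 0 = 0" "b 0 = 0" "c 0 = 0"
  define a' b' c' where "a' = Abs_fps (\<lambda>k. a (k + 1))" "b' = Abs_fps (\<lambda>k. b (k + 1))" "c' = Abs_fps (\<lambda>k. c (k + 1))"
  have e: "Abs_fps a = fps_X ^ 1 * a'" "Abs_fps b = fps_X ^ 1 * b'" "Abs_fps c = fps_X ^ 1 * c'"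
    unfolding a'_b'_c'_def by (rule fps_X_power_dvdI; use 0 in simp)+
  define R where "R = b'^2 * c' + b' * c'^2 + a' * (A * b'^2 + B * b' * c' + C * c'^2)"
  have "jg A B C (Abs_fps a) (Abs_fps b) (Abs_fps c) = fps_X ^ 2 * a'^2 + fps_X ^ 3 * R"
    unfolding e jg_def R_def by (simp add: algebra_simps eval_nat_numeral)
  moreover have "fps_nth (a'^2) 0 = a 1 ^ 2" by (simp add: fps_power_zeroth a'_b'_c'_def)
  ultimately show ?thesis by (simp add: jf_simps fps_X_power_mult_nth)
qed

lemma jf_4:
  assumes "a 0 = 0" "a 1 = 0" "b 0 = 0" "b 1 = 0" "c 0 = 0" "c 1 = 0"
  shows "jf A B C 4 (a, b, c) = (a 2 :: 'k) ^ 2"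
proof -
  define a' b' c' where "a' = Abs_fps (\<lambda>k. a (k + 2))" "b' = Abs_fps (\<lambda>k. b (k + 2))" "c' = Abs_fps (\<lambda>k. c (k + 2))"
  have e: "Abs_fps a = fps_X ^ 2 * a'" "Abs_fps b = fps_X ^ 2 * b'" "Abs_fps c = fps_X ^ 2 * c'"
    unfolding a'_b'_c'_def by (rule fps_X_power_dvdI; use assms in \<open>auto simp: less_2_cases_iff\<close>)+
  define R where "R = b'^2 * c' + b' * c'^2 + a' * (A * b'^2 + B * b' * c' + C * c'^2)"
  have "jg A B C (Abs_fps a) (Abs_fps b) (Abs_fps c) = fps_X ^ 4 * a'^2 + fps_X ^ 6 * R"
    unfolding e jg_def R_def by (simp add: algebra_simps eval_nat_numeral)
  moreover have "fps_nth (a'^2) 0 = a 2 ^ 2" by (simp add: fps_power_zeroth a'_b'_c'_def numeral_2_eq_2)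
  ultimately show ?thesis by (simp add: jf_simps fps_X_power_mult_nth)
qed

text \<open>On the locus of the first line the fifth coefficient is divisible by
  \<open>zv 1\<close>, and this is the quotient. It vanishes on the chart and hence on its closure,
  while the term \<open>yv 2 ^ 2\<close> keeps it from vanishing on all jets of order 2.\<close>

definition line_quintic :: "'k fps \<Rightarrow> 'k fps \<Rightarrow> 'k jpt \<Rightarrow> 'k" where
  "line_quintic B C p = yv 2 p ^ 2 + yv 3 p * zv 1 p + fps_nth B 0 * (xv 2 p * yv 2 p) +
     fps_nth C 0 * (xv 3 p * zv 1 p) + fps_nth C 1 * (xv 2 p * zv 1 p)"

lemma line_quintic_Rm: "3 \<le> M \<Longrightarrow> line_quintic B C \<in> Rm M"
  unfolding line_quintic_def[abs_def] by (intro Rm.add Rm.mult Rm.const Rm_power Rm.varx Rm.vary Rm.varz) auto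

lemma jf_5:
  assumes "a 0 = 0" "a 1 = 0" "b 0 = 0" "b 1 = 0" "c 0 = 0"
  shows "jf A B C 5 (a, b, c) = c 1 * line_quintic B C (a, b, c)"
proof -
  define a' b' c' where "a' = Abs_fps (\<lambda>i. a (i + 2))" "b' = Abs_fps (\<lambda>i. b (i + 2))" "c' = Abs_fps (\<lambda>i. c (i + 1))"
  have e: "Abs_fps a = fps_X ^ 2 * a'" "Abs_fps b = fps_X ^ 2 * b'" "Abs_fps c = fps_X ^ 1 * c'"
    unfolding a'_b'_c'_def by (rule fps_X_power_dvdI; use assms in \<open>auto simp: less_2_cases_iff\<close>)+
  define R where "R = a'^2 + b' * c'^2 + C * a' * c'^2"
  have "jg A B C (Abs_fps a) (Abs_fps b) (Abs_fps c) = fps_X ^ 4 * R +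
     fps_X ^ 5 * (b'^2 * c' + B * a' * b' * c') + fps_X ^ 6 * (A * a' * b'^2)"
    unfolding e jg_def R_def by (simp add: algebra_simps eval_nat_numeral)
  then have "jf A B C 5 (a, b, c) = fps_nth R 1 + fps_nth (b'^2 * c' + B * a' * b' * c') 0"
    by (simp add: jf_simps fps_X_power_mult_nth)
  moreover have sq1: "fps_nth (F ^ 2) 1 = 0" for F :: "'k fps"
    by (simp add: power2_eq_square fps_mult_nth_1 mult.commute[of "fps_nth F (Suc 0)"])
  have "fps_nth R 1 = b 3 * c 1 ^ 2 + (fps_nth C 0 * a 3 + fps_nth C 1 * a 2) * c 1 ^ 2"
    by (simp only: R_def fps_add_nth fps_mult_nth_1 sq1 fps_mult_nth_0 fps_power_zeroth)
      (simp add: a'_b'_c'_def eval_nat_numeral)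
  moreover have "fps_nth (b'^2 * c' + B * a' * b' * c') 0 = b 2 ^ 2 * c 1 + fps_nth B 0 * a 2 * b 2 * c 1"
    by (simp add: fps_mult_nth_0 fps_power_zeroth a'_b'_c'_def numeral_2_eq_2)
  ultimately show ?thesis by (simp add: line_quintic_def power2_eq_square algebra_simps)
qed

lemma line_quintic_vanish:
  assumes "on_line A B C n p" "zv 1 p \<noteq> 0" "5 < n"
  shows "line_quintic B C p = 0"
proof -
  obtain a b c where p: "p = (a, b, c)" by (cases p)
  have "jf A B C 5 p = 0" using assms by simp
  then show ?thesis using jf_5[of a b c A B C] assms by (simp add: p)
qed

lemma chart_of_line: "p \<in> chart_of (line_gens A B C n) (zv 1) \<longleftrightarrow> on_line A B C n p \<and> zv 1 p \<noteq> 0"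
  by (auto simp: chart_of_def line_gens_def jset_def)

lemma chart_of_line2:
  "p \<in> chart_of (line2_gens A B C n) (yv 1) \<longleftrightarrow> on_line C B A n (swapj p) \<and> zv 1 (swapj p) \<noteq> 0"
  by (auto simp: chart_of_def line2_gens_def jset_def jf_swapj)

lemma chart_of_line3:
  "p \<in> chart_of (line3_gens A B C n) (yv 1) \<longleftrightarrow> on_line C B (A + B + C) n (shearj p) \<and> zv 1 (shearj p) \<noteq> 0"
  by (auto simp: chart_of_def line3_gens_def jset_def jf_shearj[of A B C])

lemma gens_Rm:
  fixes A B C :: "'k fps"
  assumes "n \<le> m + 1" "1 \<le> m"
  shows "line_gens A B C n \<subseteq> Rm m" "line2_gens A B C n \<subseteq> Rm m" "line3_gens A B C n \<subseteq> Rm m"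
  using jset_Rm[of n m A B C] assms by (auto simp: line_gens_def line2_gens_def line3_gens_def intro: Rm.intros)

lemma line_components_irreducible:
  fixes A B C :: "'k fps"
  assumes n: "n \<le> m + 1" "1 \<le> m"
  shows "irreducible_closed m (zero_set m (saturate m (gen_ideal m (line_gens A B C n)) (zv 1)))"
    and "irreducible_closed m (zero_set m (saturate m (gen_ideal m (line2_gens A B C n)) (yv 1)))"
    and "irreducible_closed m (zero_set m (saturate m (gen_ideal m (line3_gens A B C n)) (yv 1)))"
proof -
  note R = gens_Rm[OF n, of A B C]
  have d: "zv 1 \<in> Rm m" "yv 1 \<in> Rm m" using n by (auto intro: Rm.intros)
  show "irreducible_closed m (zero_set m (saturate m (gen_ideal m (line_gens A B C n)) (zv 1)))"
  proof (rule saturate_irreducible[OF R(1) d(1)])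
    show "chart_of (line_gens A B C n) (zv 1) \<noteq> {}"
      using line_chart_nonempty[where A = A and B = B and C = C and n = n] chart_of_line by blast
  next
    fix u :: "'k jpt \<Rightarrow> 'k" assume u: "u \<in> Rm m" "\<And>p. p \<in> chart_of (line_gens A B C n) (zv 1) \<Longrightarrow> u p = 0"
    show "\<exists>N. (\<lambda>q. zv 1 q ^ N * u q ^ 2) \<in> gen_ideal m (line_gens A B C n)"
      by (rule line_chart_vanish[OF n u(1)]) (use u(2) chart_of_line in blast)
  next
    fix u v :: "'k jpt \<Rightarrow> 'k" and p q
    assume "u \<in> Rm m" "v \<in> Rm m" "p \<in> chart_of (line_gens A B C n) (zv 1)"
      "q \<in> chart_of (line_gens A B C n) (zv 1)" "u p \<noteq> 0" "v q \<noteq> 0"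
    then show "\<exists>r\<in>chart_of (line_gens A B C n) (zv 1). u r \<noteq> 0 \<and> v r \<noteq> 0"
      using line_chart_irreducible[OF n, where u = u and v = v and A = A and B = B and C = C and p = p and q = q] unfolding chart_of_line Bex_def by blast
  qed
  show "irreducible_closed m (zero_set m (saturate m (gen_ideal m (line2_gens A B C n)) (yv 1)))"
  proof (rule saturate_irreducible[OF R(2) d(2)])
    obtain p where "on_line C B A n p \<and> zv 1 p \<noteq> 0" using line_chart_nonempty by blast
    then have "swapj p \<in> chart_of (line2_gens A B C n) (yv 1)" unfolding chart_of_line2 swapj_swapj .
    then show "chart_of (line2_gens A B C n) (yv 1) \<noteq> {}" by blast
  next
    fix u :: "'k jpt \<Rightarrow> 'k" assume u: "u \<in> Rm m" "\<And>p. p \<in> chart_of (line2_gens A B C n) (yv 1) \<Longrightarrow> u p = 0"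
    have "u (swapj p) = 0" if "on_line C B A n p" "zv 1 p \<noteq> 0" for p
      by (rule u(2)) (use that in \<open>simp only: chart_of_line2 swapj_swapj, blast\<close>)
    then show "\<exists>N. (\<lambda>q. yv 1 q ^ N * u q ^ 2) \<in> gen_ideal m (line2_gens A B C n)"
      by (rule line2_chart_vanish[OF n u(1)])
  next
    fix u v :: "'k jpt \<Rightarrow> 'k" and p q
    assume uv: "u \<in> Rm m" "v \<in> Rm m" and pq: "p \<in> chart_of (line2_gens A B C n) (yv 1)"
      "q \<in> chart_of (line2_gens A B C n) (yv 1)" "u p \<noteq> 0" "v q \<noteq> 0"
    obtain r where r: "on_line C B A n r" "zv 1 r \<noteq> 0" "u (swapj r) \<noteq> 0" "v (swapj r) \<noteq> 0"
      using line_chart_irreducible[OF n Rm_swapj[OF uv(1)] Rm_swapj[OF uv(2)], where A = C and B = B and C = A and p = "swapj p" and q = "swapj q"]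
        pq unfolding chart_of_line2 swapj_swapj by blast
    have "swapj r \<in> chart_of (line2_gens A B C n) (yv 1)" unfolding chart_of_line2 swapj_swapj using r by blast
    then show "\<exists>r\<in>chart_of (line2_gens A B C n) (yv 1). u r \<noteq> 0 \<and> v r \<noteq> 0" using r by blast
  qed
  show "irreducible_closed m (zero_set m (saturate m (gen_ideal m (line3_gens A B C n)) (yv 1)))"
  proof (rule saturate_irreducible[OF R(3) d(2)])
    obtain p where "on_line C B (A + B + C) n p \<and> zv 1 p \<noteq> 0" using line_chart_nonempty by blast
    then have "unshearj p \<in> chart_of (line3_gens A B C n) (yv 1)" unfolding chart_of_line3 shearj_unshearj .
    then show "chart_of (line3_gens A B C n) (yv 1) \<noteq> {}" by blast
  next
    fix u :: "'k jpt \<Rightarrow> 'k" assume u: "u \<in> Rm m" "\<And>p. p \<in> chart_of (line3_gens A B C n) (yv 1) \<Longrightarrow> u p = 0"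
    have "u (unshearj p) = 0" if "on_line C B (A + B + C) n p" "zv 1 p \<noteq> 0" for p
      by (rule u(2)) (use that in \<open>simp only: chart_of_line3 shearj_unshearj, blast\<close>)
    then show "\<exists>N. (\<lambda>q. yv 1 q ^ N * u q ^ 2) \<in> gen_ideal m (line3_gens A B C n)"
      by (rule line3_chart_vanish[OF n u(1)])
  next
    fix u v :: "'k jpt \<Rightarrow> 'k" and p q
    assume uv: "u \<in> Rm m" "v \<in> Rm m" and pq: "p \<in> chart_of (line3_gens A B C n) (yv 1)"
      "q \<in> chart_of (line3_gens A B C n) (yv 1)" "u p \<noteq> 0" "v q \<noteq> 0"
    obtain r where r: "on_line C B (A + B + C) n r" "zv 1 r \<noteq> 0" "u (unshearj r) \<noteq> 0" "v (unshearj r) \<noteq> 0"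
      using line_chart_irreducible[OF n Rm_unshearj[OF uv(1)] Rm_unshearj[OF uv(2)], where A = C and B = B and C = "A + B + C" and p = "shearj p" and q = "shearj q"]
        pq unfolding chart_of_line3 shearj_unshearj by blast
    have "unshearj r \<in> chart_of (line3_gens A B C n) (yv 1)" unfolding chart_of_line3 shearj_unshearj using r by blast
    then show "\<exists>r\<in>chart_of (line3_gens A B C n) (yv 1). u r \<noteq> 0 \<and> v r \<noteq> 0" using r by blast
  qed
qed

text \<open>The charts of \<open>yv 0\<close> and \<open>zv 0\<close> are irreducible and overlap,
  so nonvanishing on the former can be moved to the latter, where irreducibility applies
  directly.\<close>

lemma smooth_locus_irreducible:
  assumes ABC: "fps_nth A 0 = 0" "fps_nth B 0 = 0" "fps_nth C 0 = 0" and n: "n \<le> M + 1"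
    and uv: "u \<in> Rm M" "v \<in> Rm M"
    and p: "on_jets A B C n p" "yv 0 p \<noteq> 0 \<or> zv 0 p \<noteq> 0" "u p \<noteq> 0"
    and q: "on_jets A B C n q" "yv 0 q \<noteq> 0 \<or> zv 0 q \<noteq> 0" "v q \<noteq> 0"
  shows "\<exists>r. on_jets A B C n r \<and> u r \<noteq> 0 \<and> v r \<noteq> 0"
proof -
  \<comment> \<open>A point of the overlap: \<open>yv 0\<close> and \<open>zv 0\<close> are free
    coordinates, so lifting a jet where both are 1 preserves them.\<close>
  have both: "\<exists>s. on_jets C B A n s \<and> yv 0 s \<noteq> 0 \<and> zv 0 s \<noteq> 0"
  proof -
    interpret graph_chart K M "{i. i = 0 \<and> 0 < n}" "{j. 0 < j \<and> j < n}" "{}" "gen_ideal M (jset C B A n)" "zv 0"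
      by (rule smooth_chart(1)[OF ABC(3,2,1) n])
    define t :: "'k jpt" where "t = (\<lambda>_. 0, \<lambda>_. 1, \<lambda>_. 1)"
    have "zv 0 t \<noteq> 0" by (simp add: t_def)
    from lift[OF this] obtain s where s: "\<forall>u\<in>gen_ideal M (jset C B A n). u s = 0"
      "mix {i. i = 0 \<and> 0 < n} {j. 0 < j \<and> j < n} {} origin s = mix {i. i = 0 \<and> 0 < n} {j. 0 < j \<and> j < n} {} origin t"
      by blast
    have "yv 0 s = yv 0 t" "zv 0 s = zv 0 t" using arg_cong[OF s(2), of "yv 0"] arg_cong[OF s(2), of "zv 0"] by simp_all
    then show ?thesis using s(1) unfolding gen_ideal_zero_iff
      by (intro exI[of _ s]) (auto simp: t_def jset_def)
  qed
  have toZ: "\<exists>r. on_jets A B C n r \<and> zv 0 r \<noteq> 0 \<and> w r \<noteq> 0"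
    if w: "w \<in> Rm M" "on_jets A B C n r" "yv 0 r \<noteq> 0 \<or> zv 0 r \<noteq> 0" "w r \<noteq> 0" for w r
  proof (cases "zv 0 r = 0")
    case True
    then have y: "yv 0 r \<noteq> 0" using w by simp
    obtain s where s: "on_jets C B A n s" "yv 0 s \<noteq> 0" "zv 0 s \<noteq> 0" using both by blast
    have "\<exists>r. on_jets C B A n r \<and> zv 0 r \<noteq> 0 \<and> w (swapj r) \<noteq> 0 \<and> yv 0 r \<noteq> 0"
      by (rule smooth_chart_irreducible[OF ABC(3,2,1) n Rm_swapj[OF w(1)], of "yv 0" "swapj r" s])
        (use w y s in \<open>auto simp: jf_swapj intro: Rm.vary\<close>)
    then obtain r' where "on_jets C B A n r'" "w (swapj r') \<noteq> 0" "yv 0 r' \<noteq> 0" by blast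
    then show ?thesis by (intro exI[of _ "swapj r'"]) (simp add: jf_swapj)
  qed (use w in blast)
  obtain p' where "on_jets A B C n p'" "zv 0 p' \<noteq> 0" "u p' \<noteq> 0" using toZ[OF uv(1) p] by blast
  moreover obtain q' where "on_jets A B C n q'" "zv 0 q' \<noteq> 0" "v q' \<noteq> 0" using toZ[OF uv(2) q] by blast
  ultimately show ?thesis using smooth_chart_irreducible[OF ABC n uv] by blast
qed

section \<open>The components in terms of charts and shifted jets\<close>

lemma on_jets_trunc: "n \<le> m + 1 \<Longrightarrow> on_jets A B C n (trunc m p) \<longleftrightarrow> on_jets A B C n (p :: 'k jpt)"
  using Rm_trunc[OF jf_Rm[of _ m A B C], of _ p] by auto

lemma Gm_jset: "Gm m = jset 0 1 0 (Suc m)"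
  by (simp add: Gm_eq jset_def)

lemma in_S0: "p \<in> S0 m \<longleftrightarrow> p \<in> jet_space m \<and> xv 0 p = 0 \<and> yv 0 p = 0 \<and> zv 0 p = 0 \<and> on_jets 0 1 0 (Suc m) (p :: 'k jpt)"
  unfolding S0_def Gm_jset zero_set_def by (auto simp: jset_def)

lemma in_Z0: "p \<in> Zm m 0 \<longleftrightarrow> p \<in> jet_space m \<and> xv 0 p = 0 \<and> xv 1 p = 0 \<and> xv 2 p = 0 \<and> yv 0 p = 0 \<and> yv 1 p = 0 \<and>
    zv 0 p = 0 \<and> zv 1 p = 0 \<and> on_jets 0 1 0 (Suc m) (p :: 'k jpt)"
proof -
  have "p \<in> Zm m 0 \<longleftrightarrow> p \<in> jet_space m \<and> (\<forall>f\<in>I0 m. f p = 0)" by (simp add: Zm_def zero_set_def)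
  then show ?thesis unfolding I0_def gen_ideal_zero_iff Gm_jset by (auto simp: jset_def)
qed

lemma Zm_lines:
  "Zm m 1 = zero_set m (saturate m (gen_ideal m (line_gens 0 1 0 (Suc m))) (zv 1))"
  "Zm m 2 = zero_set m (saturate m (gen_ideal m (line2_gens 0 1 0 (Suc m))) (yv 1))"
  "Zm m 3 = zero_set m (saturate m (gen_ideal m (line3_gens 0 1 0 (Suc m))) (yv 1))"
  by (simp_all add: Zm_def I1_def I2_def I3_def J1_def J2_def J3_def line_gens_def line2_gens_def line3_gens_def Gm_jset)

text \<open>Up to coordinates beyond \<open>m\<close>, the shift identifies the component of index 0
  with a jet locus of the same type. A shifted jet may have entries past \<open>m\<close>, hence the
  truncation.\<close>

lemma Z0_shift:
  "(p :: 'k jpt) \<in> Zm m 0 \<Longrightarrow> \<exists>q. shift_jet q = p \<and> on_jets (fps_X * 0) (fps_X * 1) (fps_X * 0) (Suc m - 6) q"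
  "on_jets (fps_X * 0) (fps_X * 1) (fps_X * 0) (Suc m - 6) q \<Longrightarrow> trunc m (shift_jet q) \<in> (Zm m 0 :: 'k jpt set)"
proof -
  assume p: "p \<in> Zm m 0"
  have "i < 3 \<longleftrightarrow> i = 0 \<or> i = 1 \<or> i = 2" for i :: nat by auto
  then have s: "shift_jet (\<lambda>i. xv (i + 3) p, \<lambda>i. yv (i + 2) p, \<lambda>i. zv (i + 2) p) = p"
    using p unfolding in_Z0 by (intro shift_jet_surj) (auto simp: less_2_cases_iff)
  then show "\<exists>q. shift_jet q = p \<and> on_jets (fps_X * 0) (fps_X * 1) (fps_X * 0) (Suc m - 6) q"
    using p unfolding in_Z0 on_jets_shift_jet[symmetric] by (intro exI[of _ "(\<lambda>i. xv (i + 3) p, \<lambda>i. yv (i + 2) p, \<lambda>i. zv (i + 2) p)"]) simp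
next
  assume "on_jets (fps_X * 0) (fps_X * 1) (fps_X * 0) (Suc m - 6) q"
  then have "on_jets 0 1 0 (Suc m) (shift_jet q)" unfolding on_jets_shift_jet .
  then have "on_jets 0 1 0 (Suc m) (trunc m (shift_jet q))" by (subst on_jets_trunc) auto
  then show "trunc m (shift_jet q) \<in> (Zm m 0 :: 'k jpt set)"
    unfolding in_Z0 by (auto simp: trunc_jet_space) (auto simp: trunc_def)
qed

text \<open>After the shift the series have zero constant term, so density moves nonvanishing to the
  smooth locus, whose irreducibility gives a common point.\<close>

lemma Z0_irreducible:
  assumes "2 \<le> m"
  shows "irreducible_closed m (Zm m 0 :: 'k jpt set)"
proof (rule irreducible_closedI)
  have "{xv 0, xv 1, xv 2, yv 0, yv 1, zv 0, zv 1} \<union> Gm m \<subseteq> (Rm m :: ('k jpt \<Rightarrow> 'k) set)"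
    using assms jset_Rm[of "Suc m" m] unfolding Gm_jset by (auto intro: Rm.intros)
  from is_idealD(1)[OF gen_ideal_is_ideal[OF this]] have "I0 m \<subseteq> (Rm m :: ('k jpt \<Rightarrow> 'k) set)"
    unfolding I0_def by blast
  then show "zariski_closed m (Zm m 0 :: 'k jpt set)"
    unfolding zariski_closed_def Zm_def by auto
  have "Abs_fps (\<lambda>_. 0 :: 'k) = 0" by (simp add: fps_eq_iff)
  then have "origin \<in> (Zm m 0 :: 'k jpt set)"
    unfolding in_Z0 by (simp add: origin_def jet_space_def jf_def jg_def)
  then show "(Zm m 0 :: 'k jpt set) \<noteq> {}" by blast
  fix f g :: "'k jpt \<Rightarrow> 'k" and p q
  assume fg: "f \<in> Rm m" "g \<in> Rm m" "p \<in> Zm m 0" "q \<in> Zm m 0" "f p \<noteq> 0" "g q \<noteq> 0"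
  let ?W = "on_jets (fps_X * 0) (fps_X * 1) (fps_X * 0) (Suc m - 6)"
  have good: "\<exists>r. ?W r \<and> (yv 0 r \<noteq> 0 \<or> zv 0 r \<noteq> 0) \<and> u (shift_jet r) \<noteq> 0"
    if us: "u \<in> Rm m" "s \<in> Zm m 0" "u s \<noteq> 0" for u s
  proof (rule ccontr)
    assume "\<not> ?thesis"
    then have *: "\<And>r. ?W r \<Longrightarrow> yv 0 r \<noteq> 0 \<or> zv 0 r \<noteq> 0 \<Longrightarrow> u (shift_jet r) = 0" by blast
    obtain s' where s': "shift_jet s' = s" "?W s'" using Z0_shift(1)[OF us(2)] by blast
    have "u (shift_jet s') = 0"
      by (rule smooth_locus_dense[OF _ _ _ Rm_shift_jet[OF us(1)] * s'(2)]) auto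
    then show False using us(3) s'(1) by simp
  qed
  obtain r s where r: "?W r" "yv 0 r \<noteq> 0 \<or> zv 0 r \<noteq> 0" "f (shift_jet r) \<noteq> 0"
    and s: "?W s" "yv 0 s \<noteq> 0 \<or> zv 0 s \<noteq> 0" "g (shift_jet s) \<noteq> 0"
    using good[OF fg(1,3,5)] good[OF fg(2,4,6)] by blast
  have "\<exists>t. ?W t \<and> f (shift_jet t) \<noteq> 0 \<and> g (shift_jet t) \<noteq> 0"
    by (rule smooth_locus_irreducible[OF _ _ _ _ Rm_shift_jet[OF fg(1)] Rm_shift_jet[OF fg(2)] r s]) auto
  then obtain t where "?W t" "f (shift_jet t) \<noteq> 0" "g (shift_jet t) \<noteq> 0" by blast
  then show "\<exists>r\<in>Zm m 0. f r \<noteq> 0 \<and> g r \<noteq> 0"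
    using Z0_shift(2)[of m t] Rm_trunc[OF fg(1)] Rm_trunc[OF fg(2)]
    by (intro bexI[of _ "trunc m (shift_jet t)"]) simp_all
qed

end

section \<open>The decomposition of the singular fiber\<close>

context char_two
begin

lemma Zm_line_vanish:
  assumes m: "1 \<le> m"
  shows "p \<in> (Zm m 1 :: 'k jpt set) \<Longrightarrow> \<forall>g\<in>line_gens 0 1 0 (Suc m). g p = 0"
    and "p \<in> (Zm m 2 :: 'k jpt set) \<Longrightarrow> \<forall>g\<in>line2_gens 0 1 0 (Suc m). g p = 0"
    and "p \<in> (Zm m 3 :: 'k jpt set) \<Longrightarrow> \<forall>g\<in>line3_gens 0 1 0 (Suc m). g p = 0"
proof -
  note R = gens_Rm[OF _ m, of "Suc m" 0 1 0, simplified]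
  show "p \<in> (Zm m 1 :: 'k jpt set) \<Longrightarrow> \<forall>g\<in>line_gens 0 1 0 (Suc m). g p = 0"
    unfolding Zm_lines by (blast intro: zero_set_saturate_subset[OF R(1)])
  show "p \<in> (Zm m 2 :: 'k jpt set) \<Longrightarrow> \<forall>g\<in>line2_gens 0 1 0 (Suc m). g p = 0"
    unfolding Zm_lines by (blast intro: zero_set_saturate_subset[OF R(2)])
  show "p \<in> (Zm m 3 :: 'k jpt set) \<Longrightarrow> \<forall>g\<in>line3_gens 0 1 0 (Suc m). g p = 0"
    unfolding Zm_lines by (blast intro: zero_set_saturate_subset[OF R(3)])
qed

lemma Zm_subset_S0:
  assumes m: "1 \<le> m" and i: "i < 4"
  shows "(Zm m i :: 'k jpt set) \<subseteq> S0 m"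
proof
  fix p :: "'k jpt" assume p: "p \<in> Zm m i"
  have jet: "p \<in> jet_space m" using p by (auto simp: Zm_def zero_set_def)
  have "i = 0 \<or> i = 1 \<or> i = 2 \<or> i = 3" using i by linarith
  then have "xv 0 p = 0 \<and> yv 0 p = 0 \<and> zv 0 p = 0 \<and> (\<forall>g\<in>jset 0 1 0 (Suc m). g p = 0)"
  proof (elim disjE)
    assume "i = 0"
    then show ?thesis using p by (auto simp: in_Z0 jset_def)
  next
    assume "i = 1"
    then show ?thesis using Zm_line_vanish(1)[OF m] p unfolding line_gens_def by blast
  next
    assume "i = 2"
    then show ?thesis using Zm_line_vanish(2)[OF m] p unfolding line2_gens_def by blast
  next
    assume "i = 3"
    then show ?thesis using Zm_line_vanish(3)[OF m] p unfolding line3_gens_def by blast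
  qed
  then show "p \<in> S0 m" using jet by (auto simp: in_S0 jset_def)
qed

text \<open>Besides coefficients 2 and 3, coefficient 4 enters: with \<open>yv 1 = zv 1 = 0\<close>
  it is \<open>xv 2 ^ 2\<close>, which puts the jet into the component of index 0.\<close>

lemma S0_subset_Zm:
  assumes m: "4 \<le> m"
  shows "S0 m \<subseteq> (\<Union>i<4. Zm m i :: 'k jpt set)"
proof
  fix p :: "'k jpt" assume p: "p \<in> S0 m"
  obtain a b c where abc: "p = (a, b, c)" by (cases p)
  have jet: "p \<in> jet_space m" and jf: "on_jets 0 1 0 (Suc m) p" and 0: "a 0 = 0" "b 0 = 0" "c 0 = 0"
    using p by (auto simp: in_S0 abc)
  have a1: "a 1 = 0" using jf_2[of a b c 0 1 0] 0 jf m by (simp add: abc)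
  have "b 1 ^ 2 * c 1 + b 1 * c 1 ^ 2 = 0" using jf_3[of a b c 0 1 0] 0 a1 jf m by (simp add: abc)
  then have "b 1 * c 1 * (b 1 + c 1) = 0" by (simp add: power2_eq_square algebra_simps)
  then consider "b 1 = 0" "c 1 = 0" | "b 1 = 0" "c 1 \<noteq> 0" | "c 1 = 0" "b 1 \<noteq> 0" | "b 1 + c 1 = 0" "b 1 \<noteq> 0" by auto
  then have "\<exists>i<4. p \<in> Zm m i"
  proof cases
    case 1
    then have "a 2 = 0" using jf_4[of a b c 0 1 0] 0 a1 jf m by (simp add: abc)
    then have "p \<in> Zm m 0" using jet jf 0 a1 1 by (simp add: in_Z0 abc)
    then show ?thesis by (intro exI[of _ 0]) simp
  next
    case 2
    then have "p \<in> chart_of (line_gens 0 1 0 (Suc m)) (zv 1)" 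
      unfolding chart_of_line using jf 0 a1 by (simp add: abc)
    then have "p \<in> Zm m 1" unfolding Zm_lines using jet by (rule chart_in_zero_set_saturate)
    then show ?thesis by (intro exI[of _ 1]) simp
  next
    case 3
    then have "p \<in> chart_of (line2_gens 0 1 0 (Suc m)) (yv 1)"
      unfolding chart_of_line2 using jf 0 a1 by (simp add: jf_swapj abc)
    then have "p \<in> Zm m 2" unfolding Zm_lines using jet by (rule chart_in_zero_set_saturate)
    then show ?thesis by (intro exI[of _ 2]) simp
  next
    case 4
    then have "p \<in> chart_of (line3_gens 0 1 0 (Suc m)) (yv 1)"
      using jf 0 a1 by (auto simp: chart_of_def line3_gens_def jset_def abc)
    then have "p \<in> Zm m 3" unfolding Zm_lines using jet by (rule chart_in_zero_set_saturate)
    then show ?thesis by (intro exI[of _ 3]) simp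
  qed
  then show "p \<in> (\<Union>i<4. Zm m i)" by blast
qed

lemma line_components_points:
  assumes m: "1 \<le> m"
  shows "\<exists>p\<in>Zm m 1. yv 1 p = 0 \<and> zv 1 p \<noteq> (0 :: 'k)"
    and "\<exists>p\<in>Zm m 2. zv 1 p = 0 \<and> yv 1 p \<noteq> (0 :: 'k)"
    and "\<exists>p\<in>Zm m 3. yv 1 p \<noteq> (0 :: 'k) \<and> zv 1 p \<noteq> 0"
proof -
  have tr: "yv 1 (trunc m p) = yv 1 p" "zv 1 (trunc m p) = zv 1 p" for p :: "'k jpt"
    using m by (simp_all add: trunc_def)
  have V: "zv 1 \<in> Rm m" "yv 1 \<in> Rm m" using m by (auto intro: Rm.intros)
  note R = gens_Rm[OF _ m, of "Suc m" 0 1 0, simplified]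
  obtain p :: "'k jpt" where p: "on_line 0 1 0 (Suc m) p" "zv 1 p \<noteq> 0" using line_chart_nonempty by blast
  have "p \<in> chart_of (line_gens 0 1 0 (Suc m)) (zv 1)" unfolding chart_of_line using p by blast
  from chart_in_zero_set_saturate[OF chart_of_trunc[OF R(1) V(1) this] trunc_jet_space]
  have "trunc m p \<in> Zm m 1" unfolding Zm_lines .
  then show "\<exists>p\<in>Zm m 1. yv 1 p = 0 \<and> zv 1 p \<noteq> (0 :: 'k)" using p tr by (intro bexI[of _ "trunc m p"]) auto
  have "swapj p \<in> chart_of (line2_gens 0 1 0 (Suc m)) (yv 1)" unfolding chart_of_line2 swapj_swapj using p by blast
  from chart_in_zero_set_saturate[OF chart_of_trunc[OF R(2) V(2) this] trunc_jet_space]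
  have "trunc m (swapj p) \<in> Zm m 2" unfolding Zm_lines .
  then show "\<exists>p\<in>Zm m 2. zv 1 p = 0 \<and> yv 1 p \<noteq> (0 :: 'k)" using p tr by (intro bexI[of _ "trunc m (swapj p)"]) auto
  obtain q :: "'k jpt" where q: "on_line 0 1 (0 + 1 + 0) (Suc m) q" "zv 1 q \<noteq> 0" using line_chart_nonempty by blast
  have "unshearj q \<in> chart_of (line3_gens 0 1 0 (Suc m)) (yv 1)" unfolding chart_of_line3 shearj_unshearj using q by blast
  from chart_in_zero_set_saturate[OF chart_of_trunc[OF R(3) V(2) this] trunc_jet_space]
  have "trunc m (unshearj q) \<in> Zm m 3" unfolding Zm_lines .
  then show "\<exists>p\<in>Zm m 3. yv 1 p \<noteq> (0 :: 'k) \<and> zv 1 p \<noteq> 0" using q tr by (intro bexI[of _ "trunc m (unshearj q)"]) auto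
qed

text \<open>\<open>line_quintic\<close>, transported by the symmetry of the line in question,
  vanishes on that line component but is 1 at the jet \<open>y = t^2\<close>,
  \<open>x = z = 0\<close>, or at its swap for the second line. Coefficient 5 is among the equations
  because \<open>5 \<le> m\<close>.\<close>

lemma Z0_not_subset:
  assumes m: "5 \<le> m"
  shows "\<not> Zm m 0 \<subseteq> (Zm m 1 :: 'k jpt set)" "\<not> Zm m 0 \<subseteq> (Zm m 2 :: 'k jpt set)" "\<not> Zm m 0 \<subseteq> (Zm m 3 :: 'k jpt set)"
proof -
  have m1: "Suc m \<le> m + 1" "1 \<le> m" "3 \<le> m" "5 < Suc m" using m by auto
  define e :: "nat \<Rightarrow> 'k" where "e i = (if i = 2 then 1 else 0)" for i
  define p :: "'k jpt" where "p = (\<lambda>_. 0, e, \<lambda>_. 0)"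
  have "Abs_fps (\<lambda>_. 0 :: 'k) = 0" by (simp add: fps_eq_iff)
  then have p: "p \<in> Zm m 0" "swapj p \<in> Zm m 0"
    unfolding in_Z0 using m by (simp_all add: p_def e_def swapj_def jet_space_def jf_def jg_def)
  show "\<not> Zm m 0 \<subseteq> (Zm m 1 :: 'k jpt set)"
  proof
    assume "Zm m 0 \<subseteq> (Zm m 1 :: 'k jpt set)"
    with p have "p \<in> Zm m 1" by blast
    moreover have "\<exists>N. (\<lambda>q. zv 1 q ^ N * line_quintic 1 0 q ^ 2) \<in> gen_ideal m (line_gens 0 1 0 (Suc m))"
      by (rule line_chart_vanish[OF m1(1,2) line_quintic_Rm[OF m1(3)]]) (rule line_quintic_vanish[OF _ _ m1(4)])
    ultimately have "line_quintic 1 0 p = 0"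
      unfolding Zm_lines by (intro zero_set_saturate_vanish[OF _ line_quintic_Rm[OF m1(3)]])
    then show False by (simp add: line_quintic_def p_def e_def)
  qed
  show "\<not> Zm m 0 \<subseteq> (Zm m 2 :: 'k jpt set)"
  proof
    assume "Zm m 0 \<subseteq> (Zm m 2 :: 'k jpt set)"
    with p have "swapj p \<in> Zm m 2" by blast
    moreover have "\<exists>N. (\<lambda>q. yv 1 q ^ N * line_quintic 1 0 (swapj q) ^ 2) \<in> gen_ideal m (line2_gens 0 1 0 (Suc m))"
      by (rule line2_chart_vanish[OF m1(1,2) Rm_swapj[OF line_quintic_Rm[OF m1(3)]]])
        (unfold swapj_swapj, rule line_quintic_vanish[OF _ _ m1(4)])
    ultimately have "line_quintic 1 0 (swapj (swapj p)) = 0"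
      unfolding Zm_lines by (intro zero_set_saturate_vanish[OF _ Rm_swapj[OF line_quintic_Rm[OF m1(3)]]])
    then show False by (simp add: line_quintic_def p_def e_def)
  qed
  show "\<not> Zm m 0 \<subseteq> (Zm m 3 :: 'k jpt set)"
  proof
    assume "Zm m 0 \<subseteq> (Zm m 3 :: 'k jpt set)"
    with p have "p \<in> Zm m 3" by blast
    moreover have "\<exists>N. (\<lambda>q. yv 1 q ^ N * line_quintic 1 (0 + 1 + 0) (shearj q) ^ 2) \<in> gen_ideal m (line3_gens 0 1 0 (Suc m))"
      by (rule line3_chart_vanish[OF m1(1,2) Rm_shearj[OF line_quintic_Rm[OF m1(3)]]])
        (unfold shearj_unshearj, rule line_quintic_vanish[OF _ _ m1(4)])
    ultimately have "line_quintic 1 (0 + 1 + 0) (shearj p) = 0"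
      unfolding Zm_lines by (intro zero_set_saturate_vanish[OF _ Rm_shearj[OF line_quintic_Rm[OF m1(3)]]])
    then show False by (simp add: line_quintic_def p_def e_def)
  qed
qed

lemma Zm_irreducible:
  assumes "5 \<le> m" "i < 4"
  shows "irreducible_closed m (Zm m i :: 'k jpt set)"
proof -
  have "i = 0 \<or> i = 1 \<or> i = 2 \<or> i = 3" using assms by linarith
  then show ?thesis
    using assms(1) Z0_irreducible line_components_irreducible[of "Suc m" m 0 1 0, folded Zm_lines] by auto
qed

text \<open>Chart points of the three line components differ in which of \<open>yv 1\<close>,
  \<open>zv 1\<close> and \<open>yv 1 + zv 1\<close> vanishes, and all three vanish on the component
  of index 0. Only the position of that last component calls for the fifth coefficient.\<close>

lemma Zm_not_subset:
  assumes m: "5 \<le> m" and ij: "i < 4" "j < 4" "i \<noteq> j"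
  shows "\<not> Zm m i \<subseteq> (Zm m j :: 'k jpt set)"
proof
  assume sub: "Zm m i \<subseteq> (Zm m j :: 'k jpt set)"
  have m1: "1 \<le> m" using m by simp
  have v0: "yv 1 p = 0" "zv 1 p = 0" if "p \<in> Zm m 0" for p :: "'k jpt" using that by (simp_all add: in_Z0)
  have v1: "yv 1 p = 0" if "p \<in> Zm m 1" for p :: "'k jpt"
    using Zm_line_vanish(1)[OF m1 that] by (simp add: line_gens_def)
  have v2: "zv 1 p = 0" if "p \<in> Zm m 2" for p :: "'k jpt"
    using Zm_line_vanish(2)[OF m1 that] by (simp add: line2_gens_def)
  have v3: "yv 1 p + zv 1 p = 0" if "p \<in> Zm m 3" for p :: "'k jpt"
    using Zm_line_vanish(3)[OF m1 that] by (simp add: line3_gens_def)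
  obtain p1 p2 p3 :: "'k jpt" where p: "p1 \<in> Zm m 1" "yv 1 p1 = 0" "zv 1 p1 \<noteq> 0"
    "p2 \<in> Zm m 2" "zv 1 p2 = 0" "yv 1 p2 \<noteq> 0" "p3 \<in> Zm m 3" "yv 1 p3 \<noteq> 0" "zv 1 p3 \<noteq> 0"
    using line_components_points[OF m1] by blast
  have "i = 0 \<or> i = 1 \<or> i = 2 \<or> i = 3" "j = 0 \<or> j = 1 \<or> j = 2 \<or> j = 3" using ij by linarith+
  then consider "i = 0" "j = 1 \<or> j = 2 \<or> j = 3" | "i = 1" "j = 0 \<or> j = 2 \<or> j = 3"
    | "i = 2" "j = 0 \<or> j = 1 \<or> j = 3" | "i = 3" "j = 0 \<or> j = 1 \<or> j = 2" using ij(3) by blast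
  then show False
  proof cases
    case 1
    then show False using Z0_not_subset[OF m] sub by blast
  next
    case 2
    then have "p1 \<in> Zm m j" using sub p by blast
    then show False using 2(2) v0[of p1] v2[of p1] v3[of p1] p by auto
  next
    case 3
    then have "p2 \<in> Zm m j" using sub p by blast
    then show False using 3(2) v0[of p2] v1[of p2] v3[of p2] p by auto
  next
    case 4
    then have "p3 \<in> Zm m j" using sub p by blast
    then show False using 4(2) v0[of p3] v1[of p3] v2[of p3] p by auto
  qed
qed

end

theorem theorem4p12:
  fixes m :: nat
  assumes "CHAR('k::alg_closed_field) = 2"
    and "m \<ge> 5"
  shows "irreducible_decomposition m (S0 m :: 'k jpt set) (Zm m) 4"
proof -
  interpret char_two "TYPE('k)" by unfold_locales (rule assms(1))
  have "S0 m = (\<Union>i<4. Zm m i :: 'k jpt set)"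
    using S0_subset_Zm[of m] Zm_subset_S0[of m] assms(2) by (intro equalityI UN_least) auto
  then show ?thesis
    unfolding irreducible_decomposition_def using Zm_irreducible[OF assms(2)] Zm_not_subset[OF assms(2)] by blast
qed

end
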